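(* Let $p\ge 5$ be a prime and $\mathcal{K}$ a complete non-Archimedean field of characteristic $p$. Let $\lambda\in\mathcal{K}$ be not a root of unity and satisfy $|1-\lambda|<1$. Let $a_1,a_2\in\mathcal{K}$. If $a_1\neq 0$, $\left|1-\frac{a_2}{a_1^2}\right|\ge 1$ and $\left|1-\frac{a_2}{a_1^2}\right|\neq\frac{1}{|1-\lambda|}$, then the polynomial $\lambda z+a_1z^2+a_2z^3\in\mathcal{K}[z]$ is non-linearizable.
   Context: A power series $f(z)=z(\lambda+\sum_{i\ge1}a_iz^i)\in\mathcal{K}[[z]]$ that is locally analytic at $z=0$ (positive radius of convergence) is called (locally) linearizable at $z=0$ if there is a locally analytic (at $z=0$) power series $h(z)=b_0z+b_1z^2+\cdots\in\mathcal{K}[[z]]$ with $b_0\neq0$ such that $h\circ f\circ h^{-1}(z)=\lambda z$; otherwise it is called non-linearizable. *)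

theory Defs
  imports Complex_Main "HOL-Computational_Algebra.Computational_Algebra"
begin

text \<open>
  The classes below \<^class>\<open>real_normed_vector\<close>, and with them the library's \<open>norm\<close>, are
  restricted to characteristic 0, so the absolute value is a separate class parameter.
  Nonnegativity, definiteness and symmetry of \<open>abs_val\<close> follow from \<open>abs_val_dist\<close> and the
  axioms of \<^class>\<open>metric_space\<close>. The trivial absolute value is not excluded.
\<close>

class nonarchimedean_field = field + metric_space +
  fixes abs_val :: "'a \<Rightarrow> real"
  assumes abs_val_dist: "dist x y = abs_val (x - y)"
    and abs_val_mult: "abs_val (x * y) = abs_val x * abs_val y"
    and abs_val_add_le_max: "abs_val (x + y) \<le> max (abs_val x) (abs_val y)"

class complete_nonarchimedean_field = nonarchimedean_field + complete_space

definition locally_analytic :: "'a::nonarchimedean_field fps \<Rightarrow> bool" where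
  "locally_analytic f \<longleftrightarrow>
     (\<exists>r>0. \<forall>z. abs_val z < r \<longrightarrow> summable (\<lambda>n. fps_nth f n * z ^ n))"

definition analytic_germ_fixing_0 :: "'a::nonarchimedean_field fps \<Rightarrow> bool" where
  "analytic_germ_fixing_0 f \<longleftrightarrow> fps_nth f 0 = 0 \<and> locally_analytic f"

text \<open>The multiplier \<open>\<lambda>\<close> of \<open>f\<close> is its linear coefficient \<open>fps_nth f 1\<close>, and
  \<open>fps_inv h\<close> is the compositional inverse of \<open>h\<close>.\<close>

definition linearizable :: "'a::nonarchimedean_field fps \<Rightarrow> bool" where
  "linearizable f \<longleftrightarrow> analytic_germ_fixing_0 f \<and>
     (\<exists>h. analytic_germ_fixing_0 h \<and> fps_nth h 1 \<noteq> 0 \<and>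
          h oo f oo fps_inv h = fps_const (fps_nth f 1) * fps_X)"

definition non_linearizable :: "'a::nonarchimedean_field fps \<Rightarrow> bool" where
  "non_linearizable f \<longleftrightarrow> analytic_germ_fixing_0 f \<and> \<not> linearizable f"

end

theory Submission
  imports Defs "HOL-Number_Theory.Cong"
begin

text \<open>
  Put \<open>\<epsilon> = \<bar>1 - \<lambda>\<bar>\<close>. For \<open>q = p ^ n\<close> the small divisor \<open>1 - \<lambda> ^ k\<close> has absolute value \<open>\<epsilon> ^ q\<close> if
  \<open>q\<close> exactly divides \<open>k\<close>. Hence coordinate changes \<open>z A(z ^ q)\<close>, integral on a given disc,
  successively bring the map into a form \<open>z G(z ^ q)\<close>. Call a radius critical if \<open>\<bar>G - \<lambda>\<bar> = \<epsilon> ^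
  q\<close> holds there in the Gauss norm. On the critical disc an integral linearization \<open>z B(z ^ q)\<close>
  reduces, over the residue field, to a logarithmic derivative of \<open>B\<close> that equals a nonzero
  polynomial without constant term, of degree less than \<open>p\<close>. This is impossible in
  characteristic \<open>p\<close>, because the \<open>p k\<close>-th coefficient of a logarithmic derivative is the \<open>p\<close>-th
  power of its \<open>k\<close>-th coefficient. The same identity shows that the top coefficient survives in
  the next form, with absolute value \<open>\<epsilon> ^ q\<close> instead of \<open>\<epsilon> ^ (p q)\<close>, so the critical radii
  decrease geometrically to 0, and no disc carries a linearization. To start this process it
  suffices that the first resonant coefficient, at \<open>z ^ (p + 1)\<close>, or the second one, at \<open>z ^ (2
  p + 1)\<close>, is at least \<open>\<epsilon>\<^sup>2\<close> in absolute value on a disc where the nonlinear terms are at most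
  \<open>\<epsilon>\<close>; the condition on \<open>1 - a\<^sub>2 / a\<^sub>1\<^sup>2\<close> ensures this.
\<close>

section \<open>Non-Archimedean absolute values\<close>

text \<open>How \<open>d = |1 - a2 / a1^2|\<close> enters. The first normal form is computed on the
  disc where the larger nonlinear term has size exactly \<open>eps\<close>, the size of the small
  divisors at exponents prime to \<open>p\<close>. For \<open>1 <= d < 1 / eps\<close> this is the
  quadratic term, and the coefficient at index \<open>p\<close> has size \<open>eps^2 * d\<close>;
  so \<open>1 <= d\<close> is what makes it at least \<open>eps^2\<close>. For
  \<open>d > 1 / eps\<close> it is the cubic term, and \<sigma> with
  \<open>\<sigma>^2 = 1 / (eps * d)\<close> is the relative size of the quadratic one. Index
  \<open>p\<close> then carries size \<open>eps * \<sigma>\<close>, which suffices while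
  \<open>\<sigma> > eps\<close>; for smaller \<sigma> the map is almost odd and index
  \<open>2 * p\<close> is used instead. At \<open>d = 1 / eps\<close> both terms have equal size,
  and in the residue field their contributions to index \<open>p\<close> can cancel. Indices
  \<open>p\<close> and \<open>2 * p\<close> become 1 and 2 in the variable \<open>z ^ p\<close>, so
  a form is called critical only if index 1 or 2 dominates. The index \<open>p * J\<close> of the
  next resonance then lies in the negligible range, so that the logarithmic derivative cannot be
  balanced there by the form itself.\<close>

lemma abs_val_0 [simp]: "abs_val (0::'a::nonarchimedean_field) = 0"
  using abs_val_dist[of "0::'a" 0] by simp

lemma abs_val_nonneg [simp]: "abs_val (x::'a::nonarchimedean_field) \<ge> 0"
  using abs_val_dist[of x 0] by (metis diff_zero zero_le_dist)

lemma abs_val_eq_0_iff [simp]: "abs_val (x::'a::nonarchimedean_field) = 0 \<longleftrightarrow> x = 0"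
  using abs_val_dist[of x 0] by (metis diff_zero dist_eq_0_iff)

lemma abs_val_pos_iff [simp]: "abs_val (x::'a::nonarchimedean_field) > 0 \<longleftrightarrow> x \<noteq> 0"
  using abs_val_nonneg[of x] by (simp add: less_le)

lemma abs_val_1 [simp]: "abs_val (1::'a::nonarchimedean_field) = 1"
  using abs_val_mult[of "1::'a" 1] by simp

lemma abs_val_minus [simp]: "abs_val (- x::'a::nonarchimedean_field) = abs_val x"
  using abs_val_dist[of x 0] abs_val_dist[of 0 x] by (simp add: dist_commute)

lemma abs_val_minus_commute: "abs_val (x - y::'a::nonarchimedean_field) = abs_val (y - x)"
  using abs_val_minus[of "x - y"] by simp

lemma abs_val_power: "abs_val (x ^ n::'a::nonarchimedean_field) = abs_val x ^ n"
  by (induction n) (simp_all add: abs_val_mult)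

lemma abs_val_divide: "abs_val (x / y::'a::nonarchimedean_field) = abs_val x / abs_val y"
proof (cases "y = 0")
  case False
  then have "abs_val x = abs_val (x / y) * abs_val y"
    by (simp flip: abs_val_mult)
  then show ?thesis using False by simp
qed simp

lemma abs_val_add_le:
  "abs_val (x::'a::nonarchimedean_field) \<le> C \<Longrightarrow> abs_val y \<le> C \<Longrightarrow> abs_val (x + y) \<le> C"
  using abs_val_add_le_max[of x y] by linarith

lemma abs_val_diff_le:
  "abs_val (x::'a::nonarchimedean_field) \<le> C \<Longrightarrow> abs_val y \<le> C \<Longrightarrow> abs_val (x - y) \<le> C"
  using abs_val_add_le[of x C "- y"] by simp

lemma abs_val_add_less:
  "abs_val (x::'a::nonarchimedean_field) < C \<Longrightarrow> abs_val y < C \<Longrightarrow> abs_val (x + y) < C"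
  using abs_val_add_le_max[of x y] by linarith

lemma abs_val_sum_le:
  assumes "\<And>i. i \<in> I \<Longrightarrow> abs_val (f i::'a::nonarchimedean_field) \<le> C" "0 \<le> C"
  shows "abs_val (sum f I) \<le> C"
  using assms by (induction I rule: infinite_finite_induct) (auto intro: abs_val_add_le)

lemma abs_val_add_eq:
  assumes "abs_val (y::'a::nonarchimedean_field) < abs_val x"
  shows "abs_val (x + y) = abs_val x"
  using assms abs_val_add_le_max[of x y] abs_val_add_le_max[of "x + y" "- y"] by auto

lemma abs_val_eq_of_diff:
  assumes "abs_val (x - y::'a::nonarchimedean_field) < abs_val y"
  shows "abs_val x = abs_val y"
  using abs_val_add_eq[OF assms] by simp

lemma abs_val_of_nat_le: "abs_val (of_nat n::'a::nonarchimedean_field) \<le> 1"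
  by (induction n) (auto intro: abs_val_add_le)

text \<open>\<open>n\<close> has an inverse \<open>m\<close> modulo the characteristic, and two
  factors of absolute value at most 1 with product 1 both have absolute value 1.\<close>

lemma abs_val_of_nat_eq_1:
  assumes "prime CHAR('a::nonarchimedean_field)" "\<not> CHAR('a) dvd n"
  shows "abs_val (of_nat n::'a) = 1"
proof -
  have "coprime n CHAR('a)"
    using prime_imp_coprime[OF assms] by (rule coprime_commute[THEN iffD1])
  then obtain m where "[n * m = 1] (mod CHAR('a))"
    using cong_solve_coprime_nat by (metis One_nat_def)
  then have "of_nat n * of_nat m = (1::'a)"
    by (metis of_nat_1 of_nat_eq_iff_cong_CHAR of_nat_mult)
  then have "abs_val (of_nat n::'a) * abs_val (of_nat m::'a) = 1"
    by (simp flip: abs_val_mult)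
  then show ?thesis
    by (metis abs_val_nonneg abs_val_of_nat_le dual_order.antisym mult.right_neutral mult_left_mono)
qed

section \<open>Gauss norms of power series\<close>

text \<open>The Gauss norm on the disc of radius \<open>r\<close> is at most \<open>C\<close>. It is
  encoded as a relation because the supremum of a formal series may be infinite.\<close>

definition gauss_le :: "real \<Rightarrow> real \<Rightarrow> 'a::nonarchimedean_field fps \<Rightarrow> bool" where
  "gauss_le r C f \<longleftrightarrow> (\<forall>k. abs_val (fps_nth f k) * r ^ k \<le> C)"

lemma gauss_leD: "gauss_le r C f \<Longrightarrow> abs_val (fps_nth f k) * r ^ k \<le> C"
  by (simp add: gauss_le_def)

lemma gauss_le_nonneg: "gauss_le r C f \<Longrightarrow> 0 \<le> C"
  using gauss_leD[of r C f 0] abs_val_nonneg[of "fps_nth f 0"] by (simp del: abs_val_nonneg)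

lemma gauss_le_mono: "gauss_le r C f \<Longrightarrow> C \<le> D \<Longrightarrow> gauss_le r D f"
  unfolding gauss_le_def by (meson order_trans)

lemma gauss_le_0 [simp]: "gauss_le r C 0 \<longleftrightarrow> 0 \<le> C"
  by (simp add: gauss_le_def)

lemma gauss_le_monomial:
  assumes "0 \<le> r" "abs_val c * r ^ n \<le> C"
  shows "gauss_le r C (fps_const c * fps_X ^ n)"
proof -
  have "0 \<le> C" using assms by (meson abs_val_nonneg mult_nonneg_nonneg order_trans zero_le_power)
  then show ?thesis using assms by (auto simp: gauss_le_def fps_X_power_nth)
qed

lemma gauss_le_const: "0 \<le> r \<Longrightarrow> abs_val c \<le> C \<Longrightarrow> gauss_le r C (fps_const c)"
  using gauss_le_monomial[of r c 0 C] by simp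

lemma gauss_le_1: "0 \<le> r \<Longrightarrow> gauss_le r 1 1"
  using gauss_le_const[of r 1 1] by simp

lemma gauss_le_X: "0 \<le> r \<Longrightarrow> gauss_le r r fps_X"
  using gauss_le_monomial[of r 1 1 r] by simp

lemma gauss_le_add:
  assumes "0 \<le> r" "gauss_le r C f" "gauss_le r C g"
  shows "gauss_le r C (f + g)"
  unfolding gauss_le_def
proof
  fix k
  have "abs_val (fps_nth f k + fps_nth g k) * r ^ k \<le>
        max (abs_val (fps_nth f k)) (abs_val (fps_nth g k)) * r ^ k"
    using assms(1) by (intro mult_right_mono abs_val_add_le_max) auto
  also have "\<dots> \<le> C"
    using assms gauss_leD[OF assms(2), of k] gauss_leD[OF assms(3), of k] by (simp add: max_def)
  finally show "abs_val (fps_nth (f + g) k) * r ^ k \<le> C" by simp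
qed

lemma gauss_le_minus [simp]: "gauss_le r C (- f) \<longleftrightarrow> gauss_le r C f"
  by (simp add: gauss_le_def)

lemma gauss_le_diff:
  "0 \<le> r \<Longrightarrow> gauss_le r C f \<Longrightarrow> gauss_le r C g \<Longrightarrow> gauss_le r C (f - g)"
  using gauss_le_add[of r C f "- g"] by simp

lemma abs_val_sum_mult_le:
  assumes "\<And>i. i \<in> I \<Longrightarrow> abs_val (f i::'a::nonarchimedean_field) * c \<le> C" "0 \<le> C" "0 \<le> c"
  shows "abs_val (sum f I) * c \<le> C"
proof (cases "c = 0")
  case False
  then have "abs_val (sum f I) \<le> C / c"
    using assms by (intro abs_val_sum_le) (auto simp: field_simps)
  then show ?thesis using False assms by (simp add: field_simps)
qed (use assms in simp)

lemma gauss_le_mult: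
  assumes "0 \<le> r" "gauss_le r C f" "gauss_le r D g"
  shows "gauss_le r (C * D) (f * g)"
  unfolding gauss_le_def
proof
  fix n
  have "abs_val (fps_nth f i * fps_nth g (n - i)) * r ^ n \<le> C * D" if "i \<in> {0..n}" for i
  proof -
    have "r ^ n = r ^ i * r ^ (n - i)" using that by (simp flip: power_add)
    then have "abs_val (fps_nth f i * fps_nth g (n - i)) * r ^ n =
        (abs_val (fps_nth f i) * r ^ i) * (abs_val (fps_nth g (n - i)) * r ^ (n - i))"
      by (simp add: abs_val_mult mult_ac)
    also have "\<dots> \<le> C * D"
      using assms by (intro mult_mono gauss_leD gauss_le_nonneg[OF assms(2)]) auto
    finally show ?thesis .
  qed
  then show "abs_val (fps_nth (f * g) n) * r ^ n \<le> C * D"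
    unfolding fps_mult_nth using assms gauss_le_nonneg[OF assms(2)] gauss_le_nonneg[OF assms(3)]
    by (intro abs_val_sum_mult_le) auto
qed

lemma gauss_le_mult1:
  "0 \<le> r \<Longrightarrow> gauss_le r C f \<Longrightarrow> gauss_le r 1 g \<Longrightarrow> gauss_le r C (f * g)"
  using gauss_le_mult[of r C f 1 g] by simp

lemma gauss_le_power: "0 \<le> r \<Longrightarrow> gauss_le r C f \<Longrightarrow> gauss_le r (C ^ n) (f ^ n)"
  by (induction n) (auto intro: gauss_le_mult gauss_le_1)

text \<open>The equation \<open>inverse f * f = 1\<close> expresses each coefficient of the inverse
  by products of earlier ones with coefficients of \<open>f\<close>, without any division.\<close>

lemma gauss_le_inverse:
  assumes "0 \<le> r" "gauss_le r 1 f" "fps_nth f 0 = 1"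
  shows "gauss_le r 1 (inverse f)"
proof -
  let ?g = "inverse f"
  have fg: "?g * f = 1" using assms(3) by (simp add: inverse_mult_eq_1)
  have "abs_val (fps_nth ?g n) * r ^ n \<le> 1" for n
  proof (induction n rule: less_induct)
    case (less n)
    show ?case
    proof (cases "n = 0")
      case False
      have "0 = fps_nth (?g * f) n" using fg False by simp
      also have "\<dots> = (\<Sum>i<n. fps_nth ?g i * fps_nth f (n - i)) + fps_nth ?g n"
        using assms(3) by (simp add: fps_mult_nth atLeast0AtMost lessThan_Suc_atMost[symmetric])
      finally have "fps_nth ?g n = - (\<Sum>i<n. fps_nth ?g i * fps_nth f (n - i))"
        by (simp add: eq_neg_iff_add_eq_0 add.commute)
      then have "abs_val (fps_nth ?g n) = abs_val (\<Sum>i<n. fps_nth ?g i * fps_nth f (n - i))"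
        by simp
      moreover have "abs_val (fps_nth ?g i * fps_nth f (n - i)) * r ^ n \<le> 1" if "i \<in> {..<n}" for i
      proof -
        have "r ^ n = r ^ i * r ^ (n - i)" using that by (simp flip: power_add)
        then have "abs_val (fps_nth ?g i * fps_nth f (n - i)) * r ^ n =
            (abs_val (fps_nth ?g i) * r ^ i) * (abs_val (fps_nth f (n - i)) * r ^ (n - i))"
          by (simp add: abs_val_mult mult_ac)
        also have "\<dots> \<le> 1 * 1"
          using that assms(1) less gauss_leD[OF assms(2)] by (intro mult_mono) auto
        finally show ?thesis by simp
      qed
      ultimately show ?thesis
        using assms(1) abs_val_sum_mult_le[of "{..<n}" "\<lambda>i. fps_nth ?g i * fps_nth f (n - i)"
            "r ^ n" 1]
        by simp
    qed (use assms(3) in simp)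
  qed
  then show ?thesis by (simp add: gauss_le_def)
qed

text \<open>\<open>gauss_le r r g\<close> is the formal version of \<open>g\<close> mapping the disc
  of radius \<open>r\<close> into itself.\<close>

lemma gauss_le_compose:
  assumes "0 \<le> r" "gauss_le r C f" "gauss_le r r g"
  shows "gauss_le r C (f oo g)"
  unfolding gauss_le_def
proof
  fix n
  have "abs_val (fps_nth f i * fps_nth (g ^ i) n) * r ^ n \<le> C" for i
  proof -
    have "abs_val (fps_nth f i * fps_nth (g ^ i) n) * r ^ n =
        abs_val (fps_nth f i) * (abs_val (fps_nth (g ^ i) n) * r ^ n)"
      by (simp add: abs_val_mult)
    also have "\<dots> \<le> abs_val (fps_nth f i) * r ^ i"
      using gauss_leD[OF gauss_le_power[OF assms(1,3)]] by (intro mult_left_mono) auto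
    also have "\<dots> \<le> C" by (rule gauss_leD[OF assms(2)])
    finally show ?thesis .
  qed
  then show "abs_val (fps_nth (f oo g) n) * r ^ n \<le> C"
    unfolding fps_compose_nth using assms gauss_le_nonneg[OF assms(2)]
    by (intro abs_val_sum_mult_le) auto
qed

text \<open>The equation \<open>fps_inv f oo f = fps_X\<close> is triangular in the coefficients of
  the inverse, with diagonal entries \<open>fps_nth f 1 ^ n = 1\<close>, so the bound passes along
  the recursion.\<close>

lemma gauss_le_fps_inv:
  assumes "0 < r" "gauss_le r r f" "fps_nth f 0 = 0" "fps_nth f 1 = 1"
  shows "gauss_le r r (fps_inv f)"
proof -
  let ?g = "fps_inv f"
  have gf: "?g oo f = fps_X" using assms by (intro fps_inv) auto
  have "abs_val (fps_nth ?g n) * r ^ n \<le> r" for n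
  proof (induction n rule: less_induct)
    case (less n)
    have "fps_nth fps_X n = (\<Sum>i<n. fps_nth ?g i * fps_nth (f ^ i) n) + fps_nth ?g n"
      using assms(3,4) unfolding gf[symmetric] fps_compose_nth
      by (simp add: atLeast0AtMost lessThan_Suc_atMost[symmetric] startsby_zero_power_nth_same)
    then have eq: "fps_nth ?g n = fps_nth fps_X n - (\<Sum>i<n. fps_nth ?g i * fps_nth (f ^ i) n)"
      by (simp add: algebra_simps)
    have "abs_val (fps_nth ?g i * fps_nth (f ^ i) n) * r ^ n \<le> r" if "i \<in> {..<n}" for i
    proof -
      have "abs_val (fps_nth ?g i * fps_nth (f ^ i) n) * r ^ n =
          abs_val (fps_nth ?g i) * (abs_val (fps_nth (f ^ i) n) * r ^ n)"
        by (simp add: abs_val_mult)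
      also have "\<dots> \<le> abs_val (fps_nth ?g i) * r ^ i"
        using gauss_leD[OF gauss_le_power[OF less_imp_le[OF assms(1)] assms(2)]]
        by (intro mult_left_mono) auto
      also have "\<dots> \<le> r" using less that by simp
      finally show ?thesis .
    qed
    then have "abs_val (\<Sum>i<n. fps_nth ?g i * fps_nth (f ^ i) n) * r ^ n \<le> r"
      using assms(1) by (intro abs_val_sum_mult_le) auto
    moreover have "abs_val (fps_nth (fps_X::'a fps) n) * r ^ n \<le> r"
      using gauss_leD[OF gauss_le_X] assms(1) by auto
    ultimately have "abs_val (fps_nth ?g n) \<le> r / r ^ n"
      unfolding eq using assms(1) by (intro abs_val_diff_le) (auto simp: field_simps)
    then show ?case using assms(1) by (simp add: field_simps)
  qed
  then show ?thesis by (simp add: gauss_le_def)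
qed

text \<open>The bound says that \<open>f(z) / z\<close> has Gauss norm at most 1, and this persists
  on smaller discs.\<close>

lemma gauss_le_normalized_radius_mono:
  assumes "0 < s" "s \<le> r" "fps_nth f 0 = 0" "gauss_le r r f"
  shows "gauss_le s s f"
  unfolding gauss_le_def
proof
  fix k
  show "abs_val (fps_nth f k) * s ^ k \<le> s"
  proof (cases k)
    case (Suc j)
    have "abs_val (fps_nth f k) * r ^ j * r \<le> 1 * r"
      using gauss_leD[OF assms(4), of k] Suc by (simp add: mult_ac)
    then have "abs_val (fps_nth f k) * r ^ j \<le> 1" using assms by simp
    moreover have "abs_val (fps_nth f k) * s ^ j \<le> abs_val (fps_nth f k) * r ^ j"
      using assms by (intro mult_left_mono power_mono) auto
    ultimately have "(abs_val (fps_nth f k) * s ^ j) * s \<le> 1 * s"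
      using assms by (intro mult_right_mono) auto
    then show ?thesis using Suc by (simp add: mult_ac)
  qed (use assms in simp)
qed

lemma gauss_le_power_diff:
  assumes "0 \<le> r" "0 \<le> C" "gauss_le r r g" "gauss_le r r h" "gauss_le r (r * C) (g - h)"
  shows "gauss_le r (r ^ n * C) (g ^ n - h ^ n)"
proof (induction n)
  case (Suc n)
  have "g ^ Suc n - h ^ Suc n = g * (g ^ n - h ^ n) + (g - h) * h ^ n"
    by (simp add: algebra_simps)
  moreover have "gauss_le r (r ^ Suc n * C) (g * (g ^ n - h ^ n))"
    using gauss_le_mult[OF assms(1,3) Suc] by (simp add: mult_ac)
  moreover have "gauss_le r (r ^ Suc n * C) ((g - h) * h ^ n)"
    using gauss_le_mult[OF assms(1,5) gauss_le_power[OF assms(1,4)], of n] by (simp add: mult_ac)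
  ultimately show ?case using gauss_le_add assms(1) by metis
qed (use assms in simp)

text \<open>A Lipschitz estimate: moving the inner series by the fraction \<open>C\<close> of the
  radius changes the composition by at most the fraction \<open>C\<close> of its bound.\<close>

lemma gauss_le_compose_diff:
  assumes "0 \<le> r" "0 \<le> C" "gauss_le r r g" "gauss_le r r h" "gauss_le r (r * C) (g - h)"
    and "gauss_le r D f"
  shows "gauss_le r (D * C) ((f oo g) - (f oo h))"
  unfolding gauss_le_def
proof
  fix n
  have "abs_val (fps_nth f i * fps_nth (g ^ i - h ^ i) n) * r ^ n \<le> D * C" for i
  proof -
    have "abs_val (fps_nth f i * fps_nth (g ^ i - h ^ i) n) * r ^ n =
        abs_val (fps_nth f i) * (abs_val (fps_nth (g ^ i - h ^ i) n) * r ^ n)"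
      by (simp add: abs_val_mult)
    also have "\<dots> \<le> abs_val (fps_nth f i) * (r ^ i * C)"
      using gauss_leD[OF gauss_le_power_diff[OF assms(1-5)]] by (intro mult_left_mono) auto
    also have "\<dots> = (abs_val (fps_nth f i) * r ^ i) * C" by simp
    also have "\<dots> \<le> D * C"
      using gauss_leD[OF assms(6)] assms(2) by (intro mult_right_mono) auto
    finally show ?thesis .
  qed
  moreover have "fps_nth ((f oo g) - (f oo h)) n = (\<Sum>i=0..n. fps_nth f i * fps_nth (g ^ i - h ^ i)
      n)"
    by (simp add: fps_compose_nth algebra_simps sum_subtractf)
  ultimately show "abs_val (fps_nth ((f oo g) - (f oo h)) n) * r ^ n \<le> D * C"
    using assms gauss_le_nonneg[OF assms(6)] by (simp only:) (intro abs_val_sum_mult_le; simp)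
qed

section \<open>Congruences of power series\<close>

definition agree_upto :: "nat \<Rightarrow> 'a fps \<Rightarrow> 'a fps \<Rightarrow> bool" where
  "agree_upto n f g \<longleftrightarrow> (\<forall>k\<le>n. fps_nth f k = fps_nth g k)"

lemma agree_uptoD: "agree_upto n f g \<Longrightarrow> k \<le> n \<Longrightarrow> fps_nth f k = fps_nth g k"
  by (simp add: agree_upto_def)

lemma agree_upto_refl [simp]: "agree_upto n f f"
  by (simp add: agree_upto_def)

lemma agree_upto_sym: "agree_upto n f g \<Longrightarrow> agree_upto n g f"
  by (simp add: agree_upto_def)

lemma agree_upto_diff:
  "agree_upto n f g \<Longrightarrow> agree_upto n f' g' \<Longrightarrow> agree_upto n (f - f') (g - g' :: 'a::ab_group_add fps)"
  by (simp add: agree_upto_def)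

lemma agree_upto_mult:
  "agree_upto n f g \<Longrightarrow> agree_upto n f' g' \<Longrightarrow> agree_upto n (f * f') (g * g' :: 'a::comm_ring_1 fps)"
  by (simp add: agree_upto_def fps_mult_nth)

lemma agree_upto_X_mult:
  "agree_upto n f g \<Longrightarrow> agree_upto (Suc n) (fps_X * f) (fps_X * g :: 'a::comm_ring_1 fps)"
  by (auto simp: agree_upto_def)

lemma agree_upto_power:
  "agree_upto n f g \<Longrightarrow> agree_upto n (f ^ k) (g ^ k :: 'a::comm_ring_1 fps)"
  by (induction k) (auto intro: agree_upto_mult)

lemma agree_upto_compose:
  assumes "agree_upto n f f'" "agree_upto n g g'"
  shows "agree_upto n (f oo g) (f' oo g' :: 'a::comm_ring_1 fps)"
  unfolding agree_upto_def fps_compose_nth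
  using agree_uptoD[OF assms(1)] agree_uptoD[OF agree_upto_power[OF assms(2)]]
  by (auto intro!: sum.cong)

lemma agree_upto_add_monomial:
  "m < n \<Longrightarrow> agree_upto m (f + fps_const c * fps_X ^ n) (f :: 'a::comm_ring_1 fps)"
  by (auto simp: agree_upto_def fps_X_power_nth)

text \<open>From \<open>s k\<close> on the \<open>k\<close>-th coefficient no longer changes, so the
  diagonal is the X-adic limit of the sequence.\<close>

lemma agree_upto_limit:
  assumes "\<And>m. agree_upto m (s m) (s (Suc m))"
  shows "agree_upto m (Abs_fps (\<lambda>k. fps_nth (s k) k)) (s m)"
proof -
  have "fps_nth (s (k + d)) k = fps_nth (s k) k" for k d
  proof (induction d)
    case (Suc d)
    show ?case using agree_uptoD[OF assms[of "k + d"], of k] Suc by simp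
  qed simp
  then have "fps_nth (s k) k = fps_nth (s m) k" if "k \<le> m" for k
    using that le_add_diff_inverse by metis
  then show ?thesis by (simp add: agree_upto_def)
qed

section \<open>Series in one residue class of exponents\<close>

definition lift :: "nat \<Rightarrow> 'a::comm_ring_1 fps \<Rightarrow> 'a fps" where
  "lift q A = fps_X * (A oo fps_X ^ q)"

lemma lift_nth_0 [simp]: "fps_nth (lift q A) 0 = 0"
  by (simp add: lift_def)

lemma lift_nth_Suc:
  "fps_nth (lift q A) (Suc n) = (if q dvd n then fps_nth A (n div q) else 0)"
  by (simp add: lift_def fps_nth_compose_X_power)

lemma lift_nth_1 [simp]: "fps_nth (lift q A) (Suc 0) = fps_nth A 0"
  by (simp add: lift_nth_Suc)

lemma lift_inj: "0 < q \<Longrightarrow> lift q A = lift q B \<Longrightarrow> A = B"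
  by (metis dvd_triv_left fps_ext lift_nth_Suc nonzero_mult_div_cancel_left not_gr_zero)

lemma lift_const: "lift q (fps_const c) = fps_const c * fps_X"
  by (simp add: lift_def mult.commute)

lemma lift_1: "lift 1 A = fps_X * A"
  by (simp add: lift_def)

lemma lift_compose_X_power:
  "0 < q \<Longrightarrow> 0 < m \<Longrightarrow> lift q (A oo fps_X ^ m) = lift (m * q) (A :: 'a::idom fps)"
  by (simp add: lift_def fps_X_power_compose flip: fps_compose_assoc power_mult) (simp add:
      mult.commute)

text \<open>The \<open>q\<close>-th power of \<open>z B(z ^ q)\<close> is
  \<open>z ^ q * B(z ^ q) ^ q\<close>, that is, \<open>fps_X * B ^ q\<close> in the variable
  \<open>z ^ q\<close>.\<close>

lemma lift_compose:
  fixes A B :: "'a::idom fps"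
  assumes "0 < q"
  shows "lift q A oo lift q B = lift q (B * (A oo (fps_X * B ^ q)))"
proof -
  have Xq0: "fps_nth (fps_X ^ q :: 'a fps) 0 = 0" using assms by simp
  have eq: "(fps_X * B ^ q) oo fps_X ^ q = lift q B ^ q"
    using Xq0 by (simp add: lift_def fps_compose_mult_distrib power_mult_distrib fps_compose_power)
  have "lift q A oo lift q B = lift q B * ((A oo fps_X ^ q) oo lift q B)"
    unfolding lift_def[of q A] by (subst fps_compose_mult_distrib) (auto simp:
        fps_X_fps_compose_startby0)
  also have "(A oo fps_X ^ q) oo lift q B = A oo lift q B ^ q"
    using Xq0 by (simp add: fps_X_power_compose flip: fps_compose_assoc)
  also have "\<dots> = (A oo (fps_X * B ^ q)) oo fps_X ^ q"
    using Xq0 by (simp add: fps_compose_assoc flip: eq)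
  also have "lift q B * \<dots> = lift q (B * (A oo (fps_X * B ^ q)))"
    using Xq0 by (simp add: lift_def fps_compose_mult_distrib mult.assoc)
  finally show ?thesis .
qed

lemma gauss_le_lift:
  assumes "0 \<le> r" "gauss_le (r ^ q) 1 A"
  shows "gauss_le r r (lift q A)"
  unfolding gauss_le_def
proof
  fix k
  show "abs_val (fps_nth (lift q A) k) * r ^ k \<le> r"
  proof (cases k)
    case (Suc n)
    have "abs_val (fps_nth A (n div q)) * r ^ n \<le> 1" if "q dvd n"
      using gauss_leD[OF assms(2), of "n div q"] that by (simp flip: power_mult)
    then have "abs_val (fps_nth (lift q A) k) * r ^ n \<le> 1"
      using Suc by (auto simp: lift_nth_Suc)
    then have "(abs_val (fps_nth (lift q A) k) * r ^ n) * r \<le> 1 * r"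
      using assms(1) by (rule mult_right_mono)
    then show ?thesis using Suc by (simp add: mult_ac)
  qed (use assms in simp)
qed

section \<open>Multipliers close to 1 in prime characteristic\<close>

locale near_one_multiplier =
  fixes p :: nat and l :: "'a::nonarchimedean_field"
  assumes prime_p: "prime p" and char_p: "CHAR('a) = p"
    and not_root_of_unity: "0 < n \<Longrightarrow> l ^ n \<noteq> 1"
    and near_one: "abs_val (1 - l) < 1"
begin

definition eps :: real where "eps = abs_val (1 - l)"

lemma eps_pos: "0 < eps"
  using not_root_of_unity[of 1] by (simp add: eps_def)

lemma eps_less_1: "eps < 1"
  using near_one by (simp add: eps_def)

lemma p_pos [simp]: "0 < p"
  using prime_p by (rule prime_gt_0_nat)

lemma of_nat_p: "(of_nat p :: 'a) = 0"
  using char_p of_nat_CHAR[where 'a='a] by simp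

lemma eps_power_le_1: "eps ^ n \<le> 1"
  using eps_pos eps_less_1 by (simp add: power_le_one)

lemma eps_power_less_1: "0 < n \<Longrightarrow> eps ^ n < 1"
  using eps_pos eps_less_1 by (simp add: power_less_one_iff)

lemma eps_power_mono: "m \<le> n \<Longrightarrow> eps ^ n \<le> eps ^ m"
  using eps_pos eps_less_1 by (simp add: power_decreasing)

lemma eps_power_strict_mono: "m < n \<Longrightarrow> eps ^ n < eps ^ m"
  using eps_pos eps_less_1 by (simp add: power_strict_decreasing)

lemma abs_val_l [simp]: "abs_val l = 1"
  using abs_val_eq_of_diff[of l 1] near_one by (simp add: abs_val_minus_commute)

lemma abs_val_l_power [simp]: "abs_val (l ^ n) = 1"
  by (simp add: abs_val_power)

lemma l_nonzero [simp]: "l \<noteq> 0"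
  using abs_val_l by fastforce

lemma abs_val_nat_unit: "\<not> p dvd n \<Longrightarrow> abs_val (of_nat n :: 'a) = 1"
  using abs_val_of_nat_eq_1[where 'a='a] prime_p char_p by simp

lemma frobenius_add: "(x + y :: 'a) ^ (p ^ n) = x ^ (p ^ n) + y ^ (p ^ n)"
  using freshmans_dream'[where 'a='a] prime_p char_p by blast

lemma frobenius_diff: "(x - y :: 'a) ^ (p ^ n) = x ^ (p ^ n) - y ^ (p ^ n)"
  using frobenius_add[of "x - y" y n] by simp

lemma frobenius_add_fps: "(f + g :: 'a fps) ^ (p ^ n) = f ^ (p ^ n) + g ^ (p ^ n)"
  using freshmans_dream'[where 'a="'a fps"] prime_p char_p by (metis semiring_char_fps)

lemma frobenius_fps_nth:
  fixes f :: "'a fps"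
  shows "fps_nth (f ^ (p ^ n)) k = (if p ^ n dvd k then fps_nth f (k div p ^ n) ^ (p ^ n) else 0)"
proof -
  let ?q = "p ^ n"
  \<comment> \<open>The additivity of Frobenius is applied to a finite sum, so \<open>f\<close> is
    truncated at the degree that is read off.\<close>
  let ?g = "\<Sum>i\<le>k. fps_const (fps_nth f i) * fps_X ^ i"
  have "agree_upto k f ?g"
    by (auto simp: agree_upto_def fps_sum_nth fps_X_power_nth if_distrib cong: if_cong)
  then have "fps_nth (f ^ ?q) k = fps_nth (?g ^ ?q) k"
    using agree_uptoD agree_upto_power by blast
  also have "?g ^ ?q = (\<Sum>i\<le>k. (fps_const (fps_nth f i) * fps_X ^ i) ^ ?q)"
    using prime_p char_p by (intro freshmans_dream_sum'[where n=n]) auto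
  also have "fps_nth \<dots> k = (\<Sum>i\<le>k. if k = i * ?q then fps_nth f i ^ ?q else 0)"
    by (simp add: fps_sum_nth power_mult_distrib fps_X_power_nth flip: power_mult fps_const_power)
       (intro sum.cong; simp)
  also have "\<dots> = (if ?q dvd k then fps_nth f (k div ?q) ^ ?q else 0)"
  proof (cases "?q dvd k")
    case True
    then have "k = i * ?q \<longleftrightarrow> i = k div ?q" for i by auto
    then show ?thesis using True by (simp add: div_le_dividend)
  qed (auto intro!: sum.neutral)
  finally show ?thesis .
qed

lemma abs_val_one_minus_l_power_le: "abs_val (1 - l ^ m) \<le> eps"
proof (induction m)
  case (Suc m)
  have "1 - l ^ Suc m = (1 - l) + l * (1 - l ^ m)" by (simp add: algebra_simps)
  show ?case
    unfolding \<open>1 - l ^ Suc m = _\<close>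
    using Suc by (intro abs_val_add_le) (simp_all add: eps_def abs_val_mult)
qed (use eps_pos in simp)

text \<open>The quotient of \<open>1 - l ^ m\<close> by \<open>1 - l\<close> is a sum of
  \<open>m\<close> powers of \<open>l\<close>, hence differs from \<open>of_nat m\<close> by at most
  \<open>eps\<close>, and \<open>of_nat m\<close> is a unit.\<close>

lemma abs_val_one_minus_l_power_unit:
  assumes "\<not> p dvd m" shows "abs_val (1 - l ^ m) = eps"
proof -
  have "abs_val ((\<Sum>i<m. l ^ i) - of_nat m) = abs_val (\<Sum>i<m. l ^ i - 1)"
    by (simp add: sum_subtractf)
  also have "\<dots> \<le> eps"
    using eps_pos abs_val_one_minus_l_power_le by (intro abs_val_sum_le) (auto simp:
        abs_val_minus_commute)
  also have "\<dots> < abs_val (of_nat m :: 'a)"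
    using abs_val_nat_unit[OF assms] eps_less_1 by simp
  finally have "abs_val (\<Sum>i<m. l ^ i) = 1"
    using abs_val_eq_of_diff abs_val_nat_unit[OF assms] by metis
  moreover have "1 - l ^ m = (1 - l) * (\<Sum>i<m. l ^ i)"
    by (rule one_diff_power_eq)
  ultimately show ?thesis by (simp add: abs_val_mult eps_def)
qed

lemma one_minus_l_power_frobenius: "1 - l ^ (p ^ n * m) = (1 - l ^ m) ^ (p ^ n)"
  by (simp add: frobenius_diff mult.commute[of "p ^ n"] flip: power_mult)

lemma abs_val_one_minus_l_power:
  "\<not> p dvd m \<Longrightarrow> abs_val (1 - l ^ (p ^ n * m)) = eps ^ (p ^ n)"
  by (simp add: one_minus_l_power_frobenius abs_val_power abs_val_one_minus_l_power_unit)

lemma abs_val_one_minus_l_power_le': "abs_val (1 - l ^ (p ^ n * m)) \<le> eps ^ (p ^ n)"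
  by (simp add: one_minus_l_power_frobenius abs_val_power abs_val_one_minus_l_power_le power_mono)

end

section \<open>Partial normal forms\<close>

text \<open>By \<open>lift_compose\<close>, this vanishes iff \<open>lift q A\<close> conjugates \<open>lift q G\<close> to \<open>lift q H\<close>.\<close>

definition conj_defect :: "nat \<Rightarrow> 'a::comm_ring_1 fps \<Rightarrow> 'a fps \<Rightarrow> 'a fps \<Rightarrow> 'a fps" where
  "conj_defect q G A H = G * (A oo (fps_X * G ^ q)) - A * (H oo (fps_X * A ^ q))"

lemma agree_upto_conj_defect:
  "agree_upto n A A' \<Longrightarrow> agree_upto n H H' \<Longrightarrow>
    agree_upto n (conj_defect q G A H) (conj_defect q G A' H')"
  unfolding conj_defect_def
  by (intro agree_upto_diff agree_upto_mult agree_upto_compose agree_upto_power) simp_all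

lemma conj_defect_eq_0_iff:
  fixes A :: "'a::idom fps"
  assumes "0 < q"
  shows "conj_defect q G A H = 0 \<longleftrightarrow> lift q A oo lift q G = lift q H oo lift q A"
  using lift_inj[OF assms] by (auto simp: conj_defect_def lift_compose assms)

lemma compose_X_mult_add_monomial:
  fixes A B :: "'a::idom fps"
  shows "(A + fps_const c * fps_X ^ n) oo (fps_X * B) =
    (A oo (fps_X * B)) + fps_const c * fps_X ^ n * B ^ n"
  by (simp add: fps_compose_add_distrib fps_compose_mult_distrib fps_X_power_compose
      power_mult_distrib mult.assoc)

lemma mult_monomial_nth:
  fixes A :: "'a::comm_ring_1 fps"
  shows "fps_nth (fps_const c * fps_X ^ n * A) n = c * fps_nth A 0"
  by (simp add: mult.assoc fps_X_power_mult_nth)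

text \<open>To lowest order \<open>fps_X * G ^ q\<close> scales the new monomial by
  \<open>fps_nth G 0 ^ (q * n)\<close>. Its effect inside the argument of \<open>H\<close> starts
  only beyond degree \<open>n\<close>, because of the extra factor \<open>fps_X\<close>. If both
  constant terms are \<open>l\<close>, the factor of \<open>c\<close> is the negative of the small
  divisor \<open>l * (1 - l ^ (q * n))\<close>.\<close>

lemma conj_defect_add_monomial_left:
  fixes A :: "'a::idom fps"
  assumes "0 < n" "fps_nth A 0 = 1"
  shows "fps_nth (conj_defect q G (A + fps_const c * fps_X ^ n) H) n =
    fps_nth (conj_defect q G A H) n + c * (fps_nth G 0 * fps_nth G 0 ^ (q * n) - fps_nth H 0)"
proof -
  let ?A' = "A + fps_const c * fps_X ^ n"
  have "agree_upto (n - 1) (A ^ q) (?A' ^ q)"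
    using assms by (intro agree_upto_power agree_upto_sym[OF agree_upto_add_monomial]) auto
  from agree_upto_X_mult[OF this] have "agree_upto n (H oo (fps_X * ?A' ^ q)) (H oo (fps_X * A ^
      q))"
    using assms by (intro agree_upto_compose) (auto intro: agree_upto_sym)
  then have "agree_upto n (?A' * (H oo (fps_X * ?A' ^ q))) (?A' * (H oo (fps_X * A ^ q)))"
    by (intro agree_upto_mult) auto
  then have "fps_nth (?A' * (H oo (fps_X * ?A' ^ q))) n = fps_nth (?A' * (H oo (fps_X * A ^ q))) n"
    by (rule agree_uptoD) simp
  also have "\<dots> = fps_nth (A * (H oo (fps_X * A ^ q))) n + c * fps_nth H 0"
    by (simp only: distrib_right fps_add_nth mult_monomial_nth fps_compose_nth_0)
  finally have 1: "fps_nth (?A' * (H oo (fps_X * ?A' ^ q))) n = \<dots>" .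
  have "G * (?A' oo (fps_X * G ^ q)) =
      G * (A oo (fps_X * G ^ q)) + fps_const c * fps_X ^ n * (G * (G ^ q) ^ n)"
    by (simp only: compose_X_mult_add_monomial) (simp add: algebra_simps)
  then have "fps_nth (G * (?A' oo (fps_X * G ^ q))) n =
      fps_nth (G * (A oo (fps_X * G ^ q))) n + c * (fps_nth G 0 * fps_nth G 0 ^ (q * n))"
    by (simp only: fps_add_nth mult_monomial_nth fps_mult_nth_0 fps_power_zeroth power_mult)
  with 1 show ?thesis by (simp add: conj_defect_def algebra_simps)
qed

lemma conj_defect_add_monomial_right:
  fixes A :: "'a::idom fps"
  assumes "fps_nth A 0 = 1"
  shows "fps_nth (conj_defect q G A (H + fps_const c * fps_X ^ n)) n =
    fps_nth (conj_defect q G A H) n - c"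
proof -
  have "A * ((H + fps_const c * fps_X ^ n) oo (fps_X * A ^ q)) =
      A * (H oo (fps_X * A ^ q)) + fps_const c * fps_X ^ n * (A * (A ^ q) ^ n)"
    by (simp only: compose_X_mult_add_monomial) (simp add: algebra_simps)
  then have "fps_nth (A * ((H + fps_const c * fps_X ^ n) oo (fps_X * A ^ q))) n =
      fps_nth (A * (H oo (fps_X * A ^ q))) n + c"
    using assms by (simp only: fps_add_nth mult_monomial_nth fps_mult_nth_0 fps_power_zeroth) simp
  then show ?thesis by (simp add: conj_defect_def)
qed

context near_one_multiplier
begin

text \<open>Frobenius splits \<open>G ^ p ^ n\<close> into \<open>l ^ p ^ n\<close>, within
  \<open>eps ^ p ^ n\<close> of 1, and the much smaller power of
  \<open>G - fps_const l\<close>.\<close>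

lemma gauss_le_power_minus_1:
  assumes "0 < r" "gauss_le r (eps ^ p ^ n) (G - fps_const l)"
  shows "gauss_le r (eps ^ p ^ n) (G ^ p ^ n - 1)"
proof -
  let ?q = "p ^ n"
  have "G ^ ?q = ((G - fps_const l) + fps_const l) ^ ?q" by simp
  also have "\<dots> = (G - fps_const l) ^ ?q + fps_const (l ^ ?q)"
    by (simp only: frobenius_add_fps fps_const_power)
  finally have "G ^ ?q - 1 = (G - fps_const l) ^ ?q - fps_const (1 - l ^ ?q)"
    by (simp add: fps_const_sub[symmetric] del: fps_const_sub)
  moreover have "gauss_le r (eps ^ ?q) ((G - fps_const l) ^ ?q)"
  proof (rule gauss_le_mono[OF gauss_le_power[OF _ assms(2)]])
    have "?q \<le> ?q * ?q" using p_pos by (simp add: Suc_le_eq)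
    then show "(eps ^ ?q) ^ ?q \<le> eps ^ ?q"
      using eps_power_mono by (simp flip: power_mult)
  qed (use assms in simp)
  moreover have "gauss_le r (eps ^ ?q) (fps_const (1 - l ^ ?q))"
    using abs_val_one_minus_l_power_le'[of n 1] assms by (intro gauss_le_const) auto
  ultimately show ?thesis using assms by (simp add: gauss_le_diff)
qed

lemma gauss_le_near_multiplier:
  assumes "0 < r" "gauss_le r (eps ^ n) (G - fps_const l)"
  shows "gauss_le r 1 G"
proof -
  have "gauss_le r 1 ((G - fps_const l) + fps_const l)"
    using assms eps_power_le_1 by (intro gauss_le_add gauss_le_const gauss_le_mono[OF assms(2)])
        auto
  then show ?thesis by simp
qed

lemma gauss_le_compose_twist:
  assumes "0 < r" "gauss_le r (eps ^ p ^ n) (G - fps_const l)" "gauss_le r 1 A"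
  shows "gauss_le r (eps ^ p ^ n) ((A oo (fps_X * G ^ p ^ n)) - A)"
proof -
  have X: "gauss_le r r fps_X" using assms(1) by (simp add: gauss_le_X)
  have "gauss_le r (1 ^ p ^ n) (G ^ p ^ n)"
    using assms(1) gauss_le_near_multiplier[OF assms(1,2)] by (intro gauss_le_power) auto
  then have "gauss_le r r (fps_X * G ^ p ^ n)"
    using gauss_le_mult1[OF _ X] assms(1) by simp
  moreover have "gauss_le r (r * eps ^ p ^ n) (fps_X * (G ^ p ^ n - 1))"
    using assms X by (intro gauss_le_mult gauss_le_power_minus_1) auto
  ultimately have "gauss_le r (1 * eps ^ p ^ n) ((A oo (fps_X * G ^ p ^ n)) - (A oo fps_X))"
    using assms eps_pos X by (intro gauss_le_compose_diff) (auto simp: algebra_simps)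
  then show ?thesis by simp
qed

text \<open>The bound equals the size of the small divisors at exponents prime to \<open>p\<close>,
  so dividing a defect coefficient by such a divisor keeps the coordinate change integral. Each of
  the three summands below contains one small factor: the deviation of \<open>G\<close>, the motion
  of the variable, or the deviation of \<open>H\<close>.\<close>

lemma gauss_le_conj_defect:
  assumes "0 < r" "gauss_le r (eps ^ p ^ n) (G - fps_const l)"
    and "gauss_le r (eps ^ p ^ n) (H - fps_const l)" "gauss_le r 1 A"
  shows "gauss_le r (eps ^ p ^ n) (conj_defect (p ^ n) G A H)"
proof -
  let ?nu = "eps ^ p ^ n" and ?F = "fps_X * G ^ p ^ n" and ?B = "fps_X * A ^ p ^ n"
  have r: "0 \<le> r" using assms(1) by simp
  have X: "gauss_le r r fps_X" using r by (simp add: gauss_le_X)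
  have twist: "gauss_le r r (fps_X * C ^ p ^ n)" if "gauss_le r 1 C" for C
    using gauss_le_mult1[OF r X] gauss_le_power[OF r that, of "p ^ n"] by simp
  have F: "gauss_le r r ?F" and B: "gauss_le r r ?B"
    using assms(4) gauss_le_near_multiplier[OF assms(1,2)] by (auto intro: twist)
  have "conj_defect (p ^ n) G A H = ((G - fps_const l) * (A oo ?F)
      + fps_const l * ((A oo ?F) - A)) - ((H - fps_const l) oo ?B) * A"
    by (simp add: conj_defect_def fps_compose_sub_distrib algebra_simps)
  also have "gauss_le r ?nu \<dots>"
  proof (intro gauss_le_diff gauss_le_add r)
    show "gauss_le r ?nu ((G - fps_const l) * (A oo ?F))"
      by (rule gauss_le_mult1[OF r assms(2) gauss_le_compose[OF r assms(4) F]])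
    show "gauss_le r ?nu (fps_const l * ((A oo ?F) - A))"
      using gauss_le_mult[OF r gauss_le_const[of r l 1] gauss_le_compose_twist[OF assms(1,2,4)]] r
          by simp
    show "gauss_le r ?nu (((H - fps_const l) oo ?B) * A)"
      by (rule gauss_le_mult1[OF r gauss_le_compose[OF r assms(3) B] assms(4)])
  qed
  finally show ?thesis .
qed

text \<open>The series are built degree by degree. A defect at an exponent prime to \<open>p\<close>
  is absorbed into \<open>A\<close>; at a multiple of \<open>p\<close> the divisor is too small for
  that, so the defect is moved into \<open>H\<close> and the coefficient of \<open>A\<close> is set
  to 0.\<close>

lemma normal_form:
  assumes "0 < r" "fps_nth G 0 = l" "gauss_le r (eps ^ p ^ n) (G - fps_const l)"
  obtains A H where "fps_nth A 0 = 1" "gauss_le r 1 A"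
    "\<And>k. 0 < k \<Longrightarrow> p dvd k \<Longrightarrow> fps_nth A k = 0"
    "fps_nth H 0 = l" "gauss_le r (eps ^ p ^ n) (H - fps_const l)"
    "\<And>k. \<not> p dvd k \<Longrightarrow> fps_nth H k = 0"
    "conj_defect (p ^ n) G A H = 0"
proof -
  let ?q = "p ^ n" and ?nu = "eps ^ p ^ n"
  define P where "P m x \<longleftrightarrow> fps_nth (fst x) 0 = 1 \<and> gauss_le r 1 (fst x) \<and>
      (\<forall>k>0. p dvd k \<longrightarrow> fps_nth (fst x) k = 0) \<and>
      fps_nth (snd x) 0 = l \<and> gauss_le r ?nu (snd x - fps_const l) \<and>
      (\<forall>k. \<not> p dvd k \<longrightarrow> fps_nth (snd x) k = 0) \<and>
      agree_upto m (conj_defect ?q G (fst x) (snd x)) 0" for m x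
  define Q where "Q m x y \<longleftrightarrow> agree_upto m (fst x) (fst y) \<and> agree_upto m (snd x) (snd y)"
    for m and x y :: "'a fps \<times> 'a fps"
  have r: "0 \<le> r" using assms(1) by simp
  have step: "\<exists>y. P (Suc m) y \<and> Q m x y" if "P m x" for m x
  proof -
    obtain A H where x: "x = (A, H)" by force
    note P = that[unfolded P_def x fst_conv snd_conv]
    let ?n = "Suc m" and ?S = "fps_nth (conj_defect ?q G A H) (Suc m)"
    have S: "abs_val ?S * r ^ ?n \<le> ?nu"
      using gauss_leD[OF gauss_le_conj_defect[OF assms(1,3)]] P by blast
    show ?thesis
    proof (cases "p dvd ?n")
      case True
      let ?H = "H + fps_const ?S * fps_X ^ ?n"
      have ag: "agree_upto m ?H H" by (intro agree_upto_add_monomial) simp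
      have "gauss_le r ?nu ((H - fps_const l) + fps_const ?S * fps_X ^ ?n)"
        using P S r by (intro gauss_le_add gauss_le_monomial) auto
      then have "gauss_le r ?nu (?H - fps_const l)" by (simp add: algebra_simps)
      moreover have "agree_upto ?n (conj_defect ?q G A ?H) 0"
        unfolding agree_upto_def
      proof (intro allI impI)
        fix k assume "k \<le> ?n"
        show "fps_nth (conj_defect ?q G A ?H) k = fps_nth 0 k"
        proof (cases "k = ?n")
          case True
          then show ?thesis using P conj_defect_add_monomial_right[of A ?q G H ?S ?n] by simp
        next
          case False
          then have "k \<le> m" using \<open>k \<le> ?n\<close> by simp
          then show ?thesis
            using P agree_uptoD[OF agree_upto_conj_defect[OF agree_upto_refl ag], of k ?q G A]
            by (simp add: agree_upto_def)
        qed
      qed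
      ultimately have "P ?n (A, ?H)"
        using P True by (auto simp: P_def fps_X_power_nth simp del: power_Suc)
      moreover have "Q m x (A, ?H)" using ag by (simp add: Q_def x agree_upto_sym)
      ultimately show ?thesis by blast
    next
      case False
      \<comment> \<open>By \<open>conj_defect_add_monomial_left\<close> this value cancels the
        defect at \<open>?n\<close>. Its denominator has absolute value \<open>?nu\<close>, the same
        as the bound on the defect.\<close>
      let ?c = "?S / (l * (1 - l ^ (?q * ?n)))"
      let ?A = "A + fps_const ?c * fps_X ^ ?n"
      have ag: "agree_upto m ?A A" by (intro agree_upto_add_monomial) simp
      have "abs_val ?c = abs_val ?S / ?nu"
        using abs_val_one_minus_l_power[OF False, of n] by (simp add: abs_val_divide abs_val_mult)
      then have "abs_val ?c * r ^ ?n = abs_val ?S * r ^ ?n / ?nu"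
        by (simp only: times_divide_eq_left)
      also have "\<dots> \<le> 1" using S eps_pos by simp
      finally have "abs_val ?c * r ^ ?n \<le> 1" .
      then have "gauss_le r 1 ?A"
        using P r by (intro gauss_le_add gauss_le_monomial) auto
      moreover have "agree_upto ?n (conj_defect ?q G ?A H) 0"
        unfolding agree_upto_def
      proof (intro allI impI)
        fix k assume "k \<le> ?n"
        show "fps_nth (conj_defect ?q G ?A H) k = fps_nth 0 k"
        proof (cases "k = ?n")
          case True
          have "1 - l ^ (?q * ?n) \<noteq> 0" using not_root_of_unity[of "?q * ?n"] by simp
          then have "?c * (l * l ^ (?q * ?n) - l) = - ?S"
            by (simp add: field_simps)
          then show ?thesis
            using True P assms(2) conj_defect_add_monomial_left[of ?n A ?q G ?c H] by simp
        next
          case False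
          then have "k \<le> m" using \<open>k \<le> ?n\<close> by simp
          then show ?thesis
            using P agree_uptoD[OF agree_upto_conj_defect[OF ag agree_upto_refl], of k ?q G H]
            by (simp add: agree_upto_def)
        qed
      qed
      ultimately have "P ?n (?A, H)"
        using P False by (auto simp: P_def fps_X_power_nth simp del: power_Suc)
      moreover have "Q m x (?A, H)" using ag by (simp add: Q_def x agree_upto_sym)
      ultimately show ?thesis by blast
    qed
  qed
  have "P 0 (1, fps_const l)"
    using assms eps_pos r by (auto simp: P_def agree_upto_def conj_defect_def gauss_le_1)
  with step obtain s where s: "\<And>m. P m (s m)" "\<And>m. Q m (s m) (s (Suc m))"
    using dependent_nat_choice[of P Q] by blast
  define A where "A = Abs_fps (\<lambda>k. fps_nth (fst (s k)) k)"
  define H where "H = Abs_fps (\<lambda>k. fps_nth (snd (s k)) k)"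
  have agA: "agree_upto m A (fst (s m))" and agH: "agree_upto m H (snd (s m))" for m
    using s(2) unfolding A_def H_def Q_def by (auto intro!: agree_upto_limit)
  note s' = s(1)[unfolded P_def]
  show thesis
  proof (rule that)
    show "fps_nth A 0 = 1" "fps_nth H 0 = l" using s' by (auto simp: A_def H_def)
    show "fps_nth A k = 0" if "0 < k" "p dvd k" for k using s' that by (auto simp: A_def)
    show "fps_nth H k = 0" if "\<not> p dvd k" for k using s' that by (auto simp: H_def)
    show "gauss_le r 1 A"
      using s' gauss_leD unfolding gauss_le_def A_def by auto
    show "gauss_le r ?nu (H - fps_const l)"
      unfolding gauss_le_def H_def
    proof
      fix k show "abs_val (fps_nth (Abs_fps (\<lambda>k. fps_nth (snd (s k)) k) - fps_const l) k) * r ^ k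
          \<le> ?nu"
        using s'[of k] gauss_leD[of r ?nu "snd (s k) - fps_const l" k] by simp
    qed
    show "conj_defect ?q G A H = 0"
    proof (rule fps_ext)
      fix k show "fps_nth (conj_defect ?q G A H) k = fps_nth 0 k"
        using agree_uptoD[OF agree_upto_conj_defect[OF agA[of k] agH[of k]], of k ?q G] s'[of k]
        by (simp add: agree_upto_def)
    qed
  qed
qed

end

section \<open>Logarithmic derivatives\<close>

text \<open>The derivation is \<open>z d/dz\<close> instead of \<open>d/dz\<close>: it keeps
  exponents in place and does not increase Gauss norms.\<close>

definition log_deriv :: "'a::field fps \<Rightarrow> 'a fps" where
  "log_deriv A = fps_X * fps_deriv A * inverse A"

lemma X_deriv_nth: "fps_nth (fps_X * fps_deriv A) k = of_nat k * fps_nth (A::'a::field fps) k"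
  by (cases k) auto

lemma log_deriv_mult:
  assumes "fps_nth A 0 \<noteq> 0" "fps_nth B 0 \<noteq> 0"
  shows "log_deriv (A * B) = log_deriv A + log_deriv (B::'a::field fps)"
proof -
  have "inverse A * A = 1" "inverse B * B = 1" using assms by (auto intro: inverse_mult_eq_1)
  then show ?thesis
    unfolding log_deriv_def fps_inverse_mult fps_deriv_mult by algebra
qed

lemma log_deriv_times: "fps_nth A 0 \<noteq> 0 \<Longrightarrow> log_deriv A * A = fps_X * fps_deriv (A::'a::field fps)"
  by (simp add: log_deriv_def mult.assoc inverse_mult_eq_1)

text \<open>For \<open>D = 1 + a z ^ n\<close> the derivation gives \<open>n (D - 1)\<close>, so the
  logarithmic derivative is \<open>n (1 - 1 / D)\<close> with \<open>1 / D\<close> a geometric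
  series.\<close>

lemma log_deriv_binomial_nth:
  fixes a :: "'a::field"
  assumes "0 < n" "0 < k"
  shows "fps_nth (log_deriv (1 + fps_const a * fps_X ^ n)) k =
    (if n dvd k then - of_nat n * (- a) ^ (k div n) else 0)"
proof -
  let ?D = "1 + fps_const a * fps_X ^ n"
  let ?g = "Abs_fps (\<lambda>k. (- a) ^ k)"
  have D0: "fps_nth ?D 0 \<noteq> 0" using assms by (simp add: fps_X_power_nth)
  have "?g * (1 + fps_const a * fps_X) = 1"
  proof (rule fps_ext)
    fix k show "fps_nth (?g * (1 + fps_const a * fps_X)) k = fps_nth 1 k"
      by (cases k) (simp_all add: distrib_left mult.left_commute[of _ "fps_const a"])
  qed
  then have "(?g oo fps_X ^ n) * ((1 + fps_const a * fps_X) oo fps_X ^ n) = 1 oo fps_X ^ n"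
    using assms by (simp flip: fps_compose_mult_distrib)
  moreover have "(1 + fps_const a * fps_X) oo fps_X ^ n = ?D"
    using assms by (simp add: fps_compose_add_distrib fps_compose_mult_distrib
        fps_X_fps_compose_startby0)
  ultimately have "(?g oo fps_X ^ n) * ?D = 1" by simp
  then have inv: "inverse ?D = ?g oo fps_X ^ n"
    by (metis fps_inverse_unique mult.commute)
  have "fps_X * fps_deriv ?D = fps_const (of_nat n) * (?D - 1)"
    by (rule fps_ext) (auto simp only: X_deriv_nth, auto simp: fps_X_power_nth)
  then have "log_deriv ?D = fps_const (of_nat n) * (?D * inverse ?D - inverse ?D)"
    by (simp add: log_deriv_def algebra_simps)
  also have "?D * inverse ?D = 1" by (rule inverse_mult_eq_1'[OF D0])
  finally have "log_deriv ?D = fps_const (of_nat n) * (1 - (?g oo fps_X ^ n))"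
    unfolding inv .
  then show ?thesis using assms by (simp add: fps_nth_compose_X_power)
qed

lemma gauss_le_X_deriv:
  assumes "0 \<le> r" "gauss_le r C A"
  shows "gauss_le r C (fps_X * fps_deriv A)"
  unfolding gauss_le_def X_deriv_nth
proof
  fix k
  have "abs_val (of_nat k * fps_nth A k) * r ^ k \<le> 1 * (abs_val (fps_nth A k) * r ^ k)"
    using assms(1) abs_val_of_nat_le[of k, where 'a='a] unfolding abs_val_mult mult.assoc
    by (intro mult_right_mono) auto
  also have "\<dots> \<le> C" using gauss_leD[OF assms(2)] by simp
  finally show "abs_val (of_nat k * fps_nth A k) * r ^ k \<le> C" .
qed

lemma gauss_le_log_deriv:
  assumes "0 \<le> r" "gauss_le r 1 A" "fps_nth A 0 = 1"
  shows "gauss_le r 1 (log_deriv A)"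
  unfolding log_deriv_def
  by (intro gauss_le_mult1 gauss_le_X_deriv gauss_le_inverse assms)

text \<open>The substitution multiplies \<open>z ^ k\<close> by \<open>(1 + u) ^ k\<close>, which is
  \<open>1 + k u\<close> up to integer multiples of higher powers of \<open>u\<close>. Integers have
  absolute value at most 1, so the remainder is bounded uniformly in \<open>k\<close>.\<close>

lemma gauss_le_compose_taylor:
  assumes "0 \<le> r" "C \<le> 1" "gauss_le r 1 A" "gauss_le r C u"
  shows "gauss_le r (C\<^sup>2) ((A oo (fps_X * (1 + u))) - A - u * (fps_X * fps_deriv A))"
proof -
  have C: "0 \<le> C" using gauss_le_nonneg assms(4) .
  have u1: "gauss_le r 1 (1 + u)"
    using assms by (intro gauss_le_add gauss_le_1 gauss_le_mono[OF assms(4)]) auto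
  have pow: "gauss_le r (C\<^sup>2) ((1 + u) ^ k - 1 - of_nat k * u)" for k
  proof (induction k)
    case (Suc k)
    have "(1 + u) ^ Suc k - 1 - of_nat (Suc k) * u =
        ((1 + u) ^ k - 1 - of_nat k * u) * (1 + u) + u * u * of_nat k"
      by (simp add: algebra_simps)
    moreover have "gauss_le r (C\<^sup>2) (u * u * of_nat k)"
      using gauss_le_mult1[OF assms(1) gauss_le_mult[OF assms(1,4,4)]
          gauss_le_const[OF assms(1) abs_val_of_nat_le, where 'a='a]]
      by (simp add: power2_eq_square fps_of_nat)
    ultimately show ?case
      using gauss_le_mult1[OF assms(1) Suc u1] assms(1) by (simp add: gauss_le_add del: power_Suc)
  qed simp
  show ?thesis
    unfolding gauss_le_def
  proof
    fix n
    let ?t = "\<lambda>k. fps_nth A k * fps_nth (fps_X ^ k * ((1 + u) ^ k - 1 - of_nat k * u)) n"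
    have "fps_nth ((A oo (fps_X * (1 + u))) - A - u * (fps_X * fps_deriv A)) n = (\<Sum>k=0..n. ?t k)"
    proof -
      have "(\<Sum>k=0..n. ?t k) = (\<Sum>k=0..n. fps_nth A k * fps_nth ((fps_X * (1 + u)) ^ k) n)
          - (\<Sum>k=0..n. if k = n then fps_nth A k else 0)
          - (\<Sum>k=0..n. fps_nth (fps_X * fps_deriv A) k * fps_nth u (n - k))"
        unfolding sum_subtractf[symmetric]
      proof (intro sum.cong refl)
        fix k assume k: "k \<in> {0..n}"
        have "fps_X ^ k * ((1 + u) ^ k - 1 - of_nat k * u) =
            (fps_X * (1 + u)) ^ k - fps_X ^ k - fps_const (of_nat k) * (fps_X ^ k * u)"
          unfolding power_mult_distrib by (simp add: fps_of_nat right_diff_distrib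
              mult.left_commute)
        then have "fps_nth (fps_X ^ k * ((1 + u) ^ k - 1 - of_nat k * u)) n =
            fps_nth ((fps_X * (1 + u)) ^ k) n - (if k
                = n then 1 else 0) - of_nat k * fps_nth u (n - k)"
          using k by (simp only: fps_sub_nth fps_mult_left_const_nth fps_X_power_mult_nth
              fps_X_power_nth) auto
        then show "?t k = fps_nth A k * fps_nth ((fps_X * (1 + u)) ^ k) n -
            (if k = n then fps_nth A k else 0) - fps_nth (fps_X * fps_deriv A) k * fps_nth u (n -
                k)"
          by (simp only: X_deriv_nth) (simp add: right_diff_distrib mult_ac)
      qed
      then show ?thesis
        by (simp add: fps_compose_nth fps_mult_nth[of "fps_X * fps_deriv A" u] mult.commute[of u])
    qed
    moreover have "abs_val (?t k) * r ^ n \<le> C\<^sup>2" if "k \<in> {0..n}" for k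
    proof -
      let ?e = "fps_nth ((1 + u) ^ k - 1 - of_nat k * u) (n - k)"
      have "r ^ n = r ^ k * r ^ (n - k)" using that by (simp flip: power_add)
      then have "abs_val (?t k) * r ^ n = (abs_val (fps_nth A k) * r ^ k) * (abs_val ?e * r ^ (n -
          k))"
        using that by (simp add: fps_X_power_mult_nth abs_val_mult mult_ac)
      also have "\<dots> \<le> 1 * C\<^sup>2"
        using assms(1) by (intro mult_mono gauss_leD[OF pow] gauss_leD[OF assms(3)]) simp_all
      finally show ?thesis by simp
    qed
    ultimately show "abs_val (fps_nth ((A oo (fps_X * (1
        + u))) - A - u * (fps_X * fps_deriv A)) n) * r ^ n \<le> C\<^sup>2"
      using assms(1) by (simp only:) (intro abs_val_sum_mult_le; simp)
  qed
qed

context near_one_multiplier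
begin

lemma frobenius_of_nat: "(of_nat n :: 'a) ^ p = of_nat n"
proof (induction n)
  case (Suc n)
  then show ?case using frobenius_add[of 1 "of_nat n" 1] by simp
qed simp

lemma frobenius_minus: "(- x :: 'a) ^ p = - (x ^ p)"
  using frobenius_diff[of 0 x 1] by simp

text \<open>Up to any given degree, \<open>A\<close> is a product of binomials
  \<open>1 + a z ^ n\<close>, and logarithmic derivatives add up over products, as do
  \<open>p\<close>-th powers. For a single binomial the identity is read off from its explicit
  coefficients, since Frobenius fixes the integer \<open>n\<close>.\<close>

lemma log_deriv_frobenius:
  fixes A :: "'a fps"
  assumes "fps_nth A 0 = 1"
  shows "fps_nth (log_deriv A) (p * k) = fps_nth (log_deriv A) k ^ p"
proof -
  define N where "N = p * k"
  have "fps_nth (log_deriv A) (p * k) = fps_nth (log_deriv A) k ^ p"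
    if "agree_upto m A 1" "m \<le> N" for m
    using that(2,1)
  \<comment> \<open>Descending induction on the order of contact with 1. At order \<open>N\<close>
    both coefficients vanish; a step from \<open>Suc m\<close> down to \<open>m\<close> splits off
    one binomial \<open>D\<close>.\<close>
  proof (induction m arbitrary: A rule: inc_induct)
    case base
    have "agree_upto N (fps_X * fps_deriv A) 0"
      using base by (auto simp: agree_upto_def X_deriv_nth simp del: fps_mult_fps_X_commute) 
    then have "agree_upto N (log_deriv A) (0 * inverse A)"
      unfolding log_deriv_def by (intro agree_upto_mult agree_upto_refl)
    moreover have "k \<le> N" using p_pos by (cases p) (simp_all add: N_def)
    ultimately show ?case by (simp add: agree_upto_def N_def)
  next
    case (step m)
    let ?n = "Suc m"
    define a where "a = fps_nth A ?n"
    define D where "D = 1 + fps_const a * fps_X ^ ?n"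
    define B where "B = A * inverse D"
    have D0: "fps_nth D 0 = 1" and A0: "fps_nth A 0 = 1"
      using step.prems by (auto simp: D_def agree_upto_def)
    have "agree_upto ?n A D"
      unfolding agree_upto_def
    proof (intro allI impI)
      fix j assume "j \<le> ?n"
      then show "fps_nth A j = fps_nth D j"
        using step.prems
        by (cases "j = ?n") (auto simp: D_def a_def agree_upto_def fps_X_power_nth simp del:
            power_Suc)
    qed
    then have "agree_upto ?n B (D * inverse D)"
      unfolding B_def by (intro agree_upto_mult agree_upto_refl)
    then have "agree_upto ?n B 1" using D0 by (simp add: inverse_mult_eq_1')
    then have IH: "fps_nth (log_deriv B) (p * k) = fps_nth (log_deriv B) k ^ p"
      by (rule step.IH)
    have "A = D * B" using D0 by (simp add: B_def inverse_mult_eq_1' mult.left_commute)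
    then have sum: "log_deriv A = log_deriv D + log_deriv B"
      using D0 A0 by (metis fps_mult_nth_0 log_deriv_mult mult_1 one_neq_zero)
    have "fps_nth (log_deriv D) (p * k) = fps_nth (log_deriv D) k ^ p"
    proof (cases "k = 0")
      case True
      then show ?thesis by (simp add: log_deriv_def power_0_left)
    next
      case False
      then have pk: "0 < k" "0 < p * k" by simp_all
      show ?thesis
      proof (cases "?n dvd k")
        case True
        then have "p * k div ?n = p * (k div ?n)" by (rule div_mult_swap[symmetric])
        then show ?thesis
          using True pk unfolding D_def
          by (simp add: log_deriv_binomial_nth power_mult_distrib frobenius_minus frobenius_of_nat
              mult.commute[of p] power_mult del: power_Suc of_nat_Suc)
      next
        case n: False
        \<comment> \<open>If \<open>?n\<close> divides \<open>p * k\<close> but not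
          \<open>k\<close>, then \<open>p\<close> divides \<open>?n\<close>, and the factor
          \<open>of_nat ?n\<close> removes the unwanted coefficient.\<close>
        have "(of_nat ?n :: 'a) = 0" if "?n dvd p * k"
        proof -
          have "\<not> coprime ?n p" using n that coprime_dvd_mult_right_iff by blast
          then have "p dvd ?n" using prime_p prime_imp_coprime coprime_commute by blast
          then show ?thesis using char_p of_nat_eq_0_iff_char_dvd by blast
        qed
        then show ?thesis
          using n pk unfolding D_def
          by (simp add: log_deriv_binomial_nth power_0_left del: power_Suc of_nat_Suc)
      qed
    qed
    moreover have "fps_nth (log_deriv A) k ^ p = fps_nth (log_deriv D) k ^ p
        + fps_nth (log_deriv B) k ^ p"
      unfolding sum using frobenius_add[of _ _ 1] by simp
    ultimately show ?case by (simp add: sum IH)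
  qed
  from this[of 0] show ?thesis using assms by (simp add: agree_upto_def)
qed

text \<open>The conjugation equation is expanded to first order in \<open>eps ^ p ^ n\<close> and
  divided by \<open>A\<close>; what is dropped is quadratic in the small quantities. The level
  \<open>n = 0\<close> is included for the sake of \<open>resonance_generic\<close>.\<close>

lemma conj_linearized:
  assumes "0 < r" "gauss_le r (eps ^ p ^ n) (G - fps_const l)"
    and "gauss_le r 1 A" "fps_nth A 0 = 1" "conj_defect (p ^ n) G A H = 0"
  shows "gauss_le r ((eps ^ p ^ n)\<^sup>2) ((G - fps_const l)
    + fps_const l * (G ^ p ^ n - 1) * log_deriv A - ((H - fps_const l) oo (fps_X * A ^ p ^ n)))"
proof -
  let ?nu = "eps ^ p ^ n"
  define d where "d = G - fps_const l"
  define u where "u = G ^ p ^ n - 1"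
  define e where "e = (H - fps_const l) oo (fps_X * A ^ p ^ n)"
  define T where "T = (A oo (fps_X * (1 + u))) - A - u * (fps_X * fps_deriv A)"
  have r: "0 \<le> r" using assms(1) by simp
  have d: "gauss_le r ?nu d" using assms(2) by (simp add: d_def)
  have u: "gauss_le r ?nu u" unfolding u_def by (rule gauss_le_power_minus_1[OF assms(1,2)])
  have T: "gauss_le r (?nu\<^sup>2) T"
    unfolding T_def using assms u eps_power_le_1 r by (intro gauss_le_compose_taylor) auto
  have L: "log_deriv A * A = fps_X * fps_deriv A" using assms(4) by (simp add: log_deriv_times)
  have \<theta>: "gauss_le r 1 (fps_X * fps_deriv A)"
    using r assms(3) by (rule gauss_le_X_deriv)
  have "G * (A oo (fps_X * (1 + u))) = A * (H oo (fps_X * A ^ p ^ n))"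
    using assms(5) by (simp add: u_def conj_defect_def)
  then have "(fps_const l + d) * (A + u * (fps_X * fps_deriv A) + T) = A * (fps_const l + e)"
    by (simp add: d_def T_def e_def fps_compose_sub_distrib)
  then have "(d + fps_const l * u * log_deriv A - e) * A = - (d * u * (fps_X * fps_deriv A)
      + (fps_const l + d) * T)"
    using L by algebra
  then have "(d + fps_const l * u * log_deriv A - e) * (A * inverse A) =
      - (d * u * (fps_X * fps_deriv A) + T * (fps_const l + d)) * inverse A"
    by (simp add: mult.assoc[symmetric] mult.commute[of T])
  then have eq: "d + fps_const l * u * log_deriv A - e =
      - (d * u * (fps_X * fps_deriv A) + T * (fps_const l + d)) * inverse A"
    using assms(4) by (simp add: inverse_mult_eq_1')
  have "gauss_le r (?nu\<^sup>2) (d * u * (fps_X * fps_deriv A) + T * (fps_const l + d))"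
  proof (intro gauss_le_add r)
    have "gauss_le r (?nu\<^sup>2) (d * u)"
      using gauss_le_mult[OF r d u] by (simp add: power2_eq_square)
    then show "gauss_le r (?nu\<^sup>2) (d * u * (fps_X * fps_deriv A))"
      using \<theta> r by (rule gauss_le_mult1[rotated])
    have "gauss_le r 1 (fps_const l + d)"
      using gauss_le_near_multiplier[OF assms(1,2)] by (simp add: d_def)
    then show "gauss_le r (?nu\<^sup>2) (T * (fps_const l + d))"
      using T r by (intro gauss_le_mult1) auto
  qed
  then have "gauss_le r (?nu\<^sup>2) (d + fps_const l * u * log_deriv A - e)"
    unfolding eq using gauss_le_inverse[OF r assms(3,4)] gauss_le_minus r gauss_le_mult1 by blast
  then show ?thesis by (simp add: d_def u_def e_def)
qed

end

section \<open>Renormalization\<close>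

context near_one_multiplier
begin

text \<open>Dividing by \<open>eps ^ p ^ n\<close> and reducing modulo the maximal ideal turns the conjugation
  equation into \<open>d + L = d'\<close> with \<open>L\<close> the logarithmic derivative of \<open>A\<close>. As \<open>d'\<close> only has
  exponents divisible by \<open>p\<close>, \<open>L\<close> is \<open>- d\<close> at \<open>J\<close>, hence a \<open>p\<close>-th power of it at \<open>p * J\<close>, where
  \<open>d\<close> vanishes.\<close>

lemma residue_step:
  assumes r: "0 < r" and n: "0 < n" and J: "0 < J" "J < p"
    and G: "fps_nth G 0 = l" "gauss_le r (eps ^ p ^ n) (G - fps_const l)"
    and A: "gauss_le r 1 A" "fps_nth A 0 = 1"
    and H: "fps_nth H 0 = l" "\<And>k. \<not> p dvd k \<Longrightarrow> fps_nth H k = 0"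
    and AH: "conj_defect (p ^ n) G A H = 0"
    and GJ: "abs_val (fps_nth G J) * r ^ J = eps ^ p ^ n"
      "abs_val (fps_nth G (p * J)) * r ^ (p * J) < eps ^ p ^ n"
  shows "abs_val (fps_nth H (p * J)) * r ^ (p * J) = eps ^ p ^ n"
proof -
  let ?q = "p ^ n" and ?nu = "eps ^ p ^ n"
  let ?\<kappa> = "l * (l ^ ?q - 1)"
  define d where "d = G - fps_const l"
  define e where "e = (H - fps_const l) oo (fps_X * A ^ ?q)"
  define L where "L = log_deriv A"
  define E where "E = d + fps_const ?\<kappa> * L - e"
  have r0: "0 \<le> r" using r by simp
  have nu: "0 < ?nu" "?nu < 1" using eps_pos eps_power_less_1 by auto
  have p2: "2 \<le> p" using prime_p prime_ge_2_nat by blast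
  have q2: "2 \<le> ?q" using p2 n by (metis One_nat_def Suc_leI dual_order.trans p_pos
      power_increasing power_one_right)
  have d: "gauss_le r ?nu d" using G(2) by (simp add: d_def)
  have L: "gauss_le r 1 L"
    unfolding L_def using r0 A by (rule gauss_le_log_deriv)
  have "gauss_le r (?nu\<^sup>2) E"
  proof -
    \<comment> \<open>Only the constant part of \<open>G ^ ?q - 1\<close> matters: the rest,
      \<open>d ^ ?q\<close>, is at most \<open>?nu\<^sup>2\<close>, since \<open>0 < n\<close> makes
      \<open>?q\<close> at least 2.\<close>
    have Gq: "G ^ ?q - 1 = fps_const (l ^ ?q - 1) + d ^ ?q"
    proof -
      have "G ^ ?q = (fps_const l + d) ^ ?q" by (simp add: d_def)
      also have "\<dots> = fps_const (l ^ ?q) + d ^ ?q"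
        by (simp only: frobenius_add_fps fps_const_power)
      finally show ?thesis by (simp flip: fps_const_sub)
    qed
    have "gauss_le r (?nu ^ ?q) (d ^ ?q * (fps_const l * L))"
      using r0 L d gauss_le_const[of r l 1] gauss_le_mult1[OF r0 _ L, of 1 "fps_const l"]
      by (intro gauss_le_mult1 gauss_le_power) auto
    then have "gauss_le r (?nu\<^sup>2) (d ^ ?q * (fps_const l * L))"
      using nu q2 by (elim gauss_le_mono) (simp add: power_decreasing)
    moreover have "E = (d + fps_const l * (G ^ ?q - 1) * L - e) - d ^ ?q * (fps_const l * L)"
      unfolding Gq E_def by (simp add: algebra_simps flip: fps_const_mult)
    ultimately show ?thesis
      using conj_linearized[OF r G(2) A AH] r0 unfolding d_def L_def e_def
      by (auto intro: gauss_le_diff)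
  qed
  then have E: "abs_val (fps_nth E k) < ?nu / r ^ k" for k
  proof -
    assume "gauss_le r (?nu\<^sup>2) E"
    then have "abs_val (fps_nth E k) * r ^ k \<le> ?nu\<^sup>2" by (rule gauss_leD)
    also have "\<dots> < ?nu" using nu by (simp add: power2_eq_square)
    finally show ?thesis using r by (simp add: field_simps)
  qed
  have eJ: "fps_nth e J = 0"
    unfolding e_def fps_compose_nth
  proof (intro sum.neutral ballI)
    fix i assume "i \<in> {0..J}"
    then have "i = 0 \<or> \<not> p dvd i" using J by (auto dest: dvd_imp_le)
    then show "fps_nth (H - fps_const l) i * fps_nth ((fps_X * A ^ ?q) ^ i) J = 0"
      using H by auto
  qed
  have epJ: "fps_nth e (p * J) = fps_nth H (p * J)"
  proof -
    have "fps_nth e (p * J) =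
        (\<Sum>i=0..p * J. if i = p * J then fps_nth H (p * J) else 0)"
      unfolding e_def fps_compose_nth
    proof (intro sum.cong refl)
      fix i assume i: "i \<in> {0..p * J}"
      consider "i = 0" | "\<not> p dvd i" | "p dvd i" "0 < i" "i < p * J" | "0 < i" "i = p * J"
        using i by force
      then show "fps_nth (H - fps_const l) i * fps_nth ((fps_X * A ^ ?q) ^ i) (p * J) =
          (if i = p * J then fps_nth H (p * J) else 0)"
      proof cases
        case 1
        then show ?thesis using H J by simp
      next
        case 2
        then show ?thesis using H by (cases "i = 0") auto
      next
        case 3
        obtain j where j: "i = p * j" using 3 by blast
        \<comment> \<open>The extra factor \<open>p\<close> in \<open>i\<close> raises the power to
          \<open>p ^ Suc n\<close>, so only exponents divisible by \<open>p ^ Suc n\<close> occur.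
          The gap \<open>p * J - i\<close> is positive and below \<open>p * p\<close>, hence not
          among them.\<close>
        have "(A ^ ?q) ^ i = (A ^ j) ^ (p ^ Suc n)"
          unfolding j by (simp add: mult_ac flip: power_mult)
        moreover have "\<not> p ^ Suc n dvd p * J - i"
        proof
          assume "p ^ Suc n dvd p * J - i"
          then have "p ^ Suc n \<le> p * J - i" using 3 by (intro dvd_imp_le) auto
          also have "\<dots> < p * p" using 3 J by (metis diff_le_self le_less_trans mult_less_mono2
              p_pos)
          also have "\<dots> \<le> p ^ Suc n" using n p_pos self_le_power[of p n] by (simp add: Suc_le_eq)
          finally show False by simp
        qed
        ultimately have "fps_nth ((A ^ ?q) ^ i) (p * J - i) = 0"
          by (simp only: frobenius_fps_nth if_False)
        then show ?thesis using 3 by (simp add: power_mult_distrib fps_X_power_mult_nth)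
      next
        case 4
        then show ?thesis
          using A by (simp add: power_mult_distrib fps_X_power_mult_nth fps_power_zeroth)
      qed
    qed
    then show ?thesis by simp
  qed
  have \<kappa>: "abs_val ?\<kappa> = ?nu"
    using abs_val_one_minus_l_power[of 1 n] p2 by (simp add: abs_val_mult abs_val_minus_commute)
  have "abs_val (?\<kappa> * fps_nth L J) = ?nu / r ^ J"
  proof -
    have GJ': "abs_val (- fps_nth G J) = ?nu / r ^ J" using GJ(1) r by (simp add: field_simps)
    have "fps_nth E J = ?\<kappa> * fps_nth L J - (- fps_nth G J)"
      using J eJ by (simp add: E_def d_def)
    with E[of J] GJ' show ?thesis using abs_val_eq_of_diff[of "?\<kappa> * fps_nth L J" "- fps_nth G J"]
        by simp
  qed
  then have "?nu * abs_val (fps_nth L J) = ?nu * (1 / r ^ J)"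
    using \<kappa> by (simp only: abs_val_mult) simp
  then have "abs_val (fps_nth L J) = 1 / r ^ J"
    using nu(1) mult_left_cancel[of ?nu "abs_val (fps_nth L J)" "1 / r ^ J"] by linarith
  then have "abs_val (fps_nth L (p * J)) = 1 / r ^ (p * J)"
    using log_deriv_frobenius[OF A(2), of J] r
    by (simp add: L_def abs_val_power power_divide mult.commute[of p] flip: power_mult)
  then have LpJ: "abs_val (?\<kappa> * fps_nth L (p * J)) = ?nu / r ^ (p * J)"
    using \<kappa> by (simp add: abs_val_mult)
  have "fps_nth H (p * J) = ?\<kappa> * fps_nth L (p * J) + (fps_nth G (p * J) + - fps_nth E (p * J))"
    using J epJ by (simp add: E_def d_def)
  moreover have "abs_val (fps_nth G (p * J) + - fps_nth E (p * J)) < ?nu / r ^ (p * J)"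
    using E[of "p * J"] GJ(2) r by (intro abs_val_add_less) (simp_all add: field_simps)
  ultimately have "abs_val (fps_nth H (p * J)) = ?nu / r ^ (p * J)"
    using LpJ abs_val_add_eq by metis
  then show ?thesis using r by simp
qed

text \<open>A map \<open>lift (p ^ n) G\<close> in \<open>n\<close>-th partial normal form at its critical radius, measured in
  the variable \<open>z ^ p ^ n\<close>.\<close>

definition critical :: "nat \<Rightarrow> real \<Rightarrow> 'a fps \<Rightarrow> bool" where
  "critical n r G \<longleftrightarrow> 0 < r \<and> fps_nth G 0 = l \<and> gauss_le r (eps ^ p ^ n) (G - fps_const l) \<and>
    (\<exists>J\<in>{1, 2}. abs_val (fps_nth G J) * r ^ J = eps ^ p ^ n) \<and>
    (\<forall>j\<ge>3. abs_val (fps_nth G j) * r ^ j < eps ^ p ^ n)"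

text \<open>The lowest term of \<psi> outside the residue class 1 modulo \<open>q\<close>, say at
  exponent \<open>Suc j\<close>, would be multiplied by \<open>l ^ Suc j\<close> as well as by
  \<open>l\<close>, which is impossible as \<open>l\<close> is not a root of unity.\<close>

lemma eigenseries_lift:
  assumes "0 < q" "fps_nth \<psi> 0 = 0" "fps_nth G 0 = l" "\<psi> oo lift q G = fps_const l * \<psi>"
  obtains B where "\<psi> = lift q B"
proof
  define B where "B = Abs_fps (\<lambda>j. fps_nth \<psi> (Suc (q * j)))"
  define D where "D = \<psi> - lift q B"
  have "D oo lift q G = fps_const l * \<psi> - lift q (G * (B oo (fps_X * G ^ q)))"
    using assms by (simp add: D_def fps_compose_sub_distrib lift_compose)
  then have D: "fps_nth (D oo lift q G) k =
      l * fps_nth \<psi> k - fps_nth (lift q (G * (B oo (fps_X * G ^ q)))) k" for k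
    by simp
  have "fps_nth D k = 0" for k
  proof (induction k rule: less_induct)
    case (less k)
    show ?case
    proof (cases k)
      case 0
      then show ?thesis using assms by (simp add: D_def)
    next
      case (Suc j)
      show ?thesis
      proof (cases "q dvd j")
        case True
        then show ?thesis using Suc by (simp add: D_def B_def lift_nth_Suc)
      next
        case False
        have "fps_nth (D oo lift q G) k = (\<Sum>i=0..k. if i = k then fps_nth D k * l ^ k else 0)"
          unfolding fps_compose_nth
        proof (intro sum.cong refl)
          fix i assume "i \<in> {0..k}"
          then show "fps_nth D i * fps_nth (lift q G ^ i) k = (if i
              = k then fps_nth D k * l ^ k else 0)"
            using less assms by (cases "i = k") (simp_all add: startsby_zero_power_nth_same)
        qed
        then have "fps_nth D k * l ^ k = l * fps_nth D k"
          using D[of k] False Suc by (simp add: D_def lift_nth_Suc)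
        then have "fps_nth D k * (l * (l ^ j - 1)) = 0" by (simp add: Suc algebra_simps)
        moreover have "0 < j" using False by (cases j) auto
        ultimately show ?thesis using not_root_of_unity[of j] by simp
      qed
    qed
  qed
  then show "\<psi> = lift q B"
    by (intro fps_ext) (simp add: D_def)
qed

text \<open>A linearization would be a conjugation to \<open>H = l\<close>, contradicting \<open>residue_step\<close>.\<close>

lemma critical_no_linearization:
  assumes p3: "3 \<le> p" and n: "0 < n" and r: "0 < r" and G: "critical n (r ^ p ^ n) G"
    and \<psi>: "fps_nth \<psi> 0 = 0" "fps_nth \<psi> 1 = 1" "gauss_le r r \<psi>"
      "\<psi> oo lift (p ^ n) G = fps_const l * \<psi>"
  shows False
proof -
  let ?q = "p ^ n"
  note G' = G[unfolded critical_def]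
  have q: "0 < ?q" by simp
  obtain B where B: "\<psi> = lift ?q B"
    using eigenseries_lift[OF q \<psi>(1) _ \<psi>(4)] G' by blast
  have B0: "fps_nth B 0 = 1" using \<psi>(2) by (simp add: B)
  have "gauss_le (r ^ ?q) 1 B"
    unfolding gauss_le_def
  proof
    fix k
    have "abs_val (fps_nth B k) * r ^ Suc (?q * k) \<le> r"
      using gauss_leD[OF \<psi>(3), of "Suc (?q * k)"] by (simp add: B lift_nth_Suc)
    then have "(abs_val (fps_nth B k) * (r ^ ?q) ^ k) * r \<le> 1 * r"
      by (simp add: mult_ac flip: power_mult)
    then show "abs_val (fps_nth B k) * (r ^ ?q) ^ k \<le> 1" using r by simp
  qed
  moreover have "conj_defect ?q G B (fps_const l) = 0"
    using \<psi>(4) by (simp add: conj_defect_eq_0_iff[OF q] B[symmetric] lift_const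
        fps_compose_mult_distrib
        fps_X_fps_compose_startby0 \<psi>(1))
  moreover obtain J where J: "J \<in> {1, 2}" "abs_val (fps_nth G J) * (r ^ ?q) ^ J = eps ^ ?q"
    using G' by blast
  \<comment> \<open>As \<open>p * J\<close> is at least 3, it belongs to the negligible indices of a
    critical form.\<close>
  moreover have "abs_val (fps_nth G (p * J)) * (r ^ ?q) ^ (p * J) < eps ^ ?q"
    using J(1) p3 G' by auto
  moreover have "0 < J" "J < p" using J(1) p3 by auto
  moreover have "fps_nth (fps_const l) k = 0" if "\<not> p dvd k" for k
    using that by (cases k) auto
  ultimately have "abs_val (fps_nth (fps_const l) (p * J)) * (r ^ ?q) ^ (p * J) = eps ^ ?q"
    using G' n B0 by (intro residue_step[where A=B and G=G and J=J and n=n]) auto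
  then show False using J(1) p3 eps_pos by auto
qed

end

text \<open>The radius \<open>s\<close> is where the larger of the first two terms equals
  \<open>T\<close>. Since the term of size at least \<open>D\<close> has index at most 2,
  \<open>(s / R)^2\<close> is at most \<open>T / D\<close>. All later terms are then at most
  \<open>B * (s / R) ^ 3\<close>, whose square is at most \<open>B^2 * (T / D) ^ 3\<close>; the
  condition \<open>B^2 * T < D ^ 3\<close> puts this below \<open>T^2\<close>.\<close>

lemma critical_radius:
  fixes a :: "nat \<Rightarrow> real"
  assumes "0 < R" and a: "\<And>k. 0 \<le> a k" "\<And>k. 0 < k \<Longrightarrow> a k * R ^ k \<le> B"
    and J: "J \<in> {1, 2}" "D \<le> a J * R ^ J" and T: "0 < T" "T < D" "B\<^sup>2 * T < D ^ 3"
  obtains s where "0 < s" "s < R" "(s / R)\<^sup>2 \<le> T / D" "\<And>k. 0 < k \<Longrightarrow> a k * s ^ k \<le> T"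
    "\<exists>J\<in>{1, 2}. a J * s ^ J = T" "\<And>k. 3 \<le> k \<Longrightarrow> a k * s ^ k < T"
proof -
  define g where "g s = max (a 1 * s) (a 2 * s\<^sup>2)" for s
  have "D \<le> g R" using J by (auto simp: g_def)
  then have "\<exists>s\<ge>0. s \<le> R \<and> g s = T"
    using assms(1) T unfolding g_def by (intro IVT') (auto intro!: continuous_intros)
  then obtain s where s: "0 \<le> s" "s \<le> R" "g s = T" by blast
  have s0: "0 < s" using s T by (cases "s = 0") (auto simp: g_def)
  have sR: "s < R" using s T \<open>D \<le> g R\<close> by (cases "s = R") auto
  have le: "a 1 * s ^ 1 \<le> T" "a 2 * s ^ 2 \<le> T" using s by (auto simp: g_def)
  let ?x = "s / R"
  have x: "0 < ?x" "?x < 1" using s0 sR by auto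
  have "D * ?x ^ J \<le> T"
  proof -
    have "D * ?x ^ J \<le> (a J * R ^ J) * ?x ^ J" using J x by (intro mult_right_mono) auto
    also have "\<dots> = a J * s ^ J" using assms(1) by (simp add: power_divide)
    also have "\<dots> \<le> T" using J le by auto
    finally show ?thesis .
  qed
  moreover have "?x\<^sup>2 \<le> ?x ^ J" using J x by (intro power_decreasing) auto
  ultimately have "D * ?x\<^sup>2 \<le> T"
    using T by (meson less_le_trans mult_left_mono order.trans less_imp_le less_trans)
  then have x2: "?x\<^sup>2 \<le> T / D" using T by (simp add: field_simps)
  have B: "0 \<le> B" using a(1)[of 1] a(2)[of 1] assms(1)
      by (meson less_numeral_extra(1) mult_nonneg_nonneg order_trans zero_le_power less_imp_le)
  have lt: "a k * s ^ k < T" if "3 \<le> k" for k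
  proof -
    have "a k * s ^ k = (a k * R ^ k) * ?x ^ k" using assms(1) by (simp add: power_divide)
    also have "\<dots> \<le> B * ?x ^ k" using a(2)[of k] that x by (intro mult_right_mono) auto
    also have "\<dots> \<le> B * ?x ^ 3" using that x B by (intro mult_left_mono power_decreasing) auto
    also have "\<dots> < T"
    proof (rule power2_less_imp_less)
      have "(B * ?x ^ 3)\<^sup>2 = B\<^sup>2 * (?x\<^sup>2) ^ 3" by (simp add: power_mult_distrib flip: power_mult)
      also have "\<dots> \<le> B\<^sup>2 * (T / D) ^ 3" using x2 by (intro mult_left_mono power_mono) auto
      also have "\<dots> = (B\<^sup>2 * T) * T\<^sup>2 / D ^ 3"
        by (simp add: power_divide power2_eq_square power3_eq_cube)
      also have "\<dots> < D ^ 3 * T\<^sup>2 / D ^ 3"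
        using T by (intro divide_strict_right_mono mult_strict_right_mono) auto
      also have "\<dots> = T\<^sup>2" using T by simp
      finally show "(B * ?x ^ 3)\<^sup>2 < T\<^sup>2" .
    qed (use T in simp)
    finally show ?thesis .
  qed
  have "a k * s ^ k \<le> T" if "0 < k" for k
  proof -
    have "k = 1 \<or> k = 2 \<or> 3 \<le> k" using that by arith
    then show ?thesis using le lt by (auto intro: less_imp_le)
  qed
  moreover have "\<exists>J\<in>{1, 2}. a J * s ^ J = T" using s(3)
      by (auto simp: g_def max_def split: if_splits)
  ultimately show thesis using that s0 sR x2 lt by blast
qed

section \<open>Passage to the next level and decay of the critical radii\<close>

context near_one_multiplier
begin

text \<open>By \<open>residue_step\<close>, coefficient 1 or 2 of the new form still has size
  \<open>eps ^ p ^ n\<close> on the old disc, whereas the new threshold is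
  \<open>eps ^ p ^ Suc n\<close>. The ratio of the two bounds the squared ratio of the radii. With
  \<open>B = D\<close>, the condition of \<open>critical_radius\<close> reduces to
  \<open>T < D\<close>.\<close>

lemma level_step:
  assumes p3: "3 \<le> p" and n: "0 < n" and G: "critical n r G"
  obtains A G' s where "fps_nth A 0 = 1" "gauss_le r 1 A"
    "lift (p ^ n) A oo lift (p ^ n) G = lift (p ^ Suc n) G' oo lift (p ^ n) A"
    "critical (Suc n) s G'" "s < r ^ p" "(s / r ^ p)\<^sup>2 \<le> (eps ^ (p - 1)) ^ p ^ n"
proof -
  let ?q = "p ^ n" and ?nu = "eps ^ p ^ n"
  note G' = G[unfolded critical_def]
  have r: "0 < r" and nu: "0 < ?nu" using G' eps_pos by auto
  obtain A H where A: "fps_nth A 0 = 1" "gauss_le r 1 A"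
    and H: "fps_nth H 0 = l" "gauss_le r ?nu (H - fps_const l)" "\<And>k. \<not> p dvd k \<Longrightarrow> fps_nth H k = 0"
    and AH: "conj_defect ?q G A H = 0"
    using normal_form[of r G n] G' r by metis
  define K where "K = Abs_fps (\<lambda>j. fps_nth H (p * j))"
  have HK: "H = K oo fps_X ^ p"
    using H(3) by (intro fps_ext) (auto simp: K_def fps_nth_compose_X_power)
  obtain J where J: "J \<in> {1, 2}" "abs_val (fps_nth G J) * r ^ J = ?nu"
    using G' by blast
  have "abs_val (fps_nth H (p * J)) * r ^ (p * J) = ?nu"
  proof (rule residue_step[OF r n])
    show "abs_val (fps_nth G (p * J)) * r ^ (p * J) < ?nu" using J(1) p3 G' by auto
  qed (use J G' A H AH p3 in auto)
  then have KJ: "?nu \<le> abs_val (fps_nth K J) * (r ^ p) ^ J"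
    by (simp add: K_def power_mult)
  have K: "abs_val (fps_nth K k) * (r ^ p) ^ k \<le> ?nu" if "0 < k" for k
    using gauss_leD[OF H(2), of "p * k"] that p3 by (simp add: K_def power_mult split: if_splits)
  have nu': "eps ^ p ^ Suc n = ?nu * (eps ^ (p - 1)) ^ ?q"
  proof -
    have "p ^ Suc n = (1 + (p - 1)) * ?q" using p_pos by simp
    then have "p ^ Suc n = ?q + (p - 1) * ?q" by (simp only: distrib_right mult_1)
    then show ?thesis by (simp only: power_add power_mult)
  qed
  have lt: "eps ^ p ^ Suc n < ?nu"
    using p3 by (intro eps_power_strict_mono) simp
  have "?nu\<^sup>2 * eps ^ p ^ Suc n < ?nu ^ 3"
    using lt nu by (simp add: power2_eq_square power3_eq_cube mult.assoc)
  then obtain s where s: "0 < s" "s < r ^ p" "(s / r ^ p)\<^sup>2 \<le> eps ^ p ^ Suc n / ?nu"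
    "\<And>k. 0 < k \<Longrightarrow> abs_val (fps_nth K k) * s ^ k \<le> eps ^ p ^ Suc n"
    "\<exists>J\<in>{1, 2}. abs_val (fps_nth K J) * s ^ J = eps ^ p ^ Suc n"
    "\<And>k. 3 \<le> k \<Longrightarrow> abs_val (fps_nth K k) * s ^ k < eps ^ p ^ Suc n"
    using critical_radius[of "r ^ p" "\<lambda>k. abs_val (fps_nth K k)" ?nu J ?nu "eps ^ p ^ Suc n"]
      r K J(1) KJ lt eps_pos by auto
  show thesis
  proof (rule that[OF A _ _ s(2)])
    show "lift ?q A oo lift ?q G = lift (p ^ Suc n) K oo lift ?q A"
      using AH unfolding HK by (subst (asm) conj_defect_eq_0_iff) (simp_all add:
          lift_compose_X_power)
    have "gauss_le s (eps ^ p ^ Suc n) (K - fps_const l)"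
      unfolding gauss_le_def
    proof
      fix k show "abs_val (fps_nth (K - fps_const l) k) * s ^ k \<le> eps ^ p ^ Suc n"
        using s(4)[of k] H(1) eps_pos by (cases "k = 0") (simp_all add: K_def)
    qed
    then show "critical (Suc n) s K"
      using s H(1) by (auto simp: critical_def K_def)
    show "(s / r ^ p)\<^sup>2 \<le> (eps ^ (p - 1)) ^ ?q"
      using s(3) eps_pos by (simp only: nu') simp
  qed
qed

text \<open>\<open>level_step\<close> compares radii in the variable \<open>z ^ p ^ Suc n\<close>,
  with a bound that is itself a power depending on the level. Passing back to radii in
  \<open>z\<close> takes a root that cancels this dependence, leaving the constant factor
  \<open>root (2 * p) (eps ^ (p - 1))\<close>.\<close>

lemma critical_levels:
  assumes p3: "3 \<le> p" and f: "fps_nth f 0 = 0"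
    and base: "0 < r" "fps_nth \<phi> 0 = 0" "fps_nth \<phi> 1 = 1" "gauss_le r r \<phi>"
      "\<phi> oo f = lift p G oo \<phi>" "critical 1 (r ^ p) G"
  shows "\<exists>\<phi> G s. 0 < s \<and> s \<le> r * root (2 * p) (eps ^ (p - 1)) ^ n \<and> fps_nth \<phi> 0 = 0 \<and>
    fps_nth \<phi> 1 = 1 \<and> gauss_le s s \<phi> \<and> \<phi> oo f = lift (p ^ Suc n) G oo \<phi> \<and>
    critical (Suc n) (s ^ p ^ Suc n) G"
proof (induction n)
  case 0
  show ?case using base by (intro exI[of _ \<phi>] exI[of _ G] exI[of _ r]) simp
next
  case (Suc n)
  let ?\<theta> = "root (2 * p) (eps ^ (p - 1))" and ?q = "p ^ Suc n"
  obtain \<phi> G s where s: "0 < s" "s \<le> r * ?\<theta> ^ n" and \<phi>: "fps_nth \<phi> 0 = 0" "fps_nth \<phi> 1 = 1"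
      "gauss_le s s \<phi>"
    "\<phi> oo f = lift ?q G oo \<phi>" and G: "critical (Suc n) (s ^ ?q) G"
    using Suc by blast
  obtain A K t where A: "fps_nth A 0 = 1" "gauss_le (s ^ ?q) 1 A"
    and conj: "lift ?q A oo lift ?q G = lift (p ^ Suc (Suc n)) K oo lift ?q A"
    and K: "critical (Suc (Suc n)) t K" and t: "t < (s ^ ?q) ^ p" "(t / (s ^ ?q) ^ p)\<^sup>2
        \<le> (eps ^ (p - 1)) ^ ?q"
    using level_step[OF p3 _ G] by (metis zero_less_Suc)
  define u where "u = root (p ^ Suc (Suc n)) t"
  have t0: "0 < t" using K by (simp add: critical_def)
  have pn: "0 < p ^ Suc (Suc n)" by simp
  have u: "0 < u" "u ^ p ^ Suc (Suc n) = t"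
    using t0 pn unfolding u_def by (auto simp: real_root_gt_zero real_root_pow_pos2 simp del:
        power_Suc)
  have s': "(s ^ ?q) ^ p = s ^ p ^ Suc (Suc n)" by (simp add: mult.commute flip: power_mult)
  have us: "u < s"
    using t(1) s(1) u unfolding s' by (metis less_imp_le power_less_imp_less_base)
  have "u / s \<le> ?\<theta>"
  proof -
    have \<theta>: "0 \<le> ?\<theta>" "?\<theta> ^ (2 * p) = eps ^ (p - 1)"
      using eps_pos by (auto simp: real_root_pow_pos2)
    have "((u / s) ^ (2 * p)) ^ ?q = (t / (s ^ ?q) ^ p)\<^sup>2"
      unfolding s' u(2)[symmetric] power_divide[symmetric]
      by (simp add: mult_ac flip: power_mult)
    also have "\<dots> \<le> (?\<theta> ^ (2 * p)) ^ ?q" using t(2) \<theta> by simp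
    finally have "(u / s) ^ (2 * p * ?q) \<le> ?\<theta> ^ (2 * p * ?q)" by (simp only: power_mult)
    moreover have "0 < 2 * p * ?q" by simp
    ultimately show ?thesis using \<theta>(1) power_mono_iff[of "u / s" ?\<theta> "2 * p * ?q"] u s by simp
  qed
  then have "u \<le> s * ?\<theta>" using s(1) by (simp add: field_simps)
  also have "\<dots> \<le> (r * ?\<theta> ^ n) * ?\<theta>"
    using s eps_pos by (intro mult_right_mono) auto
  finally have ur: "u \<le> r * ?\<theta> ^ Suc n" by (simp add: mult_ac)
  let ?\<phi> = "lift ?q A oo \<phi>"
  have lA: "gauss_le s s (lift ?q A)" using A s by (intro gauss_le_lift) auto
  have \<phi>0: "fps_nth ?\<phi> 0 = 0" by simp
  have \<phi>1: "fps_nth ?\<phi> 1 = 1" using \<phi> A by (simp add: fps_compose_nth)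
  have "gauss_le s s ?\<phi>" using s lA \<phi> by (intro gauss_le_compose) auto
  then have "gauss_le u u ?\<phi>"
    using us u \<phi>0 by (intro gauss_le_normalized_radius_mono[of u s]) auto
  moreover have "?\<phi> oo f = lift (p ^ Suc (Suc n)) K oo ?\<phi>"
  proof -
    have "?\<phi> oo f = lift ?q A oo (\<phi> oo f)" using f \<phi> by (intro fps_compose_assoc[symmetric])
    also have "\<dots> = (lift ?q A oo lift ?q G) oo \<phi>"
      unfolding \<phi>(4) using \<phi> by (intro fps_compose_assoc) auto
    also have "\<dots> = lift (p ^ Suc (Suc n)) K oo ?\<phi>"
      unfolding conj using \<phi> by (intro fps_compose_assoc[symmetric]) auto
    finally show ?thesis .
  qed
  moreover have "critical (Suc (Suc n)) (u ^ p ^ Suc (Suc n)) K" using K u by simp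
  ultimately show ?case using u(1) ur \<phi>0 \<phi>1 by blast
qed

text \<open>Once the critical radius is below \<open>R\<close>, composing \<open>h\<close> with the
  inverse of the coordinate change linearizes the normal form integrally on its critical
  disc.\<close>

lemma no_integral_linearization:
  assumes p3: "3 \<le> p" and f: "fps_nth f 0 = 0"
    and base: "0 < r" "fps_nth \<phi> 0 = 0" "fps_nth \<phi> 1 = 1" "gauss_le r r \<phi>"
      "\<phi> oo f = lift p G oo \<phi>" "critical 1 (r ^ p) G"
    and h: "0 < R" "fps_nth h 0 = 0" "fps_nth h 1 = 1" "gauss_le R R h" "h oo f = fps_const l * h"
  shows False
proof -
  let ?\<theta> = "root (2 * p) (eps ^ (p - 1))"
  have "0 < eps ^ (p - 1)" "eps ^ (p - 1) < 1" using eps_pos eps_power_less_1[of "p - 1"] p3 by auto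
  then have \<theta>: "0 < ?\<theta>" "?\<theta> < 1" by (auto simp: real_root_gt_zero)
  have "(\<lambda>n. r * ?\<theta> ^ n) \<longlonglongrightarrow> r * 0"
    using \<theta> by (intro tendsto_intros LIMSEQ_realpow_zero) auto
  then have "\<forall>\<^sub>F n in sequentially. r * ?\<theta> ^ n < R"
    using h(1) by (intro order_tendstoD) auto
  then obtain n where n: "r * ?\<theta> ^ n < R" using eventually_happens by fastforce
  obtain \<phi> G s where s: "0 < s" "s \<le> r * ?\<theta> ^ n"
    and \<phi>: "fps_nth \<phi> 0 = 0" "fps_nth \<phi> 1 = 1" "gauss_le s s \<phi>" "\<phi> oo f = lift (p ^ Suc n) G oo \<phi>"
    and G: "critical (Suc n) (s ^ p ^ Suc n) G"
    using critical_levels[OF p3 f base, of n] by blast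
  let ?i = "fps_inv \<phi>"
  have i: "\<phi> oo ?i = fps_X" "?i oo \<phi> = fps_X" "fps_nth ?i 0 = 0" "gauss_le s s ?i" "fps_nth ?i 1
      = 1"
  proof -
    show "fps_nth ?i 0 = 0" "fps_nth ?i 1 = 1" using \<phi> by (simp_all add: fps_inv_def)
  qed (use \<phi> s in \<open>simp_all add: fps_inv fps_inv_right gauss_le_fps_inv\<close>)
  have "gauss_le s s (h oo ?i)"
    using gauss_le_normalized_radius_mono[of s R h] h s n i by (intro gauss_le_compose) auto
  moreover have "fps_nth (h oo ?i) 0 = 0" "fps_nth (h oo ?i) 1 = 1"
    using h i by (auto simp: fps_compose_nth)
  moreover have "(h oo ?i) oo lift (p ^ Suc n) G = fps_const l * (h oo ?i)"
  proof -
    have "lift (p ^ Suc n) G = lift (p ^ Suc n) G oo (\<phi> oo ?i)" by (simp only: i fps_compose_fps_X)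
    also have "\<dots> = \<phi> oo f oo ?i"
      unfolding \<phi>(4) using \<phi> i by (intro fps_compose_assoc) auto
    also have "\<dots> = \<phi> oo (f oo ?i)" using f i by (intro fps_compose_assoc[symmetric]) auto
    finally have "(h oo ?i) oo lift (p ^ Suc n) G = (h oo ?i) oo (\<phi> oo (f oo ?i))" by simp
    also have "\<dots> = ((h oo ?i) oo \<phi>) oo (f oo ?i)"
      using \<phi> f i by (intro fps_compose_assoc) auto
    also have "(h oo ?i) oo \<phi> = h" using \<phi> i by (subst fps_compose_assoc[symmetric]) auto
    also have "h oo (f oo ?i) = (h oo f) oo ?i" using f i by (intro fps_compose_assoc) auto
    also have "\<dots> = fps_const l * (h oo ?i)"
      unfolding h(5) using i by (simp add: fps_compose_mult_distrib)
    finally show ?thesis .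
  qed
  ultimately show False using critical_no_linearization[OF p3 _ s(1) G] by blast
qed

end

section \<open>The first normal form of a cubic polynomial\<close>

lemma scaled_add_le:
  assumes "abs_val (x::'a::nonarchimedean_field) * c \<le> C" "abs_val y * c \<le> C" "0 \<le> c"
  shows "abs_val (x + y) * c \<le> C"
proof -
  have "abs_val (x + y) * c \<le> max (abs_val x) (abs_val y) * c"
    using assms by (intro mult_right_mono abs_val_add_le_max) auto
  then show ?thesis using assms by (auto simp: max_def split: if_splits)
qed

lemma scaled_diff_le:
  "abs_val (x::'a::nonarchimedean_field) * c \<le> C \<Longrightarrow> abs_val y * c \<le> C \<Longrightarrow> 0 \<le> c \<Longrightarrow>
    abs_val (x - y) * c \<le> C"
  using scaled_add_le[of x c C "- y"] by simp

lemma scaled_eq_of_diff: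
  assumes "abs_val (x - y::'a::nonarchimedean_field) * c \<le> C" "abs_val y * c = D" "C < D" "0 \<le> c"
  shows "abs_val x * c = D"
proof -
  have "abs_val (x - y) * c < abs_val y * c" using assms by simp
  then have "abs_val (x - y) < abs_val y" using assms(4) mult_right_less_imp_less by blast
  then show ?thesis using abs_val_eq_of_diff assms(2) by metis
qed

context near_one_multiplier
begin

text \<open>After multiplication by \<open>fps_X\<close>, both sides are compositions of series
  without constant term, whose coefficients expand in the powers of the inner series.\<close>

lemma conj_defect_1_nth:
  fixes A G H :: "'a fps"
  assumes "conj_defect 1 G A H = 0"
  shows "(\<Sum>k=0..m. fps_nth A k * fps_nth (G ^ Suc k) (m - k)) =
    (\<Sum>k=0..m. fps_nth H k * fps_nth (A ^ Suc k) (m - k))"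
proof -
  have expand: "fps_nth (B * (C oo (fps_X * B))) m = (\<Sum>k=0..m. fps_nth C k * fps_nth (B ^ Suc k)
      (m - k))"
    for B C :: "'a fps"
  proof -
    have "fps_X * (B * (C oo (fps_X * B))) = (fps_X * C) oo (fps_X * B)"
      by (simp add: fps_compose_mult_distrib fps_X_fps_compose_startby0 mult.assoc)
    then have "fps_nth (B * (C oo (fps_X * B))) m = fps_nth ((fps_X * C) oo (fps_X * B)) (Suc m)"
      by (metis fps_mult_fps_X_commute fps_mult_fps_X_plus_1_nth fps_X_mult_nth diff_Suc_1
          nat.distinct(1))
    also have "\<dots> = (\<Sum>k=0..m. fps_nth C k * fps_nth ((fps_X * B) ^ Suc k) (Suc m))"
      unfolding fps_compose_nth by (subst sum.atLeast0_atMost_Suc_shift) simp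
    also have "\<dots> = (\<Sum>k=0..m. fps_nth C k * fps_nth (B ^ Suc k) (m - k))"
      by (intro sum.cong refl) (simp only: power_mult_distrib fps_X_power_mult_nth; simp)
    finally show ?thesis .
  qed
  have "G * (A oo (fps_X * G)) = A * (H oo (fps_X * A))"
    using assms by (simp add: conj_defect_def)
  then show ?thesis using expand by metis
qed

text \<open>The bound \<open>eps\<^sup>2\<close> for a resonant coefficient has to beat the next small divisors, of size
  \<open>eps ^ p\<close>, so strongly that the coefficients of index at least 3 become negligible; this needs
  \<open>p > 4\<close>.\<close>

lemma no_linearization_of_resonance:
  assumes p5: "5 \<le> p" and r: "0 < r"
    and A: "fps_nth A 0 = 1" "gauss_le r 1 A"
    and H: "fps_nth H 0 = l" "gauss_le r eps (H - fps_const l)" "\<And>k. \<not> p dvd k \<Longrightarrow> fps_nth H k = 0"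
    and AH: "conj_defect 1 F A H = 0"
    and J: "J \<in> {1, 2}" "eps\<^sup>2 \<le> abs_val (fps_nth H (p * J)) * r ^ (p * J)"
    and h: "0 < R" "fps_nth h 0 = 0" "fps_nth h 1 = 1" "gauss_le R R h"
      "h oo (fps_X * F) = fps_const l * h"
  shows False
proof -
  define K where "K = Abs_fps (\<lambda>j. fps_nth H (p * j))"
  have HK: "H = K oo fps_X ^ p"
    using H(3) by (intro fps_ext) (auto simp: K_def fps_nth_compose_X_power)
  have K: "abs_val (fps_nth K k) * (r ^ p) ^ k \<le> eps" if "0 < k" for k
    using gauss_leD[OF H(2), of "p * k"] that p5 by (simp add: K_def power_mult split: if_splits)
  have KJ: "eps\<^sup>2 \<le> abs_val (fps_nth K J) * (r ^ p) ^ J"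
    using J by (simp add: K_def power_mult)
  have lt: "eps ^ p < eps\<^sup>2" using p5 by (intro eps_power_strict_mono) simp
  have "eps\<^sup>2 * eps ^ p = eps ^ (2 + p)" by (simp only: power_add)
  also have "\<dots> < eps ^ 6" using p5 by (intro eps_power_strict_mono) simp
  also have "\<dots> = (eps\<^sup>2) ^ 3" by (simp flip: power_mult)
  finally have lt6: "eps\<^sup>2 * eps ^ p < (eps\<^sup>2) ^ 3" .
  obtain s where s: "0 < s" "s < r ^ p"
    "\<And>k. 0 < k \<Longrightarrow> abs_val (fps_nth K k) * s ^ k \<le> eps ^ p"
    "\<exists>J\<in>{1, 2}. abs_val (fps_nth K J) * s ^ J = eps ^ p"
    "\<And>k. 3 \<le> k \<Longrightarrow> abs_val (fps_nth K k) * s ^ k < eps ^ p"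
  \<comment> \<open>Here \<open>B = eps\<close>, \<open>D = eps\<^sup>2\<close> and
    \<open>T = eps ^ p\<close>, so \<open>B^2 * T < D ^ 3\<close> reads
    \<open>eps ^ (2 + p) < eps ^ 6\<close>.\<close>
  proof (rule critical_radius[of "r ^ p" "\<lambda>k. abs_val (fps_nth K k)" eps J "eps\<^sup>2" "eps ^ p"])
    show "eps\<^sup>2 * eps ^ p < (eps\<^sup>2) ^ 3" by (rule lt6)
  qed (use that r K J(1) KJ lt eps_pos in auto)
  have "gauss_le s (eps ^ p) (K - fps_const l)"
    unfolding gauss_le_def
  proof
    fix k show "abs_val (fps_nth (K - fps_const l) k) * s ^ k \<le> eps ^ p"
      using s(3)[of k] H(1) eps_pos by (cases "k = 0") (simp_all add: K_def)
  qed
  then have K': "critical 1 s K"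
    using s H(1) by (auto simp: critical_def K_def)
  define u where "u = root p s"
  have u: "0 < u" "u ^ p = s"
    using s(1) unfolding u_def by (auto simp: real_root_gt_zero real_root_pow_pos2)
  have ur: "u \<le> r"
    using s(2) u r by (metis less_imp_le power_less_imp_less_base)
  have "gauss_le r r (lift 1 A)" using A r by (intro gauss_le_lift) auto
  then have "gauss_le u u (lift 1 A)"
    by (intro gauss_le_normalized_radius_mono[OF u(1) ur] lift_nth_0)
  moreover have "lift 1 A oo lift 1 F = lift p K oo lift 1 A"
    using AH unfolding HK by (subst (asm) conj_defect_eq_0_iff) (simp_all add: lift_compose_X_power)
  moreover have "h oo lift 1 F = fps_const l * h"
    using h(5) by (simp only: lift_1)
  ultimately show False
    using no_integral_linearization[of "lift 1 F" u "lift 1 A" K R h] p5 A(1) u K' h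
    by simp
qed

text \<open>The binomial theorem to second order: every further term contains \<open>V ^ 3\<close>
  and an integer coefficient.\<close>

lemma gauss_le_power_expansion:
  assumes "0 \<le> r" "gauss_le r eps V"
  shows "gauss_le r (eps ^ 3) ((fps_const l + V) ^ n - fps_const (l ^ n)
    - fps_const (of_nat n * l ^ (n - 1)) * V - fps_const (of_nat (n choose 2) * l ^ (n - 2)) * V\<^sup>2)"
proof (induction n)
  case (Suc n)
  define E where "E = (fps_const l + V) ^ n - fps_const (l ^ n)
    - fps_const (of_nat n * l ^ (n - 1)) * V - fps_const (of_nat (n choose 2) * l ^ (n - 2)) * V\<^sup>2"
  have E: "(fps_const l + V) ^ n = E + fps_const (l ^ n) + fps_const (of_nat n * l ^ (n - 1)) * V
    + fps_const (of_nat (n choose 2) * l ^ (n - 2)) * V\<^sup>2"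
    by (simp add: E_def)
  \<comment> \<open>Truncated subtraction in the exponents \<open>n - 1\<close> and
    \<open>n - 2\<close> does no harm: wherever it takes effect, the binomial factor is 0.\<close>
  have 1: "of_nat n * l ^ (n - 1) * l = of_nat n * l ^ n" by (cases n) auto
  have 2: "of_nat (n choose 2) * l ^ (n - 2) * l = of_nat (n choose 2) * l ^ (n - 1)"
  proof (cases "n < 2")
    case True
    then show ?thesis by (simp add: binomial_eq_0)
  next
    case False
    then have "n - 1 = Suc (n - 2)" by simp
    then show ?thesis by simp
  qed
  have 3: "of_nat (Suc n choose 2) = (of_nat n + of_nat (n choose 2) :: 'a)"
    by (simp add: numeral_2_eq_2)
  have "(fps_const l + V) ^ Suc n = E * (fps_const l + V) + fps_const (l ^ n * l)
    + (fps_const (of_nat n * l ^ (n - 1) * l) + fps_const (l ^ n)) * V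
    + (fps_const (of_nat (n choose 2) * l ^ (n - 2) * l) + fps_const (of_nat n * l ^ (n - 1))) * V\<^sup>2
    + fps_const (of_nat (n choose 2) * l ^ (n - 2)) * V ^ 3"
    unfolding power_Suc2 E by (simp add: algebra_simps power2_eq_square power3_eq_cube flip:
        fps_const_mult)
  also have "\<dots> = E * (fps_const l + V) + fps_const (l ^ Suc n)
    + fps_const (of_nat (Suc n) * l ^ (Suc n - 1)) * V
    + fps_const (of_nat (Suc n choose 2) * l ^ (Suc n - 2)) * V\<^sup>2
    + fps_const (of_nat (n choose 2) * l ^ (n - 2)) * V ^ 3"
    unfolding 1 2 3 by (simp add: algebra_simps)
  finally have eq: "(fps_const l + V) ^ Suc n - fps_const (l ^ Suc n)
    - fps_const (of_nat (Suc n) * l ^ (Suc n - 1)) * V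
    - fps_const (of_nat (Suc n choose 2) * l ^ (Suc n - 2)) * V\<^sup>2 =
    E * (fps_const l + V) + V ^ 3 * fps_const (of_nat (n choose 2) * l ^ (n - 2))"
    by (simp add: mult.commute)
  have "gauss_le r 1 (fps_const l + V)"
    using assms eps_less_1 by (intro gauss_le_add gauss_le_const gauss_le_mono[OF assms(2)]) auto
  then have "gauss_le r (eps ^ 3) (E * (fps_const l + V))"
    using assms(1) Suc[folded E_def] by (intro gauss_le_mult1)
  moreover have "gauss_le r 1 (fps_const (of_nat (n choose 2) * l ^ (n - 2)))"
    using assms(1) abs_val_of_nat_le by (intro gauss_le_const) (simp_all add: abs_val_mult)
  then have "gauss_le r (eps ^ 3) (V ^ 3 * fps_const (of_nat (n choose 2) * l ^ (n - 2)))"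
    using assms by (intro gauss_le_mult1 gauss_le_power)
  ultimately show ?case
    unfolding eq by (intro gauss_le_add assms(1))
qed (use eps_pos in \<open>simp add: binomial_eq_0\<close>)

text \<open>Isolates the single index \<open>m - j\<close> from which a step of size
  \<open>j\<close> reaches \<open>m\<close>.\<close>

lemma sum_mult_if_eq:
  fixes a g :: "nat \<Rightarrow> 'a"
  assumes "0 < j"
  shows "(\<Sum>k<m. a k * (if m - k = j then g k else 0)) = (if j
      \<le> m then a (m - j) * g (m - j) else 0)"
proof -
  have "(\<Sum>k<m. a k * (if m - k = j then g k else 0)) =
      (\<Sum>k<m. if k = m - j \<and> j \<le> m then a k * g k else 0)"
    by (intro sum.cong refl) auto
  also have "\<dots> = (if j \<le> m then a (m - j) * g (m - j) else 0)"
    using assms by (cases "j \<le> m") (auto simp: sum.delta)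
  finally show ?thesis .
qed

end

section \<open>Coefficient recursions for the first normal form\<close>

locale cubic_normal_form = near_one_multiplier p l for p and l :: "'a::nonarchimedean_field" +
  fixes \<alpha> \<beta> :: 'a and r :: real and A H :: "'a fps"
  assumes p5: "5 \<le> p" and r: "0 < r"
    and \<alpha>: "abs_val \<alpha> * r \<le> eps" and \<beta>: "abs_val \<beta> * r\<^sup>2 \<le> eps"
    and A0: "fps_nth A 0 = 1" and A: "gauss_le r 1 A"
    and A_p: "0 < k \<Longrightarrow> p dvd k \<Longrightarrow> fps_nth A k = 0"
    and H0: "fps_nth H 0 = l" and H: "\<not> p dvd k \<Longrightarrow> fps_nth H k = 0"
    and AH: "conj_defect 1 (fps_const l + (fps_const \<alpha> * fps_X + fps_const \<beta> * fps_X\<^sup>2)) A H = 0"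
begin

abbreviation V :: "'a fps" where
  "V \<equiv> fps_const \<alpha> * fps_X + fps_const \<beta> * fps_X\<^sup>2"

text \<open>The contribution of earlier coefficients of \<open>A\<close> at index \<open>m\<close>.
  Its \<open>k\<close>-th term is the step of size \<open>m - k\<close> from \<open>k\<close> to
  \<open>m\<close> in the comments below.\<close>

definition S :: "nat \<Rightarrow> 'a" where
  "S m = (\<Sum>k<m. fps_nth A k * fps_nth ((fps_const l + V) ^ Suc k) (m - k))"

lemma r0: "0 \<le> r" "0 \<le> r ^ k"
  using r by auto

lemma H_eq_0: "0 < k \<Longrightarrow> k < p \<Longrightarrow> fps_nth H k = 0"
  using H nat_dvd_not_less by blast

lemma A_le: "abs_val (fps_nth A k) * r ^ k \<le> 1"
  by (rule gauss_leD[OF A])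

lemma gauss_le_V: "gauss_le r eps V"
  using r0 \<alpha> \<beta> gauss_le_monomial[of r \<alpha> 1 eps] gauss_le_monomial[of r \<beta> 2 eps]
  by (intro gauss_le_add) auto

lemma recursion_lhs:
  "(\<Sum>k=0..m. fps_nth A k * fps_nth ((fps_const l + V) ^ Suc k) (m - k)) = S m
      + fps_nth A m * l ^ Suc m"
  unfolding S_def atLeast0AtMost lessThan_Suc_atMost[symmetric] sum.lessThan_Suc
  by (simp add: fps_power_zeroth del: power_Suc)

lemma recursion_small:
  assumes "m < p"
  shows "fps_nth A m * (l * (1 - l ^ m)) = S m"
proof -
  have "(\<Sum>k=0..m. fps_nth H k * fps_nth (A ^ Suc k) (m - k)) = (\<Sum>k=0..m. if k
      = 0 then l * fps_nth A m else 0)"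
    using assms H_eq_0 H0 by (intro sum.cong refl) auto
  then show ?thesis
    using conj_defect_1_nth[OF AH, of m] unfolding recursion_lhs by (simp add: algebra_simps)
qed

text \<open>By Frobenius \<open>A ^ p\<close> is 1 up to degree \<open>p - 1\<close>.\<close>

lemma A_power_nth:
  assumes "k < p" shows "fps_nth (A ^ Suc p) k = fps_nth A k"
proof -
  have "fps_nth (A ^ Suc p) k = (\<Sum>i=0..k. if i = 0 then fps_nth A k else 0)"
    unfolding power_Suc2 fps_mult_nth
    using assms frobenius_fps_nth[of A 1] A0 by (intro sum.cong refl) (auto dest: dvd_imp_le)
  then show ?thesis by simp
qed

lemma recursion_p: "fps_nth H p = S p"
proof -
  have "(\<Sum>k=0..p. fps_nth H k * fps_nth (A ^ Suc k) (p - k)) = (\<Sum>k=0..p. if k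
      = p then fps_nth H p else 0)"
  proof (intro sum.cong refl)
    fix k assume "k \<in> {0..p}"
    then consider "k = 0" | "k = p" | "0 < k" "k < p" by fastforce
    then show "fps_nth H k * fps_nth (A ^ Suc k) (p - k) = (if k = p then fps_nth H p else 0)"
      using H_eq_0[of k] A_p[of p] A0 p5 by cases (auto simp: fps_power_zeroth)
  qed
  then show ?thesis
    using conj_defect_1_nth[OF AH, of p] A_p[of p] unfolding recursion_lhs by simp
qed

text \<open>Only the exponents 0 and \<open>p\<close> of \<open>H\<close> contribute below
  \<open>2 * p\<close>, and \<open>A_power_nth\<close> evaluates the power of \<open>A\<close> that
  comes with the second.\<close>

lemma recursion_large:
  assumes "p < m" "m < 2 * p"
  shows "fps_nth A m * (l * (1 - l ^ m)) = S m - fps_nth H p * fps_nth A (m - p)"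
proof -
  have nd: "\<not> p dvd k" if "k \<le> m" "k \<noteq> 0" "k \<noteq> p" for k
  proof
    assume "p dvd k"
    then obtain j where j: "k = p * j" by blast
    with that have "j \<noteq> 0" "j \<noteq> 1" by auto
    moreover have "p * j < p * 2" using that(1) assms j by linarith
    ultimately show False by (simp only: mult_less_cancel1) linarith
  qed
  have "(\<Sum>k=0..m. fps_nth H k * fps_nth (A ^ Suc k) (m - k)) =
      (\<Sum>k=0..m. (if k = 0 then l * fps_nth A m else 0) + (if k
          = p then fps_nth H p * fps_nth A (m - p) else 0))"
  proof (intro sum.cong refl)
    fix k assume "k \<in> {0..m}"
    then consider "k = 0" | "k = p" | "fps_nth H k = 0" "k \<noteq> 0" "k \<noteq> p" using nd H by fastforce
    then show "fps_nth H k * fps_nth (A ^ Suc k) (m - k) =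
        (if k = 0 then l * fps_nth A m else 0) + (if k
            = p then fps_nth H p * fps_nth A (m - p) else 0)"
      using H0 A_power_nth[of "m - p"] assms p5 by cases auto
  qed
  then show ?thesis
    using conj_defect_1_nth[OF AH, of m] assms unfolding recursion_lhs
    by (simp add: sum.distrib algebra_simps)
qed

lemma recursion_2p: "fps_nth H (2 * p) = S (2 * p) - fps_nth H p * fps_nth A 1 ^ p"
proof -
  have nd: "\<not> p dvd k" if "k \<le> 2 * p" "k \<noteq> 0" "k \<noteq> p" "k \<noteq> 2 * p" for k
  proof
    assume "p dvd k"
    then obtain j where "k = p * j" by blast
    with that have "j \<noteq> 0" "j \<noteq> 1" "j \<noteq> 2" "j \<le> 2" by auto
    then show False by linarith
  qed
  \<comment> \<open>In \<open>A ^ p * A\<close> Frobenius leaves only degrees 0 and \<open>p\<close>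
    of the first factor, and degree 0 meets \<open>fps_nth A p = 0\<close>.\<close>
  have Ap: "fps_nth (A ^ Suc p) p = fps_nth A 1 ^ p"
  proof -
    have "fps_nth (A ^ Suc p) p = (\<Sum>i=0..p. if i = p then fps_nth A 1 ^ p else 0)"
      unfolding power_Suc2 fps_mult_nth
    proof (intro sum.cong refl)
      fix i assume "i \<in> {0..p}"
      then consider "i = 0" | "i = p" | "\<not> p dvd i" using nat_dvd_not_less[of i p] by fastforce
      then show "fps_nth (A ^ p) i * fps_nth A (p - i) = (if i = p then fps_nth A 1 ^ p else 0)"
        using frobenius_fps_nth[of A 1 i] A0 A_p[of p] p5 by cases auto
    qed
    then show ?thesis by simp
  qed
  have "(\<Sum>k=0..2 * p. fps_nth H k * fps_nth (A ^ Suc k) (2 * p - k)) =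
      (\<Sum>k=0..2 * p. (if k = p then fps_nth H p * fps_nth A 1 ^ p else 0) + (if k
          = 2 * p then fps_nth H (2 * p) else 0))"
  proof (intro sum.cong refl)
    fix k assume "k \<in> {0..2 * p}"
    then consider "k = 0" | "k = p" | "k = 2 * p" | "fps_nth H k = 0" "k \<noteq> 0" "k \<noteq> p" "k \<noteq> 2 * p"
      using nd H by fastforce
    then show "fps_nth H k * fps_nth (A ^ Suc k) (2 * p - k) =
        (if k = p then fps_nth H p * fps_nth A 1 ^ p else 0) + (if k
            = 2 * p then fps_nth H (2 * p) else 0)"
    proof cases
      case 1
      then show ?thesis using p5 A_p[of "2 * p"] by auto
    next
      case 2
      then show ?thesis using p5 Ap by (simp del: power_Suc)
    next
      case 3
      then show ?thesis using p5 A0 by (simp add: fps_power_zeroth del: power_Suc)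
    qed simp
  qed
  then show ?thesis
    using conj_defect_1_nth[OF AH, of "2 * p"] A_p[of "2 * p"] p5 unfolding recursion_lhs
    by (simp add: sum.distrib)
qed

end

context near_one_multiplier
begin

lemma of_nat_choose_2: "2 * of_nat (n choose 2) = (of_nat n * (of_nat n - 1) :: 'a)"
proof (cases n)
  case (Suc m)
  have "2 * (n choose 2) = n * (n - 1)"
    unfolding choose_two by (rule dvd_mult_div_cancel) (cases n; simp)
  then have "(of_nat (2 * (n choose 2)) :: 'a) = of_nat (n * (n - 1))" by (simp only:)
  then show ?thesis using Suc by (simp add: algebra_simps)
qed (simp add: binomial_eq_0)

text \<open>Serves to evaluate binomial coefficients at indices near \<open>p\<close>, where
  \<open>p = 0\<close> simplifies the product and 2 is invertible.\<close>

lemma of_nat_choose_2_eqI: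
  assumes "5 \<le> p" "of_nat n * (of_nat n - 1) = 2 * (c :: 'a)"
  shows "of_nat (n choose 2) = c"
proof -
  have "\<not> p dvd 2" using assms(1) by (auto dest: dvd_imp_le)
  then have "abs_val (of_nat 2 :: 'a) = 1" by (rule abs_val_nat_unit)
  then have "(2 :: 'a) \<noteq> 0" by auto
  then show ?thesis using assms(2) of_nat_choose_2[of n] by simp
qed

lemma abs_val_resonance_unit: "\<not> p dvd m \<Longrightarrow> abs_val (l * (1 - l ^ m)) = eps"
  by (simp add: abs_val_mult abs_val_one_minus_l_power_unit)

lemma abs_val_of_nat_mult_le: "abs_val (of_nat n * x :: 'a) \<le> abs_val x"
  using abs_val_of_nat_le[of n, where 'a='a] by (simp add: abs_val_mult mult_left_le_one_le)

end

section \<open>Sizes of the first and second resonant coefficients\<close>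

context cubic_normal_form
begin

lemma V_nth: "fps_nth V j = (if j = 1 then \<alpha> else if j = 2 then \<beta> else 0)"
  by (auto simp: fps_X_power_nth)

lemma V_squared: "V\<^sup>2 = fps_const (\<alpha>\<^sup>2) * fps_X ^ 2 + fps_const (2 * \<alpha> * \<beta>) * fps_X ^ 3
    + fps_const (\<beta>\<^sup>2) * fps_X ^ 4"
  by (simp add: power2_eq_square power3_eq_cube power4_eq_xxxx algebra_simps numeral_fps_const
      flip: fps_const_mult)

lemma power_nth_approx:
  assumes "0 < j"
  shows "abs_val (fps_nth ((fps_const l + V) ^ n) j -
    (of_nat n * l ^ (n - 1) * (if j = 1 then \<alpha> else if j = 2 then \<beta> else 0) +
     of_nat (n choose 2) * l ^ (n - 2) *
       (if j = 2 then \<alpha>\<^sup>2 else if j = 3 then 2 * \<alpha> * \<beta> else if j = 4 then \<beta>\<^sup>2 else 0))) * r ^ j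
           \<le> eps ^ 3"
proof -
  have "fps_nth (V\<^sup>2) j =
      (if j = 2 then \<alpha>\<^sup>2 else if j = 3 then 2 * \<alpha> * \<beta> else if j = 4 then \<beta>\<^sup>2 else 0)"
    unfolding V_squared by (auto simp: fps_X_power_nth)
  then show ?thesis
    using gauss_leD[OF gauss_le_power_expansion[OF r0(1) gauss_le_V], of n j] assms V_nth[of j]
    by (simp only: fps_sub_nth fps_mult_left_const_nth fps_nth_fps_const diff_diff_eq) simp
qed

text \<open>As \<open>A\<close> is integral, an error in the coefficients of the powers of
  \<open>l + V\<close> is not amplified in \<open>S\<close>.\<close>

lemma S_approx:
  assumes "\<And>k j. 0 < j \<Longrightarrow> abs_val (fps_nth ((fps_const l + V) ^ Suc k) j - t k j) * r ^ j \<le> C"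
  shows "abs_val (S m - (\<Sum>k<m. fps_nth A k * t k (m - k))) * r ^ m \<le> C"
proof -
  have C: "0 \<le> C" using assms[of 1 0] r0 by (meson abs_val_nonneg mult_nonneg_nonneg order_trans
      zero_less_one)
  have "S m - (\<Sum>k<m. fps_nth A k * t k (m - k)) =
      (\<Sum>k<m. fps_nth A k * (fps_nth ((fps_const l + V) ^ Suc k) (m - k) - t k (m - k)))"
    unfolding S_def sum_subtractf[symmetric] right_diff_distrib ..
  moreover have "abs_val (fps_nth A k * (fps_nth ((fps_const l
      + V) ^ Suc k) (m - k) - t k (m - k))) * r ^ m \<le> C"
    if "k \<in> {..<m}" for k
  proof -
    let ?d = "fps_nth ((fps_const l + V) ^ Suc k) (m - k) - t k (m - k)"
    have "r ^ m = r ^ k * r ^ (m - k)" using that by (simp flip: power_add)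
    then have "abs_val (fps_nth A k * ?d) * r ^ m = (abs_val (fps_nth A k) * r ^ k) * (abs_val ?d
        * r ^ (m - k))"
      by (simp only: abs_val_mult mult_ac)
    also have "\<dots> \<le> 1 * C"
      using assms[of "m - k" k] that A_le r0 by (intro mult_mono) auto
    finally show ?thesis by simp
  qed
  ultimately show ?thesis
    using C r0 by (simp only:) (rule abs_val_sum_mult_le)
qed

lemma term_eq:
  assumes "j \<le> m"
  shows "abs_val (fps_nth A (m - j) * g) * r ^ m = (abs_val (fps_nth A (m - j)) * r ^ (m - j)) *
      (abs_val g * r ^ j)"
proof -
  have "r ^ m = r ^ (m - j) * r ^ j" using assms by (simp flip: power_add)
  then show ?thesis by (simp add: abs_val_mult mult_ac)
qed

lemma term_le:
  assumes "j \<le> m" "abs_val (fps_nth A (m - j)) * r ^ (m - j) \<le> x" "abs_val g * r ^ j \<le> y"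
  shows "abs_val (fps_nth A (m - j) * g) * r ^ m \<le> x * y"
  unfolding term_eq[OF assms(1)]
  using assms r0 by (intro mult_mono order_trans[OF _ assms(2)]) auto

lemma abs_val_A_of_resonance:
  assumes "fps_nth A m * (l * (1 - l ^ m)) = x" "\<not> p dvd m"
  shows "abs_val (fps_nth A m) * r ^ m = abs_val x * r ^ m / eps"
proof -
  have "abs_val x = abs_val (fps_nth A m) * eps"
    using abs_val_resonance_unit[OF assms(2)] by (simp only: assms(1)[symmetric] abs_val_mult[of
        "fps_nth A m"])
  then show ?thesis using eps_pos by simp
qed

text \<open>The steps of size 1 dominate up to \<open>p - 1\<close>. The one leading to \<open>p\<close> carries the factor \<open>p =
  0\<close>, and the step of size 2 from \<open>p - 2\<close> contributes \<open>\<alpha>\<^sup>2 - l * \<beta>\<close>.\<close>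

lemma resonance_balanced:
  assumes \<delta>: "eps \<le> \<delta>" "\<delta> < 1" and \<alpha>': "abs_val \<alpha> * r = eps"
    and \<beta>': "abs_val \<beta> * r\<^sup>2 \<le> eps * \<delta>" and \<alpha>\<beta>: "abs_val (\<alpha>\<^sup>2 - l * \<beta>) * r\<^sup>2 = eps * \<delta>"
  shows "abs_val (fps_nth H p) * r ^ p = eps * \<delta>"
proof -
  \<comment> \<open>The coefficients of \<open>(l + V) ^ Suc k\<close> in degrees 1 and 2. Those of
    higher degree are at most \<open>eps\<^sup>2 * \<delta>\<close>, because \<open>eps\<close> is
    at most \<delta>.\<close>
  define g1 where "g1 k = of_nat (Suc k) * l ^ k * \<alpha>" for k
  define g2 where "g2 k = of_nat (Suc k) * l ^ k * \<beta>
      + of_nat (Suc k choose 2) * l ^ (k - 1) * \<alpha>\<^sup>2" for k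
  define t where "t k j = (if j = 1 then g1 k else 0) + (if j = 2 then g2 k else 0)" for k j :: nat
  let ?a = "fps_nth A"
  have \<delta>0: "0 < \<delta>" using \<delta> eps_pos by simp
  have e3: "eps ^ 3 \<le> eps\<^sup>2 * \<delta>" using \<delta> eps_pos by (simp add: power3_eq_cube power2_eq_square)
  have \<alpha>2: "abs_val (\<alpha>\<^sup>2) * r\<^sup>2 = eps\<^sup>2"
    by (simp add: abs_val_power \<alpha>'[symmetric] power_mult_distrib)
  have g2: "abs_val (g2 k) * r\<^sup>2 \<le> eps * \<delta>" for k
    unfolding g2_def
  proof (intro scaled_add_le r0)
    have "abs_val (of_nat (Suc k) * (l ^ k * \<beta>)) * r\<^sup>2 \<le> abs_val (l ^ k * \<beta>) * r\<^sup>2"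
      using r0 by (intro mult_right_mono abs_val_of_nat_mult_le)
    then show "abs_val (of_nat (Suc k) * l ^ k * \<beta>) * r\<^sup>2 \<le> eps * \<delta>"
      using \<beta>' by (simp add: abs_val_mult mult_ac)
    have "abs_val (of_nat (Suc k choose 2) * (l ^ (k - 1) * \<alpha>\<^sup>2)) * r\<^sup>2
        \<le> abs_val (l ^ (k - 1) * \<alpha>\<^sup>2) * r\<^sup>2"
      using r0 by (intro mult_right_mono abs_val_of_nat_mult_le)
    also have "\<dots> = eps\<^sup>2" using \<alpha>2 by (simp add: abs_val_mult)
    also have "\<dots> \<le> eps * \<delta>" using \<delta> eps_pos by (simp add: power2_eq_square)
    finally show "abs_val (of_nat (Suc k choose 2) * l ^ (k - 1) * \<alpha>\<^sup>2) * r\<^sup>2 \<le> eps * \<delta>"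
      by (simp add: mult.assoc)
  qed
  have t: "abs_val (fps_nth ((fps_const l + V) ^ Suc k) j - t k j) * r ^ j \<le> eps\<^sup>2 * \<delta>" if "0 < j"
      for k j
  proof -
    define R where "R = of_nat (Suc k choose 2) * l ^ (k - 1) * (if j = 3 then 2 * \<alpha> * \<beta> else if j
        = 4 then \<beta>\<^sup>2 else 0)"
    have R: "abs_val R * r ^ j \<le> eps\<^sup>2 * \<delta>"
    proof -
      have "abs_val (if j = 3 then 2 * \<alpha> * \<beta> else if j = 4 then \<beta>\<^sup>2 else 0) * r ^ j \<le> eps\<^sup>2 * \<delta>"
      proof -
        have "abs_val (2 * \<alpha> * \<beta>) * r ^ 3 = abs_val (2 :: 'a) * ((abs_val \<alpha> * r) * (abs_val \<beta> *
            r\<^sup>2))"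
          by (simp add: abs_val_mult power3_eq_cube power2_eq_square)
        also have "\<dots> \<le> 1 * (eps * (eps * \<delta>))"
          unfolding \<alpha>' using \<beta>' abs_val_of_nat_le[of 2, where 'a='a] eps_pos r0
          by (intro mult_mono[of _ 1] mult_left_mono) auto
        finally have 3: "abs_val (2 * \<alpha> * \<beta>) * r ^ 3 \<le> eps\<^sup>2 * \<delta>" by (simp add: power2_eq_square)
        have "abs_val (\<beta>\<^sup>2) * r ^ 4 = (abs_val \<beta> * r\<^sup>2)\<^sup>2"
          by (simp add: abs_val_power power_mult_distrib flip: power_mult)
        also have "\<dots> \<le> (eps * \<delta>)\<^sup>2" using \<beta>' r0 by (intro power_mono) auto
        also have "\<dots> = (eps\<^sup>2 * \<delta>) * \<delta>" by (simp add: power2_eq_square)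
        also have "\<dots> \<le> eps\<^sup>2 * \<delta>" using \<delta> \<delta>0 eps_pos by (intro mult_right_le_one_le) auto
        finally show ?thesis using 3 eps_pos \<delta>0 by auto
      qed
      moreover have "abs_val R * r ^ j \<le> abs_val (if j = 3 then 2 * \<alpha> * \<beta> else if j
          = 4 then \<beta>\<^sup>2 else 0) * r ^ j"
        using abs_val_of_nat_le[of "Suc k choose 2", where 'a='a] r0 unfolding R_def abs_val_mult
        by (intro mult_right_mono mult_left_le_one_le) auto
      ultimately show ?thesis by linarith
    qed
    have "fps_nth ((fps_const l + V) ^ Suc k) j - t k j =
        (fps_nth ((fps_const l + V) ^ Suc k) j -
    (of_nat (Suc k) * l ^ (Suc k - 1) * (if j = 1 then \<alpha> else if j = 2 then \<beta> else 0) +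
     of_nat (Suc k choose 2) * l ^ (Suc k - 2) *
       (if j = 2 then \<alpha>\<^sup>2 else if j = 3 then 2 * \<alpha> * \<beta> else if j = 4 then \<beta>\<^sup>2 else 0))) + R"
      by (simp add: t_def g1_def g2_def R_def numeral_2_eq_2 del: of_nat_Suc power_Suc
          binomial_Suc_Suc)
    then show ?thesis
      using power_nth_approx[OF that, of "Suc k"] R e3 r0 by (simp only:)
          (intro scaled_add_le; simp)
  qed
  have S: "abs_val (S m - ((if 1 \<le> m then ?a (m - 1) * g1 (m - 1) else 0) +
      (if 2 \<le> m then ?a (m - 2) * g2 (m - 2) else 0))) * r ^ m \<le> eps\<^sup>2 * \<delta>" for m
    using S_approx[OF t, of m] unfolding t_def distrib_left sum.distrib
    by (simp only: sum_mult_if_eq zero_less_one zero_less_numeral)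
  have e2: "eps\<^sup>2 * \<delta> < eps * \<delta>" "eps * \<delta> < eps"
    using eps_pos eps_less_1 \<delta> \<delta>0 by (simp_all add: power2_eq_square)
  have a1: "abs_val (?a m) * r ^ m = 1" if "m < p" for m
    using that
  proof (induction m)
    case (Suc m)
    have nd: "\<not> p dvd Suc m" using Suc.prems by (auto dest: dvd_imp_le)
    have "abs_val (S (Suc m)) * r ^ Suc m = eps"
    proof (rule scaled_eq_of_diff)
      have main: "abs_val (g1 m) * r = eps"
        using \<alpha>' abs_val_nat_unit[OF nd] by (simp add: g1_def abs_val_mult del: of_nat_Suc)
      show "abs_val (?a m * g1 m) * r ^ Suc m = eps"
        using term_eq[of 1 "Suc m" "g1 m"] Suc main by simp
      have "abs_val (if 2 \<le> Suc m then ?a (Suc m - 2) * g2 (Suc m - 2) else 0) * r ^ Suc m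
          \<le> 1 * (eps * \<delta>)"
        using term_le[of 2 "Suc m", OF _ A_le g2] eps_pos \<delta>0 by (auto simp del: power_Suc)
      then have "abs_val ((S (Suc m) - ((if 1 \<le> Suc m then ?a (Suc m - 1) * g1 (Suc m - 1) else 0) +
          (if 2 \<le> Suc m then ?a (Suc m - 2) * g2 (Suc m - 2) else 0))) +
          (if 2 \<le> Suc m then ?a (Suc m - 2) * g2 (Suc m - 2) else 0)) * r ^ Suc m \<le> eps * \<delta>"
        using S[of "Suc m"] e2 r0 by (intro scaled_add_le) linarith+
      then show "abs_val (S (Suc m) - ?a m * g1 m) * r ^ Suc m \<le> eps * \<delta>"
        by (simp del: power_Suc)
    qed (use e2 r0 in auto)
    then show ?case
      using abs_val_A_of_resonance[OF recursion_small[OF Suc.prems] nd] eps_pos by simp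
  qed (simp add: A0)
  have "abs_val (S p) * r ^ p = eps * \<delta>"
  proof (rule scaled_eq_of_diff)
    have Suc: "Suc (p - 1) = p" "Suc (p - 2) = p - 1" "p - 2 - 1 = p - 3" using p5 by auto
    have "p - 2 = Suc (p - 3)" using p5 by simp
    then have l: "l ^ (p - 2) = l ^ (p - 3) * l" by simp
    \<comment> \<open>Modulo \<open>p\<close> the product \<open>(p - 1) * (p - 2)\<close> is 2.
      Together with the factor \<open>p - 1 = -1\<close> in front of \<beta> this produces
      \<open>\<alpha>\<^sup>2 - l * \<beta>\<close>.\<close>
    have "of_nat (p - 1 choose 2) = (1 :: 'a)"
      using p5 by (intro of_nat_choose_2_eqI) (simp_all add: of_nat_diff of_nat_p)
    then have "g2 (p - 2) = l ^ (p - 3) * (\<alpha>\<^sup>2 - l * \<beta>)"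
      using p5 unfolding g2_def Suc l by (simp add: of_nat_diff of_nat_p algebra_simps)
    then have "abs_val (g2 (p - 2)) * r\<^sup>2 = eps * \<delta>" using \<alpha>\<beta> by (simp add: abs_val_mult)
    then show "abs_val (?a (p - 2) * g2 (p - 2)) * r ^ p = eps * \<delta>"
      using term_eq[of 2 p] a1[of "p - 2"] p5 by simp
    have "g1 (p - 1) = 0" unfolding g1_def Suc by (simp add: of_nat_p)
    then show "abs_val (S p - ?a (p - 2) * g2 (p - 2)) * r ^ p \<le> eps\<^sup>2 * \<delta>"
      using S[of p] p5 by simp
  qed (use e2 r0 in auto)
  then show ?thesis by (simp add: recursion_p)
qed

text \<open>Here the map is close to the odd map \<open>l z + \<beta> z ^ 3\<close>. In the recursion with step 2 the
  coefficient at the transition across \<open>p\<close> is a multiple of \<open>p\<close>; the step of size 4 takes over,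
  at the cost of one factor \<open>eps\<close>.\<close>

lemma resonance_nearly_odd:
  assumes \<alpha>': "abs_val \<alpha> * r \<le> eps\<^sup>2" and \<beta>': "abs_val \<beta> * r\<^sup>2 = eps"
  shows "abs_val (fps_nth H (2 * p)) * r ^ (2 * p) = eps\<^sup>2"
proof -
  \<comment> \<open>Steps of size 1, 2 and 4 come from \<alpha>, \<beta> and
    \<open>\<beta>\<^sup>2\<close>. The terms with \<open>\<alpha>\<^sup>2\<close> and
    \<open>\<alpha> * \<beta>\<close> are at most \<open>eps ^ 3\<close> and are left to the
    error.\<close>
  define g1 where "g1 k = of_nat (Suc k) * l ^ k * \<alpha>" for k
  define g2 where "g2 k = of_nat (Suc k) * l ^ k * \<beta>" for k
  define g4 where "g4 k = of_nat (Suc k choose 2) * l ^ (k - 1) * \<beta>\<^sup>2" for k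
  define t where "t k j = (if j = 1 then g1 k else 0) + (if j = 2 then g2 k else 0) + (if j
      = 4 then g4 k else 0)"
    for k j :: nat
  define T1 where "T1 m = (if 1 \<le> m then fps_nth A (m - 1) * g1 (m - 1) else 0)" for m
  define T2 where "T2 m = (if 2 \<le> m then fps_nth A (m - 2) * g2 (m - 2) else 0)" for m
  define T4 where "T4 m = (if 4 \<le> m then fps_nth A (m - 4) * g4 (m - 4) else 0)" for m
  define N where "N m = abs_val (fps_nth A m) * r ^ m" for m
  have e: "0 < eps" "eps < 1" "eps\<^sup>2 < eps" "eps ^ 3 < eps\<^sup>2"
    using eps_pos eps_less_1 eps_power_strict_mono[of 1 2] eps_power_strict_mono[of 2 3] by simp_all
  have ee: "eps * eps = eps\<^sup>2" "eps * eps\<^sup>2 = eps ^ 3" "eps\<^sup>2 * eps = eps ^ 3"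
    by (simp_all add: power2_eq_square power3_eq_cube)
  have \<beta>2: "abs_val (\<beta>\<^sup>2) * r ^ 4 = eps\<^sup>2"
  proof -
    have "abs_val (\<beta>\<^sup>2) * r ^ 4 = (abs_val \<beta> * r\<^sup>2)\<^sup>2"
      by (simp add: abs_val_power power_mult_distrib flip: power_mult)
    then show ?thesis by (simp add: \<beta>')
  qed
  have scale: "abs_val (of_nat n * l ^ k * x) * c \<le> abs_val x * c" if "0 \<le> c" for n k c and x :: 'a
    using that abs_val_of_nat_mult_le[of n x] by (simp add: abs_val_mult mult_right_mono)
  have g1: "abs_val (g1 k) * r ^ 1 \<le> eps\<^sup>2" for k
    using scale[OF r0(1), of "Suc k" k \<alpha>] \<alpha>' unfolding g1_def by (simp del: of_nat_Suc)
  have g2: "abs_val (g2 k) * r\<^sup>2 \<le> eps" for k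
    using scale[OF r0(2)[of 2], of "Suc k" k \<beta>] \<beta>' unfolding g2_def by linarith
  have g4: "abs_val (g4 k) * r ^ 4 \<le> eps\<^sup>2" for k
    using scale[OF r0(2)[of 4], of "Suc k choose 2" "k - 1" "\<beta>\<^sup>2"] \<beta>2 unfolding g4_def by linarith
  have t: "abs_val (fps_nth ((fps_const l + V) ^ Suc k) j - t k j) * r ^ j \<le> eps ^ 3" if "0 < j"
      for k j
  proof -
    define R where "R = of_nat (Suc k choose 2) * l ^ (k - 1) * (if j = 2 then \<alpha>\<^sup>2 else if j
        = 3 then 2 * \<alpha> * \<beta> else 0)"
    have "abs_val (if j = 2 then \<alpha>\<^sup>2 else if j = 3 then 2 * \<alpha> * \<beta> else 0) * r ^ j \<le> eps ^ 3"
    proof -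
      have "abs_val (2 * \<alpha> * \<beta>) * r ^ 3 = abs_val (2 :: 'a) * ((abs_val \<alpha> * r) * (abs_val \<beta> * r\<^sup>2))"
        by (simp add: abs_val_mult power3_eq_cube power2_eq_square)
      also have "\<dots> \<le> 1 * (eps\<^sup>2 * eps)"
        unfolding \<beta>' using \<alpha>' abs_val_of_nat_le[of 2, where 'a='a] eps_pos r0
        by (intro mult_mono[of _ 1] mult_right_mono) auto
      finally have 3: "abs_val (2 * \<alpha> * \<beta>) * r ^ 3 \<le> eps ^ 3" using e ee by simp
      have "abs_val (\<alpha>\<^sup>2) * r\<^sup>2 = (abs_val \<alpha> * r)\<^sup>2"
        by (simp add: abs_val_power power_mult_distrib)
      also have "\<dots> \<le> (eps\<^sup>2)\<^sup>2" using \<alpha>' r0 by (intro power_mono) auto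
      also have "\<dots> \<le> eps ^ 3" using eps_power_mono[of 3 4] by (simp flip: power_mult)
      finally show ?thesis using 3 eps_pos by auto
    qed
    then have R: "abs_val R * r ^ j \<le> eps ^ 3"
      using scale[OF r0(2)] unfolding R_def by (rule order_trans[rotated])
    have "fps_nth ((fps_const l + V) ^ Suc k) j - t k j =
        (fps_nth ((fps_const l + V) ^ Suc k) j -
    (of_nat (Suc k) * l ^ (Suc k - 1) * (if j = 1 then \<alpha> else if j = 2 then \<beta> else 0) +
     of_nat (Suc k choose 2) * l ^ (Suc k - 2) *
       (if j = 2 then \<alpha>\<^sup>2 else if j = 3 then 2 * \<alpha> * \<beta> else if j = 4 then \<beta>\<^sup>2 else 0))) + R"
      by (simp add: t_def g1_def g2_def g4_def R_def numeral_2_eq_2 del: of_nat_Suc power_Suc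
          binomial_Suc_Suc)
    then show ?thesis
      using power_nth_approx[OF that, of "Suc k"] R r0 by (simp only:) (intro scaled_add_le; simp)
  qed
  have S: "abs_val (S m - (T1 m + T2 m + T4 m)) * r ^ m \<le> eps ^ 3" for m
    using S_approx[OF t, of m] unfolding t_def distrib_left sum.distrib T1_def T2_def T4_def
    by (simp only: sum_mult_if_eq zero_less_one zero_less_numeral)
  have N1: "N m \<le> 1" for m unfolding N_def by (rule A_le)
  have Np: "N p = 0" using A_p[of p] by (simp add: N_def)
  have T1: "abs_val (T1 m) * r ^ m \<le> x * eps\<^sup>2" if "0 \<le> x" "1 \<le> m \<Longrightarrow> N (m - 1) \<le> x" for m x
    using that term_le[OF _ _ g1, of m x "m - 1"] unfolding T1_def N_def by auto
  have T2: "abs_val (T2 m) * r ^ m \<le> x * eps" if "0 \<le> x" "2 \<le> m \<Longrightarrow> N (m - 2) \<le> x" for m x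
    using that eps_pos term_le[OF _ _ g2, of m x "m - 2"] unfolding T2_def N_def by auto
  have T4: "abs_val (T4 m) * r ^ m \<le> x * eps\<^sup>2" if "0 \<le> x" "4 \<le> m \<Longrightarrow> N (m - 4) \<le> x" for m x
    using that term_le[OF _ _ g4, of m x "m - 4"] unfolding T4_def N_def by auto
  have T2_eq: "abs_val (T2 m) * r ^ m = N (m - 2) * eps" if "2 \<le> m" "\<not> p dvd (m - 1)" for m
  proof -
    have "Suc (m - 2) = m - 1" using that(1) by simp
    then have "abs_val (g2 (m - 2)) * r\<^sup>2 = eps"
      using abs_val_nat_unit[OF that(2)] \<beta>' by (simp add: g2_def abs_val_mult del: of_nat_Suc)
    then show ?thesis using term_eq[OF that(1)] that(1) by (simp add: T2_def N_def)
  qed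
  have odd_p: "odd p" using prime_p p5 prime_odd_nat by auto
  \<comment> \<open>Parity changes only through steps of size 1, which cost
    \<open>eps\<^sup>2\<close>; a step of size 2 costs \<open>eps\<close> but starts from an odd
    index that already carries \<open>eps\<close>. After division by the small divisor the bound
    \<open>eps\<close> for odd indices reproduces itself.\<close>
  have S_odd: "abs_val (S m) * r ^ m \<le> eps\<^sup>2" if "odd m" "\<And>k. k < m \<Longrightarrow> odd k \<Longrightarrow> N k \<le> eps" for m
  proof -
    have "abs_val (T1 m) * r ^ m \<le> eps\<^sup>2" using T1[of 1 m] N1 by simp
    moreover have "abs_val (T2 m) * r ^ m \<le> eps\<^sup>2"
      using T2[of eps m] that e ee by (simp add: less_imp_le)
    moreover have "abs_val (T4 m) * r ^ m \<le> eps\<^sup>2" using T4[of 1 m] N1 by simp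
    moreover have "abs_val (S m - (T1 m + T2 m + T4 m)) * r ^ m \<le> eps\<^sup>2" using S[of m] e by linarith
    ultimately have "abs_val ((S m - (T1 m + T2 m + T4 m)) + (T1 m + T2 m + T4 m)) * r ^ m \<le> eps\<^sup>2"
      by (intro scaled_add_le r0)
    then show ?thesis by simp
  qed
  have Hp: "abs_val (fps_nth H p) * r ^ p \<le> eps\<^sup>2" if "\<And>k. k < p \<Longrightarrow> odd k \<Longrightarrow> N k \<le> eps"
    unfolding recursion_p using odd_p that by (rule S_odd)
  have Hp_term: "abs_val (fps_nth H p * fps_nth A (m - p)) * r ^ m \<le> eps\<^sup>2 * x"
    if "p \<le> m" "\<And>k. k < p \<Longrightarrow> odd k \<Longrightarrow> N k \<le> eps" "N (m - p) \<le> x" for m x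
  proof -
    have "r ^ m = r ^ p * r ^ (m - p)" using that by (simp flip: power_add)
    then have "abs_val (fps_nth H p * fps_nth A (m - p)) * r ^ m
        = (abs_val (fps_nth H p) * r ^ p) * N (m - p)"
      by (simp add: N_def abs_val_mult mult_ac)
    also have "\<dots> \<le> eps\<^sup>2 * x" using that Hp r0 by (intro mult_mono) (auto simp: N_def)
    finally show ?thesis .
  qed
  have nd: "\<not> p dvd m" if "m \<noteq> 0" "m \<noteq> p" "m < 2 * p" for m
  proof
    assume "p dvd m"
    then obtain j where j: "m = p * j" by blast
    with that have "j \<noteq> 0" "j \<noteq> 1" by auto
    moreover have "p * j < p * 2" using that j by linarith
    ultimately show False by (simp only: mult_less_cancel1) linarith
  qed
  \<comment> \<open>Steps of size 2 preserve the size at even indices, except for the one to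
    \<open>p + 1\<close>, whose factor is \<open>p = 0\<close>. One factor \<open>eps\<close> is
    lost there and kept afterwards.\<close>
  have claim: "(odd m \<longrightarrow> N m \<le> eps) \<and> (even m \<and> m < p \<longrightarrow> N m = 1) \<and> (even m \<and> p < m \<longrightarrow> N m = eps)"
    if "m < 2 * p" for m
    using that
  proof (induction m rule: less_induct)
    case (less m)
    then have odd_IH: "N k \<le> eps" if "k < m" "odd k" for k
      using that by auto
    have IH_small: "N k = 1" if "k < m" "even k" "k < p" for k
      using that less by auto
    have IH_large: "N k = eps" if "k < m" "even k" "p < k" for k
      using that less by auto
    consider "m = 0" | "m = p" | "m \<noteq> 0" "m < p" "odd m" | "m < 2 * p" "p < m" "odd m"
      | "m \<noteq> 0" "m < p" "even m" | "p < m" "m < 2 * p" "even m"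
      using less.prems by (cases "even m") linarith+
    then show ?case
    proof cases
      case 1
      then show ?thesis using odd_p by (simp add: N_def A0)
    next
      case 2
      then show ?thesis using odd_p Np eps_pos by simp
    next
      case 3
      have "N m = abs_val (S m) * r ^ m / eps"
        unfolding N_def using 3 nd less.prems by (intro abs_val_A_of_resonance recursion_small) auto
      also have "\<dots> \<le> eps\<^sup>2 / eps"
        using S_odd 3 odd_IH eps_pos by (intro divide_right_mono) auto
      finally have "N m \<le> eps" using eps_pos by (simp add: power2_eq_square)
      then show ?thesis using 3 by simp
    next
      case 4
      have N: "N m = abs_val (S m - fps_nth H p * fps_nth A (m - p)) * r ^ m / eps"
        unfolding N_def using 4 nd by (intro abs_val_A_of_resonance recursion_large) auto
      have "abs_val (S m - fps_nth H p * fps_nth A (m - p)) * r ^ m \<le> eps\<^sup>2"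
        using S_odd[of m] 4 odd_IH Hp_term[of m 1] N1 r0 by (intro scaled_diff_le) auto
      then have "N m \<le> eps\<^sup>2 / eps"
        unfolding N using eps_pos by (intro divide_right_mono) auto
      then have "N m \<le> eps" using eps_pos by (simp add: power2_eq_square)
      then show ?thesis using 4 by simp
    next
      case 5
      then have m2: "2 \<le> m" by (cases m) (auto, presburger)
      have "abs_val (S m) * r ^ m = eps"
      proof (rule scaled_eq_of_diff)
        show "abs_val (T2 m) * r ^ m = eps"
          using T2_eq[of m] m2 5 nd[of "m - 1"] IH_small[of "m - 2"] by simp
        have "abs_val (S m - (T1 m + T2 m + T4 m)) * r ^ m \<le> eps\<^sup>2" using S[of m] e by linarith
        then have "abs_val ((S m - (T1 m + T2 m + T4 m)) + (T1 m + T4 m)) * r ^ m \<le> eps\<^sup>2"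
          using T1[of 1 m] T4[of 1 m] N1 by (intro scaled_add_le r0) auto
        then show "abs_val (S m - T2 m) * r ^ m \<le> eps\<^sup>2" by (simp add: algebra_simps)
      qed (use e r0 in auto)
      then have "N m = eps / eps"
        unfolding N_def using abs_val_A_of_resonance[OF recursion_small] 5 nd[of m] by simp
      then show ?thesis using 5 eps_pos by simp
    next
      case 6
      then have odd_m1: "odd (m - 1)" "m - 1 < m" by auto
      have "m \<noteq> p + 2" using 6 odd_p by auto
      with 6 have m: "m = p + 1 \<or> p + 3 \<le> m" by auto
      define X where "X = S m - fps_nth H p * fps_nth A (m - p)"
      have HpA: "abs_val (fps_nth H p * fps_nth A (m - p)) * r ^ m \<le> eps ^ 3"
        using Hp_term[of m eps] 6 odd_IH odd_p e ee by (simp add: less_imp_le)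
      have t1: "abs_val (T1 m) * r ^ m \<le> eps ^ 3"
        using T1[of eps m] odd_IH[OF odd_m1(2,1)] e ee by (simp add: less_imp_le)
      have "abs_val X * r ^ m = eps\<^sup>2"
        using m
      proof
        assume m: "m = p + 1"
        have T20: "T2 m = 0"
        proof -
          have "Suc (m - 2) = p" using m p5 by simp
          then show ?thesis by (simp add: T2_def g2_def of_nat_p del: of_nat_Suc)
        qed
        show ?thesis
        proof (rule scaled_eq_of_diff)
          have eq: "Suc (m - 4) = p - 2" using m p5 by simp
          \<comment> \<open>Modulo \<open>p\<close> the product \<open>(p - 2) * (p - 3)\<close> is
            6, so the step of size 4 from \<open>p - 3\<close> carries the factor 3, a unit as
            \<open>p\<close> is at least 5.\<close>
          have "of_nat (p - 2 choose 2) = (of_nat 3 :: 'a)"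
            using p5 by (intro of_nat_choose_2_eqI) (simp_all add: of_nat_diff of_nat_p)
          moreover have "\<not> p dvd 3" using p5 by (auto dest: dvd_imp_le)
          ultimately have "abs_val (g4 (m - 4)) * r ^ 4 = eps\<^sup>2"
            using abs_val_nat_unit[of 3] \<beta>2 unfolding g4_def eq abs_val_mult by simp
          moreover have "N (m - 4) = 1" using IH_small[of "m - 4"] m p5 6 by simp
          ultimately show "abs_val (T4 m) * r ^ m = eps\<^sup>2"
            using term_eq[of 4 m "g4 (m - 4)"] m p5 by (simp add: T4_def N_def)
          have "abs_val ((S m - (T1 m + T2 m + T4 m))
              + T1 m - fps_nth H p * fps_nth A (m - p)) * r ^ m \<le> eps ^ 3"
            by (rule scaled_diff_le[OF scaled_add_le[OF S t1 r0(2)] HpA r0(2)])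
          then show "abs_val (X - T4 m) * r ^ m \<le> eps ^ 3"
            by (simp add: X_def T20 algebra_simps)
        qed (use e r0 in auto)
      next
        assume m: "p + 3 \<le> m"
        have t4: "abs_val (T4 m) * r ^ m \<le> eps ^ 3"
        \<comment> \<open>Only for \<open>m = p + 3\<close> does the step of size 4 start below
          \<open>p\<close>, at \<open>p - 1\<close>, where the size is still 1; there its binomial
          factor vanishes modulo \<open>p\<close>.\<close>
        proof (cases "m = p + 3")
          case True
          then have eq: "Suc (m - 4) = p" using p5 by simp
          have "of_nat (p choose 2) = (0 :: 'a)"
            using p5 by (intro of_nat_choose_2_eqI) (simp_all add: of_nat_p)
          then have "T4 m = 0" unfolding T4_def g4_def eq by simp
          then show ?thesis using e ee by simp
        next
          case False
          then have "N (m - 4) = eps" using IH_large[of "m - 4"] m 6 odd_p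
            by (cases "m = p + 4") auto
          then show ?thesis using T4[of eps m] e ee by simp
        qed
        show ?thesis
        proof (rule scaled_eq_of_diff)
          show "abs_val (T2 m) * r ^ m = eps\<^sup>2"
            using T2_eq[of m] nd[of "m - 1"] IH_large[of "m - 2"] 6 m e ee by simp
          have "abs_val ((S m - (T1 m + T2 m + T4 m)) + (T1 m
              + T4 m) - fps_nth H p * fps_nth A (m - p)) * r ^ m \<le> eps ^ 3"
            by (rule scaled_diff_le[OF scaled_add_le[OF S scaled_add_le[OF t1 t4 r0(2)] r0(2)] HpA
                r0(2)])
          then show "abs_val (X - T2 m) * r ^ m \<le> eps ^ 3"
            by (simp add: X_def algebra_simps)
        qed (use e r0 in auto)
      qed
      then have "N m = eps\<^sup>2 / eps"
        unfolding N_def using abs_val_A_of_resonance[OF recursion_large] 6 nd[of m]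
            by (simp add: X_def)
      then show ?thesis using 6 eps_pos by (simp add: power2_eq_square)
    qed
  qed
  let ?m = "2 * p"
  \<comment> \<open>The step of size 2 from \<open>2 * p - 2\<close> has the unit factor
    \<open>2 * p - 1\<close> and gives \<open>eps * eps\<close>. The step of size 4 is negligible
    because \<open>2 * p - 4\<close> already lies beyond \<open>p\<close>.\<close>
  have "abs_val (S ?m - fps_nth H p * fps_nth A 1 ^ p) * r ^ ?m = eps\<^sup>2"
  proof (rule scaled_eq_of_diff)
    show "abs_val (T2 ?m) * r ^ ?m = eps\<^sup>2"
      using T2_eq[of ?m] nd[of "?m - 1"] claim[of "?m - 2"] p5 e ee by auto
    have t1: "abs_val (T1 ?m) * r ^ ?m \<le> eps ^ 3"
      using T1[of eps ?m] claim[of "?m - 1"] p5 e ee by auto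
    have t4: "abs_val (T4 ?m) * r ^ ?m \<le> eps ^ 3"
      using T4[of eps ?m] claim[of "?m - 4"] p5 e ee by auto
    have t5: "abs_val (fps_nth H p * fps_nth A 1 ^ p) * r ^ ?m \<le> eps ^ 3"
    proof -
      have N1': "N 1 \<le> eps" using claim[of 1] p5 by simp
      have "abs_val (fps_nth H p * fps_nth A 1 ^ p) * r ^ ?m
          = (abs_val (fps_nth H p) * r ^ p) * N 1 ^ p"
        by (simp add: N_def abs_val_mult abs_val_power power_mult_distrib mult_2 power_add)
      also have "\<dots> \<le> eps\<^sup>2 * eps ^ p"
        using Hp claim N1' r0 e ee by (intro mult_mono power_mono) (auto simp: N_def)
      also have "\<dots> \<le> eps\<^sup>2 * eps ^ 1" using eps_power_mono[of 1 p] p5 e ee by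
          (intro mult_left_mono) auto
      finally show ?thesis using e ee by simp
    qed
    have "abs_val ((S ?m - (T1 ?m + T2 ?m + T4 ?m)) + (T1 ?m
        + T4 ?m) - fps_nth H p * fps_nth A 1 ^ p) * r ^ ?m \<le> eps ^ 3"
      by (rule scaled_diff_le[OF scaled_add_le[OF S scaled_add_le[OF t1 t4 r0(2)] r0(2)] t5 r0(2)])
    then show "abs_val (S ?m - fps_nth H p * fps_nth A 1 ^ p - T2 ?m) * r ^ ?m \<le> eps ^ 3"
      by (simp add: algebra_simps)
  qed (use e r0 in auto)
  then show ?thesis by (simp add: recursion_2p)
qed

text \<open>Modulo \<open>eps\<^sup>2\<close> the conjugation equation is linear in the logarithmic derivative \<open>L\<close> of
  \<open>A\<close>, and \<open>1 + L\<close> satisfies a Fibonacci-type recursion up to index \<open>p\<close>, where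
  \<open>log_deriv_frobenius\<close> forces a value that the recursion does not produce.\<close>

lemma resonance_generic:
  assumes \<sigma>: "eps < \<sigma>" "\<sigma> < 1" and \<alpha>': "abs_val \<alpha> * r = eps * \<sigma>" and \<beta>': "abs_val \<beta> * r\<^sup>2 = eps"
  shows "abs_val (fps_nth H p) * r ^ p = eps * \<sigma>"
proof -
  define L where "L = log_deriv A"
  \<comment> \<open>Adding 1 to \<open>L\<close> makes the linearized equation homogeneous: up to
    \<open>eps\<^sup>2\<close> it says that \<open>l * (V - \<mu>) * Z\<close> equals
    \<open>e\<close> minus a constant.\<close>
  define Z where "Z = 1 + L"
  define M where "M k = fps_nth Z k" for k
  define \<mu> where "\<mu> = 1 - l"
  define s where "s = \<alpha> / \<mu>"
  define u where "u = \<beta> / \<mu>"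
  \<comment> \<open>The error level: \<open>eps\<close> is lost in the linearization,
    \<open>\<sigma>\<^sup>2\<close> by solving the recursion only to first order in
    \<open>s\<close>. Both are below \<sigma>, the size of the term to be detected.\<close>
  define \<tau> where "\<tau> = max eps (\<sigma>\<^sup>2)"
  define e where "e = (H - fps_const l) oo (fps_X * A)"
  have \<sigma>0: "0 < \<sigma>" using \<sigma> eps_pos by simp
  have \<tau>: "0 < \<tau>" "\<tau> < \<sigma>" "eps \<le> \<tau>" "\<sigma>\<^sup>2 \<le> \<tau>"
    using \<sigma> \<sigma>0 eps_pos by (auto simp: \<tau>_def power2_eq_square)
  have \<mu>: "\<mu> \<noteq> 0" "abs_val \<mu> = eps" using eps_pos by (auto simp: eps_def \<mu>_def)
  have s: "abs_val s * r = \<sigma>" and u: "abs_val u * r\<^sup>2 = 1"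
    using \<alpha>' \<beta>' eps_pos by (simp_all add: s_def u_def abs_val_divide \<mu>)
  have \<mu>s: "\<alpha> = \<mu> * s" "\<beta> = \<mu> * u" using \<mu>(1) by (simp_all add: s_def u_def)
  have e: "fps_nth e k = (if k = p then fps_nth H p else 0)" if "k \<le> p" for k
  proof -
    have "fps_nth e k = (\<Sum>i=0..k. if i = p then fps_nth H p else 0)"
      unfolding e_def fps_compose_nth
    proof (intro sum.cong refl)
      fix i assume "i \<in> {0..k}"
      then have "i = 0 \<or> 0 < i \<and> i < p \<or> i = p \<and> k = p" using that by auto
      then consider "i = 0" | "0 < i" "i < p" | "i = p" "k = p" by blast
      then show "fps_nth (H - fps_const l) i * fps_nth ((fps_X * A) ^ i) k = (if i
          = p then fps_nth H p else 0)"
        using H0 H_eq_0[of i] A0 p5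
        by cases (auto simp: power_mult_distrib fps_X_power_mult_nth fps_power_zeroth)
    qed
    then show ?thesis using that by auto
  qed
  have "gauss_le r (eps\<^sup>2) (V + fps_const l * (fps_const l + V - 1) * L - e)"
    using conj_linearized[of r 0 "fps_const l + V" A H] r A A0 AH gauss_le_V
    unfolding L_def e_def by simp
  moreover have "V + fps_const l * (fps_const l + V - 1) * L - e =
      fps_const l * (V * Z - fps_const \<mu> * Z) + fps_const \<mu> * V + fps_const (l * \<mu>) - e"
    by (simp add: Z_def \<mu>_def algebra_simps flip: fps_const_sub fps_const_mult)
  ultimately have E: "gauss_le r (eps\<^sup>2)
      (fps_const l * (V * Z - fps_const \<mu> * Z) + fps_const \<mu> * V + fps_const (l * \<mu>) - e)" by simp
  have VZ: "fps_nth (V * Z) (Suc k) = \<alpha> * M k + (if k = 0 then 0 else \<beta> * M (k - 1))" for k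
    unfolding M_def distrib_right[of "fps_const \<alpha> * fps_X"] mult.assoc
    by (cases k) (simp_all add: numeral_2_eq_2 mult.assoc)
  have rec: "abs_val (s * M k + (if k = 0 then 0 else u * M (k - 1)) - M (Suc k) -
      (if Suc k = p then fps_nth H p / (l * \<mu>) else 0)) * r ^ Suc k \<le> eps" if "k < p" for k
  proof -
    let ?x = "s * M k + (if k = 0 then 0 else u * M (k - 1)) - M (Suc k) -
      (if Suc k = p then fps_nth H p / (l * \<mu>) else 0)"
    let ?y = "fps_nth (fps_const l * (V * Z - fps_const \<mu> * Z) +
      fps_const \<mu> * V + fps_const (l * \<mu>) - e) (Suc k)"
    have "?y = l * (\<alpha> * M k + (if k = 0 then 0 else \<beta> * M (k - 1)) - \<mu> * M (Suc k)) +
        \<mu> * fps_nth V (Suc k) - (if Suc k = p then fps_nth H p else 0)"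
      using e[of "Suc k"] that
      by (simp only: fps_add_nth fps_sub_nth fps_mult_left_const_nth VZ M_def[of "Suc k"]) simp
    also have "\<dots> = l * \<mu> * ?x + \<mu> * fps_nth V (Suc k)"
      using \<mu>(1) unfolding \<mu>s by (cases "k = 0"; cases "Suc k
          = p"; simp add: right_diff_distrib distrib_left mult_ac)
    finally have "l * \<mu> * ?x = ?y - \<mu> * fps_nth V (Suc k)" by simp
    moreover have "abs_val (\<mu> * fps_nth V (Suc k)) * r ^ Suc k \<le> eps\<^sup>2"
      using gauss_leD[OF gauss_le_V, of "Suc k"] eps_pos
      unfolding abs_val_mult \<mu> power2_eq_square mult.assoc by simp
    ultimately have "abs_val (l * \<mu> * ?x) * r ^ Suc k \<le> eps\<^sup>2"
      using gauss_leD[OF E, of "Suc k"] r0 by (simp only:) (intro scaled_diff_le)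
    then have "eps * (abs_val ?x * r ^ Suc k) \<le> eps * eps"
      unfolding abs_val_mult \<mu> abs_val_l power2_eq_square by (simp add: mult.assoc)
    then show ?thesis using eps_pos by simp
  qed
  have M0: "M 0 = 1" using A0 by (simp add: M_def Z_def L_def log_deriv_def)
  have sM: "abs_val (s * x) * r ^ Suc k \<le> \<sigma> * C" if "abs_val x * r ^ k \<le> C" for x k C
  proof -
    have "abs_val (s * x) * r ^ Suc k = (abs_val s * r) * (abs_val x * r ^ k)"
      by (simp add: abs_val_mult)
    also have "\<dots> \<le> \<sigma> * C" unfolding s using that \<sigma>0 by (intro mult_left_mono) auto
    finally show ?thesis .
  qed
  have uM: "abs_val (u * x) * r ^ Suc (Suc k) = abs_val x * r ^ k" for x k
  proof -
    have "abs_val (u * x) * r ^ Suc (Suc k) = (abs_val u * r\<^sup>2) * (abs_val x * r ^ k)"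
      by (simp add: abs_val_mult power2_eq_square)
    then show ?thesis by (simp add: u)
  qed
  have \<sigma>\<tau>: "\<sigma> * \<tau> \<le> \<tau>" using \<sigma> \<sigma>0 \<tau> by (intro mult_left_le_one_le) auto
  have u_pow: "abs_val (u ^ i) * r ^ (2 * i) = 1" for i
    using u by (simp add: abs_val_power power_mult flip: power_mult_distrib)
  have su_pow: "abs_val (of_nat n * s * u ^ i) * r ^ Suc (2 * i) \<le> \<sigma>" for n i
  proof -
    have "abs_val (s * u ^ i) * r ^ Suc (2 * i) \<le> \<sigma> * 1" using u_pow by (intro sM) simp
    then show ?thesis
      using abs_val_of_nat_mult_le[of n "s * u ^ i"] r0(2)[of "Suc (2 * i)"]
      by (metis mult.assoc mult.right_neutral mult_right_mono order_trans)
  qed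
  define Q where "Q k = s * M k + (if k = 0 then 0 else u * M (k - 1))" for k
  have QM: "abs_val (M (Suc k) - Q k) * r ^ Suc k \<le> \<tau>" if "Suc k < p" for k
    using rec[of k] that \<tau>(3) by (simp add: Q_def abs_val_minus_commute[of "M (Suc k)"])
  have Q_odd: "abs_val (Q (2 * i) - of_nat (Suc i) * s * u ^ i) * r ^ Suc (2 * i) \<le> \<tau>"
    if "abs_val (M (2 * i) - u ^ i) * r ^ (2 * i) \<le> \<tau>"
      "0 < i \<Longrightarrow> abs_val (M (2 * i - 1) - of_nat i * s * u ^ (i - 1)) * r ^ (2 * i - 1) \<le> \<tau>" for i
  proof -
    have 1: "abs_val (s * (M (2 * i) - u ^ i)) * r ^ Suc (2 * i) \<le> \<tau>"
      using sM[OF that(1)] \<sigma>\<tau> by linarith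
    show ?thesis
    proof (cases i)
      case 0
      then show ?thesis using 1 by (simp add: Q_def algebra_simps)
    next
      case (Suc j)
      have "abs_val (u * (M (Suc (2 * j)) - of_nat (Suc j) * s * u ^ j)) * r ^ Suc (Suc (Suc (2 *
          j))) \<le> \<tau>"
        using that(2) unfolding uM by (simp add: Suc)
      then have "abs_val (s * (M (2 * i) - u ^ i) + u * (M (Suc (2 * j)) - of_nat (Suc j) * s * u
          ^ j)) * r ^ Suc (2 * i) \<le> \<tau>"
        using 1 r0 by (intro scaled_add_le) (simp_all add: Suc del: power_Suc)
      moreover have "s * (M (2 * i) - u ^ i) + u * (M (Suc (2 * j)) - of_nat (Suc j) * s * u ^ j) =
          Q (2 * i) - of_nat (Suc i) * s * u ^ i"
        by (simp add: Q_def Suc algebra_simps)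
      ultimately show ?thesis by simp
    qed
  qed
  \<comment> \<open>The solution of \<open>M (k + 1) = s * M k + u * M (k - 1)\<close> with
    \<open>M 0 = 1\<close>, to first order in \<open>s\<close>: even terms are powers of
    \<open>u\<close>, and each odd term collects one more copy of \<open>s * u ^ i\<close>.\<close>
  have claim: "(2 * i < p \<longrightarrow> abs_val (M (2 * i) - u ^ i) * r ^ (2 * i) \<le> \<tau>) \<and>
      (Suc (2 * i) < p \<longrightarrow> abs_val (M (Suc (2 * i)) - of_nat (Suc i) * s * u ^ i) * r ^ Suc (2 * i)
          \<le> \<tau>)" for i
  proof (induction i)
    case 0
    have "abs_val ((M 1 - Q 0) + (Q 0 - of_nat 1 * s * u ^ 0)) * r ^ 1 \<le> \<tau>" if "1 < p"
      using that QM[of 0] Q_odd[of 0] M0 \<tau> r0 by (intro scaled_add_le) simp_all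
    then show ?case using M0 \<tau> by simp
  next
    case (Suc i)
    have even: "abs_val (M (2 * Suc i) - u ^ Suc i) * r ^ (2 * Suc i) \<le> \<tau>" if "2 * Suc i < p"
    proof -
      have odd_le: "abs_val (M (Suc (2 * i))) * r ^ Suc (2 * i) \<le> \<sigma>"
      proof -
        have "abs_val ((M (Suc (2 * i)) - of_nat (Suc i) * s * u ^ i)
            + of_nat (Suc i) * s * u ^ i) * r ^ Suc (2 * i) \<le> \<sigma>"
          using Suc.IH that su_pow[of "Suc i" i] \<tau> r0 by
              (intro scaled_add_le) (auto simp del: power_Suc of_nat_Suc)
        then show ?thesis by simp
      qed
      have "abs_val ((M (Suc (Suc (2 * i))) - Q (Suc (2 * i))) + (s * M (Suc (2 * i))
          + u * (M (2 * i) - u ^ i))) *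
          r ^ Suc (Suc (2 * i)) \<le> \<tau>"
      proof (intro scaled_add_le r0)
        show "abs_val (M (Suc (Suc (2 * i))) - Q (Suc (2 * i))) * r ^ Suc (Suc (2 * i)) \<le> \<tau>"
          using that by (intro QM) simp
        show "abs_val (s * M (Suc (2 * i))) * r ^ Suc (Suc (2 * i)) \<le> \<tau>"
          using sM[OF odd_le] \<tau>(4) by (simp add: power2_eq_square)
        show "abs_val (u * (M (2 * i) - u ^ i)) * r ^ Suc (Suc (2 * i)) \<le> \<tau>"
          unfolding uM using Suc.IH that by simp
      qed
      moreover have "(M (Suc (Suc (2 * i))) - Q (Suc (2 * i))) + (s * M (Suc (2 * i))
          + u * (M (2 * i) - u ^ i)) =
          M (2 * Suc i) - u ^ Suc i"
        by (simp add: Q_def algebra_simps)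
      ultimately show ?thesis by simp
    qed
    moreover have "abs_val (M (Suc (2 * Suc i)) - of_nat (Suc (Suc i)) * s * u ^ Suc i) * r ^ Suc
        (2 * Suc i) \<le> \<tau>"
      if "Suc (2 * Suc i) < p"
    proof -
      have "abs_val (Q (2 * Suc i) - of_nat (Suc (Suc i)) * s * u ^ Suc i) * r ^ Suc (2 * Suc i)
          \<le> \<tau>"
        using even Suc.IH that by (intro Q_odd) (auto simp del: power_Suc of_nat_Suc)
      then have "abs_val ((M (Suc (2 * Suc i)) - Q (2 * Suc i)) +
          (Q (2 * Suc i) - of_nat (Suc (Suc i)) * s * u ^ Suc i)) * r ^ Suc (2 * Suc i) \<le> \<tau>"
        using QM[OF that] r0 by (intro scaled_add_le)
      then show ?thesis by simp
    qed
    ultimately show ?case by blast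
  qed
  have "odd p" using prime_p p5 prime_odd_nat by auto
  then obtain i where i: "p = Suc (2 * i)" by (metis oddE Suc_eq_plus1)
  have i2: "0 < i" using p5 i by simp
  have Qp: "abs_val (Q (2 * i) - of_nat (Suc i) * s * u ^ i) * r ^ p \<le> \<tau>"
    unfolding i
  proof (rule Q_odd)
    show "abs_val (M (2 * i) - u ^ i) * r ^ (2 * i) \<le> \<tau>" using claim[of i] i by simp
    obtain j where "i = Suc j" using i2 by (cases i) auto
    then show "abs_val (M (2 * i - 1) - of_nat i * s * u ^ (i - 1)) * r ^ (2 * i - 1) \<le> \<tau>"
      using claim[of j] i by (simp del: power_Suc of_nat_Suc)
  qed
  \<comment> \<open>The actual value at \<open>p\<close> is the \<open>p\<close>-th power of
    \<open>M 1\<close>, hence negligible.\<close>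
  have Mp: "abs_val (M p) * r ^ p \<le> \<tau>"
  proof -
    have "M p = M 1 ^ p"
      using log_deriv_frobenius[OF A0, of 1] p5 by (simp add: M_def Z_def L_def)
    moreover have "abs_val (M 1) * r ^ 1 \<le> \<sigma>"
    proof -
      have "abs_val ((M 1 - of_nat 1 * s * u ^ 0) + of_nat 1 * s * u ^ 0) * r ^ 1 \<le> \<sigma>"
        using claim[of 0] p5 \<tau> s r0 by (intro scaled_add_le) auto
      then show ?thesis by simp
    qed
    ultimately have "abs_val (M p) * r ^ p \<le> \<sigma> ^ p"
      using r0 by (simp add: abs_val_power power_mono flip: power_mult_distrib)
    also have "\<dots> \<le> \<sigma>\<^sup>2" using \<sigma> \<sigma>0 p5 by (intro power_decreasing) auto
    finally show ?thesis using \<tau> by simp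
  qed
  let ?h = "fps_nth H p / (l * \<mu>)"
  have "abs_val ?h * r ^ p = \<sigma>"
  proof (rule scaled_eq_of_diff)
    \<comment> \<open>\<open>Suc i\<close> is \<open>(p + 1) / 2\<close>, so the value predicted by
      the recursion has size exactly \<sigma>. The discrepancy with \<open>M p\<close> must be made
      up by \<open>?h\<close>.\<close>
    have "\<not> p dvd Suc i" using i i2 by (auto dest: dvd_imp_le)
    then have "abs_val (of_nat (Suc i) :: 'a) = 1" by (rule abs_val_nat_unit)
    then have "abs_val (of_nat (Suc i) * s * u ^ i) * r ^ p
        = (abs_val s * r) * (abs_val (u ^ i) * r ^ (2 * i))"
      unfolding i by (simp only: abs_val_mult) simp
    then show "abs_val (of_nat (Suc i) * s * u ^ i) * r ^ p = \<sigma>" by (simp add: s u_pow)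
    have h: "abs_val (Q (2 * i) - M p - ?h) * r ^ p \<le> \<tau>"
      using rec[of "2 * i"] i i2 \<tau>(3) unfolding Q_def by (simp del: power_Suc)
    have "abs_val ((Q (2 * i) - of_nat (Suc i) * s * u ^ i) - M p - (Q (2 * i) - M p - ?h)) * r ^
        p \<le> \<tau>"
      by (rule scaled_diff_le[OF scaled_diff_le[OF Qp Mp r0(2)] h r0(2)])
    then show "abs_val (?h - of_nat (Suc i) * s * u ^ i) * r ^ p \<le> \<tau>"
      by (simp add: algebra_simps)
  qed (use \<tau> r0 in auto)
  moreover have "abs_val ?h = abs_val (fps_nth H p) / eps"
    by (simp only: abs_val_divide abs_val_mult abs_val_l \<mu> mult_1)
  ultimately have "abs_val (fps_nth H p) / eps * r ^ p = \<sigma>" by simp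
  then show ?thesis using eps_pos by (simp add: field_simps)
qed

end

section \<open>Non-linearizable cubic polynomials\<close>

text \<open>The terms are differences of consecutive partial sums, so their absolute values tend to
  0.\<close>

lemma bounded_terms_of_summable:
  fixes f :: "nat \<Rightarrow> 'a::nonarchimedean_field"
  assumes "summable f"
  obtains C where "\<And>n. abs_val (f n) \<le> C"
proof -
  obtain s where s: "(\<lambda>n. \<Sum>i<n. f i) \<longlonglongrightarrow> s"
    using summable_LIMSEQ[OF assms] by blast
  have "(\<lambda>n. dist (\<Sum>i<Suc n. f i) (\<Sum>i<n. f i)) \<longlonglongrightarrow> dist s s"
    by (intro tendsto_dist s LIMSEQ_Suc[OF s])
  then have "(\<lambda>n. abs_val (f n)) \<longlonglongrightarrow> 0" by (simp add: abs_val_dist)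
  then have "Bseq (\<lambda>n. abs_val (f n))" by (intro convergent_imp_Bseq convergentI)
  then show thesis using that by (auto simp: Bseq_def)
qed

context near_one_multiplier
begin

text \<open>Translates convergence into a Gauss bound: the linear coefficient is scaled to 1 and the
  disc is shrunk until the linear term dominates.\<close>

lemma integral_linearization:
  assumes "linearizable f" "fps_nth f 1 = l"
  obtains h R where "0 < R" "fps_nth h 0 = 0" "fps_nth h 1 = 1" "gauss_le R R h"
    "h oo f = fps_const l * h"
proof -
  obtain g where f0: "fps_nth f 0 = 0" and g: "fps_nth g 0 = 0" "locally_analytic g"
      "fps_nth g 1 \<noteq> 0"
    "g oo f oo fps_inv g = fps_const l * fps_X"
    using assms unfolding linearizable_def analytic_germ_fixing_0_def by blast
  obtain r where r: "0 < r" "\<And>z. abs_val z < r \<Longrightarrow> summable (\<lambda>n. fps_nth g n * z ^ n)"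
    using g(2) unfolding locally_analytic_def by blast
  \<comment> \<open>Powers of \<open>1 - l\<close> supply nonzero points arbitrarily close to 0 at
    which convergence can be tested.\<close>
  obtain k where k: "eps ^ k < r" using real_arch_pow_inv[OF r(1) eps_less_1] by blast
  have z: "abs_val ((1 - l) ^ k) = eps ^ k" by (simp add: abs_val_power eps_def)
  have "summable (\<lambda>n. fps_nth g n * ((1 - l) ^ k) ^ n)" using k by (intro r(2)) (simp add: z)
  from bounded_terms_of_summable[OF this]
  obtain C where C: "\<And>n. abs_val (fps_nth g n * ((1 - l) ^ k) ^ n) \<le> C"
    by blast
  define \<rho> where "\<rho> = eps ^ k"
  define C' where "C' = C / abs_val (fps_nth g 1)"
  \<comment> \<open>Shrinking the radius by \<open>t\<close> gains at least \<open>t\<^sup>2\<close>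
    on the terms of degree at least 2, and this \<open>t\<close> satisfies
    \<open>C' * t \<le> \<rho>\<close>.\<close>
  define t where "t = 1 / (1 + C' / \<rho>)"
  define h where "h = fps_const (1 / fps_nth g 1) * g"
  have \<rho>: "0 < \<rho>" using eps_pos by (simp add: \<rho>_def)
  have h_le: "abs_val (fps_nth h n) * \<rho> ^ n \<le> C'" for n
    using C[of n] z g(3) by (simp add: h_def C'_def \<rho>_def abs_val_mult abs_val_divide
        abs_val_power divide_right_mono)
  have C'0: "0 \<le> C'" using h_le[of 0] abs_val_nonneg[of "fps_nth h 0"] by (simp del: abs_val_nonneg)
  have pos: "0 < 1 + C' / \<rho>" "1 \<le> 1 + C' / \<rho>" using C'0 \<rho> by (simp_all add: add_pos_nonneg)
  then have t: "0 < t" "t \<le> 1" unfolding t_def by (simp_all add: divide_le_eq_1_pos)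
  have "C' \<le> \<rho> * (1 + C' / \<rho>)" using \<rho> by (simp add: field_simps)
  with pos(1) have Ct: "C' * t \<le> \<rho>" unfolding t_def by (simp add: pos_divide_le_eq)
  have h: "fps_nth h 0 = 0" "fps_nth h 1 = 1" using g by (auto simp: h_def)
  have "gauss_le (\<rho> * t) (\<rho> * t) h"
    unfolding gauss_le_def
  proof
    fix n :: nat
    consider "n = 0" | "n = 1" | "2 \<le> n" by linarith
    then show "abs_val (fps_nth h n) * (\<rho> * t) ^ n \<le> \<rho> * t"
    proof cases
      case 3
      have "abs_val (fps_nth h n) * (\<rho> * t) ^ n = (abs_val (fps_nth h n) * \<rho> ^ n) * t ^ n"
        by (simp add: power_mult_distrib)
      also have "\<dots> \<le> C' * t\<^sup>2"
        using 3 t C'0 h_le by (intro mult_mono power_decreasing) auto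
      also have "\<dots> = (C' * t) * t" by (simp add: power2_eq_square)
      also have "\<dots> \<le> \<rho> * t" using Ct t by (intro mult_right_mono) auto
      finally show ?thesis .
    qed (use h \<rho> t in auto)
  qed
  moreover have "h oo f = fps_const l * h"
  proof -
    have i: "fps_inv g oo g = fps_X" "fps_nth (fps_inv g) 0 = 0"
      using g by (rule_tac fps_inv, simp_all) (simp add: fps_inv_def)
    have "g oo f = (g oo f) oo (fps_inv g oo g)" by (simp add: i)
    also have "\<dots> = (g oo f oo fps_inv g) oo g" using g i by (intro fps_compose_assoc) auto
    also have "\<dots> = fps_const l * g"
      unfolding g(4) using g by (simp add: fps_compose_mult_distrib fps_X_fps_compose_startby0)
    finally have "g oo f = fps_const l * g" .
    then show ?thesis using f0 by (simp add: h_def fps_compose_mult_distrib mult.left_commute)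
  qed
  ultimately show thesis using that[of "\<rho> * t" h] h \<rho> t by simp
qed

lemma cubic_normal_form_exists:
  assumes "5 \<le> p" "0 < r" "abs_val \<alpha> * r \<le> eps" "abs_val \<beta> * r\<^sup>2 \<le> eps"
  obtains A H where "cubic_normal_form p l \<alpha> \<beta> r A H" "gauss_le r eps (H - fps_const l)"
proof -
  let ?V = "fps_const \<alpha> * fps_X + fps_const \<beta> * fps_X\<^sup>2"
  have "gauss_le r eps ?V"
    using assms gauss_le_monomial[of r \<alpha> 1 eps] gauss_le_monomial[of r \<beta> 2 eps]
    by (intro gauss_le_add) auto
  then obtain A H where "fps_nth A 0 = 1" "gauss_le r 1 A"
    "\<And>k. 0 < k \<Longrightarrow> p dvd k \<Longrightarrow> fps_nth A k = 0"
    "fps_nth H 0 = l" "gauss_le r eps (H - fps_const l)"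
    "\<And>k. \<not> p dvd k \<Longrightarrow> fps_nth H k = 0"
    "conj_defect 1 (fps_const l + ?V) A H = 0"
    using normal_form[of r "fps_const l + ?V" 0] assms(2) by (auto simp: fps_X_power_nth)
  then show thesis
    using assms by (intro that[of A H]) (unfold_locales, auto)
qed

lemma cubic_no_integral_linearization:
  assumes p5: "5 \<le> p" and a1: "a1 \<noteq> 0" and ge: "1 \<le> abs_val (1 - a2 / a1\<^sup>2)"
    and ne: "abs_val (1 - a2 / a1\<^sup>2) \<noteq> 1 / eps"
    and h: "0 < R" "fps_nth h 0 = 0" "fps_nth h 1 = 1" "gauss_le R R h"
      "h oo (fps_X * (fps_const l + (fps_const a1 * fps_X + fps_const a2 * fps_X\<^sup>2)))
          = fps_const l * h"
  shows False
proof -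
  define a where "a = a2 / a1\<^sup>2"
  define d where "d = abs_val (1 - a)"
  have a2: "a2 = a * a1\<^sup>2" using a1 by (simp add: a_def)
  have d1: "1 \<le> d" using ge by (simp add: d_def a_def)
  have a_le: "abs_val a \<le> d"
    using abs_val_diff_le[of 1 d "1 - a"] d1 by (simp add: d_def)
  have resonance: False if res: "0 < r" "abs_val a1 * r \<le> eps" "abs_val a2 * r\<^sup>2 \<le> eps"
    "\<And>A H. cubic_normal_form p l a1 a2 r A H \<Longrightarrow>
      \<exists>J\<in>{1, 2}. eps\<^sup>2 \<le> abs_val (fps_nth H (p * J)) * r ^ (p * J)" for r
  proof -
    obtain A H where AH: "cubic_normal_form p l a1 a2 r A H" "gauss_le r eps (H - fps_const l)"
      using cubic_normal_form_exists[OF p5 res(1-3)] by blast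
    interpret C: cubic_normal_form p l a1 a2 r A H by (rule AH(1))
    show False
      using no_linearization_of_resonance[OF p5 res(1) C.A0 C.A C.H0 AH(2) C.H C.AH _ _ h]
          res(4)[OF AH(1)]
      by blast
  qed
  show False
  proof (cases "d < 1 / eps")
    case True
    \<comment> \<open>On this disc the quadratic term has size exactly \<open>eps\<close>, and
      \<open>eps * d\<close> takes the role of \<delta> in
      \<open>resonance_balanced\<close>.\<close>
    define r where "r = eps / abs_val a1"
    have r: "0 < r" "abs_val a1 * r = eps" using a1 eps_pos by (auto simp: r_def)
    have ar: "abs_val (x * a1\<^sup>2) * r\<^sup>2 = abs_val x * eps\<^sup>2" for x
      unfolding r(2)[symmetric] by (simp add: abs_val_mult abs_val_power power_mult_distrib)
    have \<delta>: "eps \<le> eps * d" "eps * d < 1" using d1 eps_pos True by (auto simp: field_simps)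
    have a2r: "abs_val a2 * r\<^sup>2 \<le> eps * (eps * d)"
      using a_le eps_pos unfolding a2 ar by (simp add: power2_eq_square)
    \<comment> \<open>Replacing \<open>1 - a\<close> by \<open>1 - l * a\<close> costs
      \<open>(1 - l) * a\<close>, of size at most \<open>eps * d < d\<close>.\<close>
    have "abs_val (1 - l * a) = d"
    proof -
      have "abs_val ((1 - l * a) - (1 - a)) = eps * abs_val a"
      proof -
        have "(1 - l * a) - (1 - a) = (1 - l) * a" by (simp add: algebra_simps)
        then show ?thesis by (simp add: abs_val_mult eps_def)
      qed
      also have "\<dots> \<le> eps * d" using a_le eps_pos by simp
      also have "\<dots> < d" using d1 eps_less_1 by simp
      finally show ?thesis using abs_val_eq_of_diff d_def by metis
    qed
    moreover have "a1\<^sup>2 - l * a2 = (1 - l * a) * a1\<^sup>2" by (simp add: a2 algebra_simps)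
    ultimately have a12: "abs_val (a1\<^sup>2 - l * a2) * r\<^sup>2 = eps * (eps * d)"
      by (simp only: ar) (simp add: power2_eq_square)
    show False
    proof (rule resonance[OF r(1)])
      show "abs_val a2 * r\<^sup>2 \<le> eps" using a2r \<delta> eps_pos mult_left_le[of "eps * d" eps] by linarith
      fix A H assume "cubic_normal_form p l a1 a2 r A H"
      then interpret C: cubic_normal_form p l a1 a2 r A H .
      have "abs_val (fps_nth H (p * 1)) * r ^ (p * 1) = eps * (eps * d)"
        using C.resonance_balanced[OF \<delta> r(2) a2r a12] by simp
      then show "\<exists>J\<in>{1, 2}. eps\<^sup>2 \<le> abs_val (fps_nth H (p * J)) * r ^ (p * J)"
        using \<delta> eps_pos by (intro bexI[of _ 1]) (auto simp: power2_eq_square)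
    qed (use r in simp)
  next
    case False
    then have d: "1 / eps < d" using ne by (simp add: d_def a_def)
    moreover have "1 < 1 / eps" using eps_pos eps_less_1 by simp
    ultimately have "1 < d" by (rule less_trans[rotated])
    then have ad: "abs_val a = d"
      using abs_val_eq_of_diff[of a "a - 1"] by (simp add: d_def abs_val_minus_commute)
    then have a2_0: "a2 \<noteq> 0" using a1 d1 by (auto simp: a2)
    \<comment> \<open>Now the cubic term has size exactly \<open>eps\<close>.\<close>
    define r where "r = sqrt (eps / abs_val a2)"
    have r: "0 < r" "r\<^sup>2 = eps / abs_val a2" using a2_0 eps_pos by (auto simp: r_def)
    have a2r: "abs_val a2 * r\<^sup>2 = eps" using a2_0 by (simp add: r)
    define \<sigma> where "\<sigma> = abs_val a1 * r / eps"
    have a1r: "abs_val a1 * r = eps * \<sigma>" using eps_pos by (simp add: \<sigma>_def)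
    have "\<sigma>\<^sup>2 = (abs_val a1)\<^sup>2 * r\<^sup>2 / eps\<^sup>2"
      by (simp add: \<sigma>_def power_divide power_mult_distrib)
    also have "\<dots> = 1 / (eps * d)"
      using eps_pos a1 unfolding r(2) a2 by (simp add: abs_val_mult abs_val_power ad
          power2_eq_square)
    also have "\<dots> < 1" using d eps_pos by (simp add: field_simps)
    finally have \<sigma>: "\<sigma> < 1" by (metis abs_ge_self le_less_trans abs_square_less_1)
    show False
    proof (rule resonance[OF r(1)])
      show "abs_val a1 * r \<le> eps" using a1r \<sigma> eps_pos by simp
      fix A H assume "cubic_normal_form p l a1 a2 r A H"
      then interpret C: cubic_normal_form p l a1 a2 r A H .
      show "\<exists>J\<in>{1, 2}. eps\<^sup>2 \<le> abs_val (fps_nth H (p * J)) * r ^ (p * J)"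
      proof (cases "eps < \<sigma>")
        case True
        then have "abs_val (fps_nth H (p * 1)) * r ^ (p * 1) = eps * \<sigma>"
          using C.resonance_generic[OF True \<sigma> a1r a2r] by simp
        then show ?thesis
          using True eps_pos by (intro bexI[of _ 1]) (auto simp: power2_eq_square)
      next
        case False
        then have "abs_val a1 * r \<le> eps\<^sup>2" using a1r eps_pos by (simp add: power2_eq_square)
        then have "abs_val (fps_nth H (p * 2)) * r ^ (p * 2) = eps\<^sup>2"
          using C.resonance_nearly_odd a2r by (simp add: mult.commute)
        then show ?thesis by (intro bexI[of _ 2]) auto
      qed
    qed (use a2r in simp)
  qed
qed

end

theorem theorem1p7:
  fixes p :: nat and l a1 a2 :: "'a::complete_nonarchimedean_field"
  assumes "prime p" and "p \<ge> 5"
    and "CHAR('a) = p"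
    and "\<forall>n>0. l ^ n \<noteq> 1"
    and "abs_val (1 - l) < 1"
    and "a1 \<noteq> 0"
    and "abs_val (1 - a2 / a1\<^sup>2) \<ge> 1"
    and "abs_val (1 - a2 / a1\<^sup>2) \<noteq> 1 / abs_val (1 - l)"
  shows "non_linearizable (fps_of_poly [:0, l, a1, a2:])"
proof -
  interpret near_one_multiplier p l
    using assms by unfold_locales auto
  let ?f = "fps_of_poly [:0, l, a1, a2:]"
  let ?F = "fps_const l + (fps_const a1 * fps_X + fps_const a2 * fps_X\<^sup>2)"
  have f: "?f = fps_X * ?F"
    by (simp add: fps_of_poly_pCons algebra_simps power2_eq_square)
  have "summable (\<lambda>n. fps_nth ?f n * z ^ n)" for z
  proof (rule summable_finite[of "{..3}"])
    fix n :: nat assume "n \<notin> {..3}"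
    then have "n = Suc (Suc (Suc (Suc (n - 4))))" by simp
    then have "coeff [:0, l, a1, a2:] n = 0" by (metis coeff_pCons_Suc coeff_0)
    then show "fps_nth ?f n * z ^ n = 0" by simp
  qed simp
  then have "analytic_germ_fixing_0 ?f"
    unfolding analytic_germ_fixing_0_def locally_analytic_def by (auto intro: exI[of _ 1])
  moreover have "\<not> linearizable ?f"
  proof
    assume "linearizable ?f"
    then obtain h R where h: "0 < R" "fps_nth h 0 = 0" "fps_nth h 1 = 1" "gauss_le R R h"
      "h oo ?f = fps_const l * h"
      by (rule integral_linearization) simp
    show False
      using cubic_no_integral_linearization[OF assms(2,6,7) _ h(1-4)] h(5) assms(8)
      unfolding f eps_def by blast
  qed
  ultimately show ?thesis by (simp add: non_linearizable_def)
qed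

end
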